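(* Let $\Bbbk$ be a field, let $m,n$ be integers greater than $1$ with $n$ dividing $m$, let $\omega\in\Bbbk$ be a primitive $n$-th root of unity, let $I$ be a non-empty set, let $q_i\in\Bbbk^\times$ for $i\in I$, and let $\alpha\in\Bbbk$; suppose $m=n$ when $\alpha\ne0$. Let $\mathcal D$ be the $\Bbbk$-algebra presented by generators $u,x,a_i^{\pm1}$ ($i\in I$) and relations $$u^m=1,\quad x^n=0,\quad a_i^{\pm1}a_i^{\mp1}=1,\quad ux=\omega xu,\quad ua_i=a_iu,\quad a_ix=q_ixa_i,\quad a_ia_j=a_ja_i\quad(i,j\in I).$$ Then $\mathcal D$ bears a Hopf algebra structure uniquely defined by $$\Delta(u)=u\otimes u,\qquad\Delta(x)=u\otimes x+x\otimes1,$$ $$\Delta(a_i^{\pm1})=a_i^{\pm1}\otimes a_i^{\pm1}+\alpha(1-q_i^{\pm n})\sum_{k=1}^{n-1}\frac{1}{(k)!_\omega(n-k)!_\omega}\,x^{n-k}u^ka_i^{\pm1}\otimes x^ka_i^{\pm1},$$ $$\varepsilon(u)=1,\quad\varepsilon(x)=0,\quad\varepsilon(a_i^{\pm1})=1,$$ $$\mathcal S(u)=u^{m-1},\quad\mathcal S(x)=-u^{m-1}x,\quad\mathcal S(a_i^{\pm1})=a_i^{\mp1},\qquad i\in I.$$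
   Context: Notation: $(k)_\omega=\sum_{j=0}^{k-1}\omega^j$ and $(k)!_\omega=\prod_{j=1}^k(j)_\omega$. *)

theory Defs
  imports "HOL-Algebra.QuotRing" "HOL-Algebra.Module"
begin

section \<open>Associative unital algebras over a field\<close>

text \<open>The locale \<open>algebra\<close> of HOL-Algebra is restricted to commutative algebras.\<close>

locale assoc_algebra = K?: field K + module K A + A?: ring A for K (structure) and A (structure) +
  assumes smult_mult_left: "\<lbrakk>c \<in> carrier K; x \<in> carrier A; y \<in> carrier A\<rbrakk> \<Longrightarrow>
      (c \<odot>\<^bsub>A\<^esub> x) \<otimes>\<^bsub>A\<^esub> y = c \<odot>\<^bsub>A\<^esub> (x \<otimes>\<^bsub>A\<^esub> y)"
    and smult_mult_right: "\<lbrakk>c \<in> carrier K; x \<in> carrier A; y \<in> carrier A\<rbrakk> \<Longrightarrow>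
      x \<otimes>\<^bsub>A\<^esub> (c \<odot>\<^bsub>A\<^esub> y) = c \<odot>\<^bsub>A\<^esub> (x \<otimes>\<^bsub>A\<^esub> y)"

definition linear_maps :: "('k, 'z) ring_scheme \<Rightarrow> ('k, 'a) module \<Rightarrow> ('k, 'b) module \<Rightarrow> ('a \<Rightarrow> 'b) set" where
  "linear_maps K V W = {f \<in> carrier V \<rightarrow> carrier W.
     (\<forall>x\<in>carrier V. \<forall>y\<in>carrier V. f (x \<oplus>\<^bsub>V\<^esub> y) = f x \<oplus>\<^bsub>W\<^esub> f y) \<and>
     (\<forall>c\<in>carrier K. \<forall>x\<in>carrier V. f (c \<odot>\<^bsub>V\<^esub> x) = c \<odot>\<^bsub>W\<^esub> f x)}"

definition algebra_homs :: "('k, 'z) ring_scheme \<Rightarrow> ('k, 'a) module \<Rightarrow> ('k, 'b) module \<Rightarrow> ('a \<Rightarrow> 'b) set" where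
  "algebra_homs K A B = ring_hom A B \<inter> linear_maps K A B"

definition ground_algebra :: "('k, 'z) ring_scheme \<Rightarrow> ('k, 'k) module" where
  "ground_algebra K = \<lparr>carrier = carrier K, mult = mult K, one = \<one>\<^bsub>K\<^esub>, zero = \<zero>\<^bsub>K\<^esub>,
     add = add K, smult = mult K\<rparr>"

definition quotient_algebra :: "('k, 'a) module \<Rightarrow> 'a set \<Rightarrow> ('k, 'a set) module" where
  "quotient_algebra A J =
     ring.extend (A Quot J) (module.fields (\<lambda>c X. \<Union>x\<in>X. J +>\<^bsub>A\<^esub> (c \<odot>\<^bsub>A\<^esub> x)))"


section \<open>Monoid algebras and presentations\<close>

definition fsupp :: "('k, 'z) ring_scheme \<Rightarrow> ('m \<Rightarrow> 'k) \<Rightarrow> 'm set" where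
  "fsupp K f = {w. f w \<noteq> \<zero>\<^bsub>K\<^esub>}"

definition monoid_algebra ::
    "('k, 'z) ring_scheme \<Rightarrow> ('m, 'y) monoid_scheme \<Rightarrow> ('k, 'm \<Rightarrow> 'k) module" where
  "monoid_algebra K G = \<lparr>
     carrier = {f. range f \<subseteq> carrier K \<and> fsupp K f \<subseteq> carrier G \<and> finite (fsupp K f)},
     mult = (\<lambda>f g w. \<Oplus>\<^bsub>K\<^esub>p\<in>{p \<in> fsupp K f \<times> fsupp K g. fst p \<otimes>\<^bsub>G\<^esub> snd p = w}.
               f (fst p) \<otimes>\<^bsub>K\<^esub> g (snd p)),
     one = (\<lambda>w. if w = \<one>\<^bsub>G\<^esub> then \<one>\<^bsub>K\<^esub> else \<zero>\<^bsub>K\<^esub>),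
     zero = (\<lambda>w. \<zero>\<^bsub>K\<^esub>),
     add = (\<lambda>f g w. f w \<oplus>\<^bsub>K\<^esub> g w),
     smult = (\<lambda>c f w. c \<otimes>\<^bsub>K\<^esub> f w)\<rparr>"

definition basis_elem :: "('k, 'z) ring_scheme \<Rightarrow> 'm \<Rightarrow> ('m \<Rightarrow> 'k)" where
  "basis_elem K w = (\<lambda>v. if v = w then \<one>\<^bsub>K\<^esub> else \<zero>\<^bsub>K\<^esub>)"

definition free_monoid :: "'g set \<Rightarrow> 'g list monoid" where
  "free_monoid S = \<lparr>carrier = lists S, mult = (@), one = []\<rparr>"

definition free_algebra :: "('k, 'z) ring_scheme \<Rightarrow> 'g set \<Rightarrow> ('k, 'g list \<Rightarrow> 'k) module" where
  "free_algebra K S = monoid_algebra K (free_monoid S)"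

definition free_gen :: "('k, 'z) ring_scheme \<Rightarrow> 'g \<Rightarrow> ('g list \<Rightarrow> 'k)" where
  "free_gen K g = basis_elem K [g]"

text \<open>A pair \<open>(l, r)\<close> in \<open>R\<close> stands for the relation \<open>l = r\<close>.\<close>

definition relation_ideal :: "('k, 'z) ring_scheme \<Rightarrow> 'g set \<Rightarrow>
    (('g list \<Rightarrow> 'k) \<times> ('g list \<Rightarrow> 'k)) set \<Rightarrow> ('g list \<Rightarrow> 'k) set" where
  "relation_ideal K S R =
     Idl\<^bsub>free_algebra K S\<^esub> ((\<lambda>(l, r). l \<ominus>\<^bsub>free_algebra K S\<^esub> r) ` R)"

definition presented_algebra :: "('k, 'z) ring_scheme \<Rightarrow> 'g set \<Rightarrow>
    (('g list \<Rightarrow> 'k) \<times> ('g list \<Rightarrow> 'k)) set \<Rightarrow> ('k, ('g list \<Rightarrow> 'k) set) module" where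
  "presented_algebra K S R = quotient_algebra (free_algebra K S) (relation_ideal K S R)"

definition presented_gen :: "('k, 'z) ring_scheme \<Rightarrow> 'g set \<Rightarrow>
    (('g list \<Rightarrow> 'k) \<times> ('g list \<Rightarrow> 'k)) set \<Rightarrow> 'g \<Rightarrow> ('g list \<Rightarrow> 'k) set" where
  "presented_gen K S R g = relation_ideal K S R +>\<^bsub>free_algebra K S\<^esub> free_gen K g"


section \<open>Tensor products of algebras\<close>

text \<open>The vector space \<open>A \<otimes> B\<close> is the free vector space on \<open>carrier A \<times> carrier B\<close> modulo the
  span of the bilinearity relators. In the monoid algebra of the multiplicative monoid
  \<open>A \<times>\<times> B\<close>, whose underlying vector space is that free vector space, the product of a
  basis element and a relator is a relator, so this span is the two-sided ideal generated by
  the relators, and the quotient carries the usual product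
  \<open>(a \<otimes> b) (a' \<otimes> b') = a a' \<otimes> b b'\<close>.\<close>

definition tensor_relators ::
    "('k, 'z) ring_scheme \<Rightarrow> ('k, 'a) module \<Rightarrow> ('k, 'b) module \<Rightarrow> ('a \<times> 'b \<Rightarrow> 'k) set" where
  "tensor_relators K A B =
     (let F = monoid_algebra K (A \<times>\<times> B); e = basis_elem K in
       {e (a \<oplus>\<^bsub>A\<^esub> a', b) \<ominus>\<^bsub>F\<^esub> (e (a, b) \<oplus>\<^bsub>F\<^esub> e (a', b)) | a a' b.
          a \<in> carrier A \<and> a' \<in> carrier A \<and> b \<in> carrier B} \<union>
       {e (a, b \<oplus>\<^bsub>B\<^esub> b') \<ominus>\<^bsub>F\<^esub> (e (a, b) \<oplus>\<^bsub>F\<^esub> e (a, b')) | a b b'.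
          a \<in> carrier A \<and> b \<in> carrier B \<and> b' \<in> carrier B} \<union>
       {e (c \<odot>\<^bsub>A\<^esub> a, b) \<ominus>\<^bsub>F\<^esub> c \<odot>\<^bsub>F\<^esub> e (a, b) | c a b.
          c \<in> carrier K \<and> a \<in> carrier A \<and> b \<in> carrier B} \<union>
       {e (a, c \<odot>\<^bsub>B\<^esub> b) \<ominus>\<^bsub>F\<^esub> c \<odot>\<^bsub>F\<^esub> e (a, b) | c a b.
          c \<in> carrier K \<and> a \<in> carrier A \<and> b \<in> carrier B})"

definition tensor_ideal ::
    "('k, 'z) ring_scheme \<Rightarrow> ('k, 'a) module \<Rightarrow> ('k, 'b) module \<Rightarrow> ('a \<times> 'b \<Rightarrow> 'k) set" where
  "tensor_ideal K A B = Idl\<^bsub>monoid_algebra K (A \<times>\<times> B)\<^esub> (tensor_relators K A B)"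

definition tensor_algebra ::
    "('k, 'z) ring_scheme \<Rightarrow> ('k, 'a) module \<Rightarrow> ('k, 'b) module \<Rightarrow> ('k, ('a \<times> 'b \<Rightarrow> 'k) set) module" where
  "tensor_algebra K A B = quotient_algebra (monoid_algebra K (A \<times>\<times> B)) (tensor_ideal K A B)"

definition pure_tensor ::
    "('k, 'z) ring_scheme \<Rightarrow> ('k, 'a) module \<Rightarrow> ('k, 'b) module \<Rightarrow> 'a \<Rightarrow> 'b \<Rightarrow> ('a \<times> 'b \<Rightarrow> 'k) set" where
  "pure_tensor K A B a b = tensor_ideal K A B +>\<^bsub>monoid_algebra K (A \<times>\<times> B)\<^esub> basis_elem K (a, b)"

text \<open>For bilinear \<open>\<beta> : A \<times> B \<rightarrow> V\<close>, \<open>tensor_lift K V \<beta>\<close> is the linear map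
  \<open>A \<otimes> B \<rightarrow> V\<close> with \<open>a \<otimes> b \<mapsto> \<beta> a b\<close>: the linear extension of \<open>\<beta>\<close> takes the
  same value on all representatives \<open>t\<close> of a class \<open>T\<close>.\<close>

definition tensor_lift ::
    "('k, 'z) ring_scheme \<Rightarrow> ('k, 'v) module \<Rightarrow> ('a \<Rightarrow> 'b \<Rightarrow> 'v) \<Rightarrow> ('a \<times> 'b \<Rightarrow> 'k) set \<Rightarrow> 'v" where
  "tensor_lift K V \<beta> T =
     the_elem ((\<lambda>t. \<Oplus>\<^bsub>V\<^esub>p\<in>fsupp K t. t p \<odot>\<^bsub>V\<^esub> \<beta> (fst p) (snd p)) ` T)"

definition tensor_map :: "('k, 'z) ring_scheme \<Rightarrow> ('k, 'c) module \<Rightarrow> ('k, 'd) module \<Rightarrow>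
    ('a \<Rightarrow> 'c) \<Rightarrow> ('b \<Rightarrow> 'd) \<Rightarrow> ('a \<times> 'b \<Rightarrow> 'k) set \<Rightarrow> ('c \<times> 'd \<Rightarrow> 'k) set" where
  "tensor_map K C D f g =
     tensor_lift K (tensor_algebra K C D) (\<lambda>a b. pure_tensor K C D (f a) (g b))"

text \<open>The canonical isomorphism \<open>(A \<otimes> B) \<otimes> C \<rightarrow> A \<otimes> (B \<otimes> C)\<close>.\<close>

definition tensor_assoc ::
    "('k, 'z) ring_scheme \<Rightarrow> ('k, 'a) module \<Rightarrow> ('k, 'b) module \<Rightarrow> ('k, 'c) module \<Rightarrow>
     (('a \<times> 'b \<Rightarrow> 'k) set \<times> 'c \<Rightarrow> 'k) set \<Rightarrow> ('a \<times> ('b \<times> 'c \<Rightarrow> 'k) set \<Rightarrow> 'k) set" where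
  "tensor_assoc K A B C =
     (let BC = tensor_algebra K B C; ABC = tensor_algebra K A BC in
       tensor_lift K ABC (\<lambda>s c.
         tensor_lift K ABC (\<lambda>a b. pure_tensor K A BC a (pure_tensor K B C b c)) s))"


section \<open>Hopf algebras\<close>

text \<open>In the counit axioms \<open>K \<otimes> H\<close> and \<open>H \<otimes> K\<close> are identified with \<open>H\<close> via scalar
  multiplication. The antipode is a linear map that is a two-sided convolution inverse of the
  identity.\<close>


locale bialgebra = assoc_algebra K H for K (structure) and H (structure) +
  fixes \<Delta> :: "'b \<Rightarrow> ('b \<times> 'b \<Rightarrow> 'a) set" and \<epsilon> :: "'b \<Rightarrow> 'a"
  assumes comult_hom: "\<Delta> \<in> algebra_homs K H (tensor_algebra K H H)"
    and counit_hom: "\<epsilon> \<in> algebra_homs K H (ground_algebra K)"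
    and coassoc: "h \<in> carrier H \<Longrightarrow>
      tensor_assoc K H H H (tensor_map K (tensor_algebra K H H) H \<Delta> (\<lambda>a. a) (\<Delta> h)) =
      tensor_map K H (tensor_algebra K H H) (\<lambda>a. a) \<Delta> (\<Delta> h)"
    and counit_left: "h \<in> carrier H \<Longrightarrow> tensor_lift K H (\<lambda>a b. \<epsilon> a \<odot>\<^bsub>H\<^esub> b) (\<Delta> h) = h"
    and counit_right: "h \<in> carrier H \<Longrightarrow> tensor_lift K H (\<lambda>a b. \<epsilon> b \<odot>\<^bsub>H\<^esub> a) (\<Delta> h) = h"

locale hopf_algebra = bialgebra K H \<Delta> \<epsilon> for K (structure) and H (structure) and \<Delta> \<epsilon> +
  fixes S :: "'b \<Rightarrow> 'b"
  assumes antipode_linear: "S \<in> linear_maps K H H"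
    and antipode_left: "h \<in> carrier H \<Longrightarrow>
      tensor_lift K H (\<lambda>a b. S a \<otimes>\<^bsub>H\<^esub> b) (\<Delta> h) = \<epsilon> h \<odot>\<^bsub>H\<^esub> \<one>\<^bsub>H\<^esub>"
    and antipode_right: "h \<in> carrier H \<Longrightarrow>
      tensor_lift K H (\<lambda>a b. a \<otimes>\<^bsub>H\<^esub> S b) (\<Delta> h) = \<epsilon> h \<odot>\<^bsub>H\<^esub> \<one>\<^bsub>H\<^esub>"


section \<open>Roots of unity and quantum factorials\<close>

definition primitive_root_of_unity :: "('k, 'z) ring_scheme \<Rightarrow> nat \<Rightarrow> 'k \<Rightarrow> bool" where
  "primitive_root_of_unity K n \<omega> \<longleftrightarrow> \<omega> \<in> carrier K \<and> n > 0 \<and> \<omega> [^]\<^bsub>K\<^esub> n = \<one>\<^bsub>K\<^esub> \<and>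
     (\<forall>k. 0 < k \<and> k < n \<longrightarrow> \<omega> [^]\<^bsub>K\<^esub> k \<noteq> \<one>\<^bsub>K\<^esub>)"

definition q_int :: "('k, 'z) ring_scheme \<Rightarrow> 'k \<Rightarrow> nat \<Rightarrow> 'k" where
  "q_int K \<omega> k = (\<Oplus>\<^bsub>K\<^esub>j\<in>{..<k}. \<omega> [^]\<^bsub>K\<^esub> j)"

definition q_fact :: "('k, 'z) ring_scheme \<Rightarrow> 'k \<Rightarrow> nat \<Rightarrow> 'k" where
  "q_fact K \<omega> k = (\<Otimes>\<^bsub>K\<^esub>j\<in>{1..k}. q_int K \<omega> j)"


section \<open>The algebra D\<close>

datatype 'i gen = Gen_u | Gen_x | Gen_a 'i | Gen_a_inv 'i

definition D_gens :: "'i set \<Rightarrow> 'i gen set" where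
  "D_gens I = {Gen_u, Gen_x} \<union> Gen_a ` I \<union> Gen_a_inv ` I"

definition D_relations :: "('k, 'z) ring_scheme \<Rightarrow> nat \<Rightarrow> nat \<Rightarrow> 'k \<Rightarrow> 'i set \<Rightarrow> ('i \<Rightarrow> 'k) \<Rightarrow>
    (('i gen list \<Rightarrow> 'k) \<times> ('i gen list \<Rightarrow> 'k)) set" where
  "D_relations K m n \<omega> I q =
     (let F = free_algebra K (D_gens I);
          u = free_gen K Gen_u; x = free_gen K Gen_x;
          a = (\<lambda>i. free_gen K (Gen_a i)); a' = (\<lambda>i. free_gen K (Gen_a_inv i)) in
       {(u [^]\<^bsub>F\<^esub> m, \<one>\<^bsub>F\<^esub>), (x [^]\<^bsub>F\<^esub> n, \<zero>\<^bsub>F\<^esub>), (u \<otimes>\<^bsub>F\<^esub> x, \<omega> \<odot>\<^bsub>F\<^esub> (x \<otimes>\<^bsub>F\<^esub> u))} \<union>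
       {(a i \<otimes>\<^bsub>F\<^esub> a' i, \<one>\<^bsub>F\<^esub>) | i. i \<in> I} \<union>
       {(a' i \<otimes>\<^bsub>F\<^esub> a i, \<one>\<^bsub>F\<^esub>) | i. i \<in> I} \<union>
       {(u \<otimes>\<^bsub>F\<^esub> a i, a i \<otimes>\<^bsub>F\<^esub> u) | i. i \<in> I} \<union>
       {(a i \<otimes>\<^bsub>F\<^esub> x, q i \<odot>\<^bsub>F\<^esub> (x \<otimes>\<^bsub>F\<^esub> a i)) | i. i \<in> I} \<union>
       {(a i \<otimes>\<^bsub>F\<^esub> a j, a j \<otimes>\<^bsub>F\<^esub> a i) | i j. i \<in> I \<and> j \<in> I})"

definition D_algebra :: "('k, 'z) ring_scheme \<Rightarrow> nat \<Rightarrow> nat \<Rightarrow> 'k \<Rightarrow> 'i set \<Rightarrow> ('i \<Rightarrow> 'k) \<Rightarrow>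
    ('k, ('i gen list \<Rightarrow> 'k) set) module" where
  "D_algebra K m n \<omega> I q = presented_algebra K (D_gens I) (D_relations K m n \<omega> I q)"

definition D_gen :: "('k, 'z) ring_scheme \<Rightarrow> nat \<Rightarrow> nat \<Rightarrow> 'k \<Rightarrow> 'i set \<Rightarrow> ('i \<Rightarrow> 'k) \<Rightarrow>
    'i gen \<Rightarrow> ('i gen list \<Rightarrow> 'k) set" where
  "D_gen K m n \<omega> I q = presented_gen K (D_gens I) (D_relations K m n \<omega> I q)"

text \<open>The value prescribed for \<open>\<Delta>(b)\<close>, where \<open>b = a\<^sub>i\<^sup>s\<close> and \<open>r = q\<^sub>i\<^sup>s\<^sup>n\<close> for a sign \<open>s\<close>.\<close>

definition comult_formula :: "('k, 'z) ring_scheme \<Rightarrow> ('k, 'd) module \<Rightarrow> nat \<Rightarrow> 'k \<Rightarrow> 'k \<Rightarrow>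
    'd \<Rightarrow> 'd \<Rightarrow> 'd \<Rightarrow> 'k \<Rightarrow> ('d \<times> 'd \<Rightarrow> 'k) set" where
  "comult_formula K D n \<omega> \<alpha> u x b r =
     (let DD = tensor_algebra K D D in
       pure_tensor K D D b b \<oplus>\<^bsub>DD\<^esub>
       (\<alpha> \<otimes>\<^bsub>K\<^esub> (\<one>\<^bsub>K\<^esub> \<ominus>\<^bsub>K\<^esub> r)) \<odot>\<^bsub>DD\<^esub>
         (\<Oplus>\<^bsub>DD\<^esub>k\<in>{1..n - 1}.
            inv\<^bsub>K\<^esub> (q_fact K \<omega> k \<otimes>\<^bsub>K\<^esub> q_fact K \<omega> (n - k)) \<odot>\<^bsub>DD\<^esub>
            pure_tensor K D D (x [^]\<^bsub>D\<^esub> (n - k) \<otimes>\<^bsub>D\<^esub> u [^]\<^bsub>D\<^esub> k \<otimes>\<^bsub>D\<^esub> b) (x [^]\<^bsub>D\<^esub> k \<otimes>\<^bsub>D\<^esub> b)))"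

definition D_structure_formulas :: "('k, 'z) ring_scheme \<Rightarrow> nat \<Rightarrow> nat \<Rightarrow> 'k \<Rightarrow> 'i set \<Rightarrow> ('i \<Rightarrow> 'k) \<Rightarrow>
    'k \<Rightarrow>
    (('i gen list \<Rightarrow> 'k) set \<Rightarrow> (('i gen list \<Rightarrow> 'k) set \<times> ('i gen list \<Rightarrow> 'k) set \<Rightarrow> 'k) set) \<Rightarrow>
    (('i gen list \<Rightarrow> 'k) set \<Rightarrow> 'k) \<Rightarrow>
    (('i gen list \<Rightarrow> 'k) set \<Rightarrow> ('i gen list \<Rightarrow> 'k) set) \<Rightarrow> bool" where
  "D_structure_formulas K m n \<omega> I q \<alpha> \<Delta> \<epsilon> S \<longleftrightarrow>
     (let D = D_algebra K m n \<omega> I q; DD = tensor_algebra K D D;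
          u = D_gen K m n \<omega> I q Gen_u; x = D_gen K m n \<omega> I q Gen_x;
          a = (\<lambda>i. D_gen K m n \<omega> I q (Gen_a i)); a' = (\<lambda>i. D_gen K m n \<omega> I q (Gen_a_inv i)) in
       \<Delta> u = pure_tensor K D D u u \<and>
       \<Delta> x = pure_tensor K D D u x \<oplus>\<^bsub>DD\<^esub> pure_tensor K D D x \<one>\<^bsub>D\<^esub> \<and>
       (\<forall>i\<in>I. \<Delta> (a i) = comult_formula K D n \<omega> \<alpha> u x (a i) (q i [^]\<^bsub>K\<^esub> int n)) \<and>
       (\<forall>i\<in>I. \<Delta> (a' i) = comult_formula K D n \<omega> \<alpha> u x (a' i) (q i [^]\<^bsub>K\<^esub> (- int n))) \<and>
       \<epsilon> u = \<one>\<^bsub>K\<^esub> \<and> \<epsilon> x = \<zero>\<^bsub>K\<^esub> \<and> (\<forall>i\<in>I. \<epsilon> (a i) = \<one>\<^bsub>K\<^esub> \<and> \<epsilon> (a' i) = \<one>\<^bsub>K\<^esub>) \<and>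
       S u = u [^]\<^bsub>D\<^esub> (m - 1) \<and> S x = \<ominus>\<^bsub>D\<^esub> (u [^]\<^bsub>D\<^esub> (m - 1) \<otimes>\<^bsub>D\<^esub> x) \<and>
       (\<forall>i\<in>I. S (a i) = a' i \<and> S (a' i) = a i))"

end

theory Submission
  imports Defs "HOL-Algebra.UnivPoly"
begin

text \<open>Put \<open>A = u \<otimes> x\<close> and \<open>B = x \<otimes> 1\<close>, so that \<open>A B = \<omega> B A\<close> and \<open>A\<^sup>n = B\<^sup>n = 0\<close>, and let \<open>T\<^sub>s\<close> be the
  coefficient of \<open>t\<^sup>s\<close> in \<open>e\<^sub>B(t) e\<^sub>A(t)\<close>, where \<open>e\<^sub>X(t) = \<Sum>\<^sub>i\<^sub><\<^sub>n X\<^sup>i t\<^sup>i / (i)!\<^sub>\<omega>\<close>. The quantum binomial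
  theorem takes the form \<open>T\<^sub>s (A + B) = (s + 1)\<^sub>\<omega> T\<^sub>s\<^sub>+\<^sub>1\<close> (\<open>T_step\<close>). As \<open>(n)\<^sub>\<omega> = 0\<close>, this yields
  \<open>T\<^sub>s = (A + B)\<^sup>s / (s)!\<^sub>\<omega>\<close> for \<open>s < n\<close> and \<open>(A + B)\<^sup>n = 0\<close>, so that \<open>\<Delta>(x) = A + B\<close> respects
  \<open>x\<^sup>n = 0\<close>; and it leaves over the element \<open>T\<^sub>n\<close>, which stands for the meaningless
  \<open>(A + B)\<^sup>n / (n)!\<^sub>\<omega>\<close>. This \<open>T\<^sub>n\<close> commutes with \<open>A + B\<close>, has square zero, and is the sum in the
  formula for \<open>\<Delta>(a\<^sub>i)\<close>, up to the factor \<open>a\<^sub>i \<otimes> a\<^sub>i\<close>.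

  The structure is a Drinfeld twist. There is an evident coproduct \<open>\<Delta>\<^sub>0\<close> for which \<open>u\<close> and all
  \<open>a\<^sub>i\<close> are grouplike. Let \<open>F = 1 + \<alpha> T\<^sub>n\<close>, whose inverse is \<open>1 - \<alpha> T\<^sub>n\<close>. It commutes with
  \<open>\<Delta>\<^sub>0(u)\<close> and \<open>\<Delta>\<^sub>0(x)\<close>, and from \<open>(a\<^sub>i \<otimes> a\<^sub>i) T\<^sub>n = q\<^sub>i\<^sup>n T\<^sub>n (a\<^sub>i \<otimes> a\<^sub>i)\<close> one gets
  \<open>F (a\<^sub>i \<otimes> a\<^sub>i) F\<inverse> = (1 + \<alpha> (1 - q\<^sub>i\<^sup>n) T\<^sub>n) (a\<^sub>i \<otimes> a\<^sub>i)\<close>. Hence the prescribed values are those of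
  \<open>\<Delta>(h) = F \<Delta>\<^sub>0(h) F\<inverse>\<close> (\<open>conj_grouplike\<close>, \<open>comult_formula_tw\<close>), and this \<open>\<Delta>\<close> is a homomorphism.

  Coassociativity amounts to \<open>(\<Delta> \<otimes> 1)(F) (F \<otimes> 1) = (1 \<otimes> \<Delta>)(F) (1 \<otimes> F)\<close>. For pairwise
  \<open>\<omega>\<close>-commuting \<open>A\<close>, \<open>B\<close>, \<open>C\<close> with vanishing \<open>n\<close>-th powers, this identity compares the coefficients of
  \<open>t\<^sup>n\<close> and \<open>t\<^sup>2\<^sup>n\<close> in the two bracketings of \<open>e\<^sub>C e\<^sub>B e\<^sub>A\<close> (\<open>twist_cocycle\<close>). Writing \<open>1 \<otimes> F\<close> in terms of
  \<open>u \<otimes> u \<otimes> x\<close> and \<open>u \<otimes> x \<otimes> 1\<close> takes \<open>u\<^sup>n = 1\<close>, whence the condition \<open>m = n\<close> for \<open>\<alpha> \<noteq> 0\<close>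
  (\<open>right_factor_twist\<close>). In the axioms for counit and antipode the terms of \<open>F\<close> other than \<open>1\<close>
  disappear, because \<open>\<epsilon>(x) = 0\<close> and \<open>x\<^sup>n = 0\<close>. Coproduct and counit are determined by their values on
  generators, and the antipode by being a convolution inverse (\<open>antipode_unique\<close>).

  The remaining parts supply the universal properties that this argument uses: those of monoid algebras,
  quotients, presentations (\<open>presented_lift\<close>) and tensor products (\<open>lift_tens\<close>, \<open>lift_hom\<close>).\<close>

section \<open>Linear maps and algebra homomorphisms\<close>

lemma linear_mapsI:
  assumes "\<And>x. x \<in> carrier V \<Longrightarrow> f x \<in> carrier W"
    and "\<And>x y. x \<in> carrier V \<Longrightarrow> y \<in> carrier V \<Longrightarrow> f (x \<oplus>\<^bsub>V\<^esub> y) = f x \<oplus>\<^bsub>W\<^esub> f y"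
    and "\<And>c x. c \<in> carrier K \<Longrightarrow> x \<in> carrier V \<Longrightarrow> f (c \<odot>\<^bsub>V\<^esub> x) = c \<odot>\<^bsub>W\<^esub> f x"
  shows "f \<in> linear_maps K V W"
  using assms by (auto simp: linear_maps_def)

lemma linear_mapsD:
  assumes "f \<in> linear_maps K V W"
  shows "x \<in> carrier V \<Longrightarrow> f x \<in> carrier W"
    and "x \<in> carrier V \<Longrightarrow> y \<in> carrier V \<Longrightarrow> f (x \<oplus>\<^bsub>V\<^esub> y) = f x \<oplus>\<^bsub>W\<^esub> f y"
    and "c \<in> carrier K \<Longrightarrow> x \<in> carrier V \<Longrightarrow> f (c \<odot>\<^bsub>V\<^esub> x) = c \<odot>\<^bsub>W\<^esub> f x"
  using assms by (auto simp: linear_maps_def)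

lemma linear_maps_comp:
  "\<lbrakk>f \<in> linear_maps K U V; g \<in> linear_maps K V W\<rbrakk> \<Longrightarrow> (\<lambda>x. g (f x)) \<in> linear_maps K U W"
  by (rule linear_mapsI) (simp_all add: linear_mapsD)

lemma linear_maps_zero:
  assumes "module K V" "module K W" "f \<in> linear_maps K V W"
  shows "f \<zero>\<^bsub>V\<^esub> = \<zero>\<^bsub>W\<^esub>"
proof -
  interpret V: module K V by fact
  interpret W: module K W by fact
  have "f (\<zero>\<^bsub>K\<^esub> \<odot>\<^bsub>V\<^esub> \<zero>\<^bsub>V\<^esub>) = \<zero>\<^bsub>K\<^esub> \<odot>\<^bsub>W\<^esub> f \<zero>\<^bsub>V\<^esub>"
    using assms(3) by (simp only: linear_mapsD V.R.zero_closed V.M.zero_closed)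
  then show ?thesis
    using linear_mapsD(1)[OF assms(3) V.M.zero_closed] by simp
qed

lemma linear_maps_minus:
  assumes "module K V" "module K W" "f \<in> linear_maps K V W" "x \<in> carrier V" "y \<in> carrier V"
  shows "f (x \<ominus>\<^bsub>V\<^esub> y) = f x \<ominus>\<^bsub>W\<^esub> f y"
proof -
  interpret V: module K V by fact
  interpret W: module K W by fact
  have "\<ominus>\<^bsub>V\<^esub> y = (\<ominus>\<^bsub>K\<^esub> \<one>\<^bsub>K\<^esub>) \<odot>\<^bsub>V\<^esub> y"
    using assms(5) by (simp add: V.smult_l_minus)
  then have "f (\<ominus>\<^bsub>V\<^esub> y) = \<ominus>\<^bsub>W\<^esub> f y"
    using assms by (simp add: linear_mapsD W.smult_l_minus)
  then show ?thesis
    using assms by (simp add: linear_mapsD a_minus_def)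
qed

lemma linear_maps_finsum:
  assumes "module K V" "module K W" "f \<in> linear_maps K V W"
    and "finite A" "g \<in> A \<rightarrow> carrier V"
  shows "f (\<Oplus>\<^bsub>V\<^esub>i\<in>A. g i) = (\<Oplus>\<^bsub>W\<^esub>i\<in>A. f (g i))"
proof -
  interpret V: module K V by fact
  interpret W: module K W by fact
  show ?thesis using assms(4,5)
  proof (induction A rule: finite_induct)
    case empty
    then show ?case using linear_maps_zero[OF assms(1-3)] by simp
  next
    case (insert a A)
    then show ?case
      using assms(3) by (subst V.M.finsum_insert W.M.finsum_insert;
        auto simp: linear_mapsD Pi_iff intro!: V.M.finsum_closed)+
  qed
qed

lemma algebra_homsI:
  assumes "f \<in> linear_maps K A B"
    and "\<And>x y. x \<in> carrier A \<Longrightarrow> y \<in> carrier A \<Longrightarrow> f (x \<otimes>\<^bsub>A\<^esub> y) = f x \<otimes>\<^bsub>B\<^esub> f y"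
    and "f \<one>\<^bsub>A\<^esub> = \<one>\<^bsub>B\<^esub>"
  shows "f \<in> algebra_homs K A B"
  using assms by (auto simp: algebra_homs_def linear_mapsD intro!: ring_hom_memI)

lemma algebra_homsD:
  assumes "f \<in> algebra_homs K A B"
  shows algebra_homs_linear: "f \<in> linear_maps K A B"
    and algebra_homs_closed: "x \<in> carrier A \<Longrightarrow> f x \<in> carrier B"
    and algebra_homs_add: "x \<in> carrier A \<Longrightarrow> y \<in> carrier A \<Longrightarrow> f (x \<oplus>\<^bsub>A\<^esub> y) = f x \<oplus>\<^bsub>B\<^esub> f y"
    and algebra_homs_smult: "c \<in> carrier K \<Longrightarrow> x \<in> carrier A \<Longrightarrow> f (c \<odot>\<^bsub>A\<^esub> x) = c \<odot>\<^bsub>B\<^esub> f x"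
    and algebra_homs_mult: "x \<in> carrier A \<Longrightarrow> y \<in> carrier A \<Longrightarrow> f (x \<otimes>\<^bsub>A\<^esub> y) = f x \<otimes>\<^bsub>B\<^esub> f y"
    and algebra_homs_one: "f \<one>\<^bsub>A\<^esub> = \<one>\<^bsub>B\<^esub>"
  using assms by (auto simp: algebra_homs_def linear_mapsD ring_hom_memE)

lemma algebra_homs_comp:
  "\<lbrakk>f \<in> algebra_homs K A B; g \<in> algebra_homs K B C\<rbrakk> \<Longrightarrow> (\<lambda>x. g (f x)) \<in> algebra_homs K A C"
  by (rule algebra_homsI, rule linear_maps_comp[OF algebra_homs_linear algebra_homs_linear])
     (auto simp: algebra_homsD)

lemma algebra_homs_pow:
  assumes "monoid A" "monoid B" "f \<in> algebra_homs K A B" "x \<in> carrier A"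
  shows "f (x [^]\<^bsub>A\<^esub> (i::nat)) = f x [^]\<^bsub>B\<^esub> i"
proof -
  interpret A: monoid A by fact
  interpret B: monoid B by fact
  show ?thesis
    using assms(3,4) by (induction i) (simp_all add: algebra_homsD)
qed

lemma algebra_homs_zero:
  assumes "assoc_algebra K A" "assoc_algebra K B" "f \<in> algebra_homs K A B"
  shows "f \<zero>\<^bsub>A\<^esub> = \<zero>\<^bsub>B\<^esub>"
  using assms linear_maps_zero assoc_algebra.axioms(2) algebra_homs_linear by metis

lemma assoc_algebraI:
  assumes "field K" "module K A" "ring A"
    and "\<And>c x y. \<lbrakk>c \<in> carrier K; x \<in> carrier A; y \<in> carrier A\<rbrakk> \<Longrightarrow>
      (c \<odot>\<^bsub>A\<^esub> x) \<otimes>\<^bsub>A\<^esub> y = c \<odot>\<^bsub>A\<^esub> (x \<otimes>\<^bsub>A\<^esub> y)"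
    and "\<And>c x y. \<lbrakk>c \<in> carrier K; x \<in> carrier A; y \<in> carrier A\<rbrakk> \<Longrightarrow>
      x \<otimes>\<^bsub>A\<^esub> (c \<odot>\<^bsub>A\<^esub> y) = c \<odot>\<^bsub>A\<^esub> (x \<otimes>\<^bsub>A\<^esub> y)"
  shows "assoc_algebra K A"
  using assms by (auto simp: assoc_algebra_def assoc_algebra_axioms_def)

section \<open>Monoid algebras\<close>

locale monoid_alg = K?: field K + G?: monoid G for K (structure) and G (structure)
begin

abbreviation F where "F \<equiv> monoid_algebra K G"
abbreviation e where "e \<equiv> basis_elem K"

lemma carrier_F: "f \<in> carrier F \<longleftrightarrow> (\<forall>w. f w \<in> carrier K) \<and> fsupp K f \<subseteq> carrier G \<and> finite (fsupp K f)"
  by (auto simp: monoid_algebra_def)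

lemma F_simps:
  "f \<oplus>\<^bsub>F\<^esub> g = (\<lambda>w. f w \<oplus> g w)" "c \<odot>\<^bsub>F\<^esub> f = (\<lambda>w. c \<otimes>\<^bsub>K\<^esub> f w)" "\<zero>\<^bsub>F\<^esub> = (\<lambda>w. \<zero>)"
  by (simp_all add: monoid_algebra_def)

lemma one_F: "\<one>\<^bsub>F\<^esub> = e \<one>\<^bsub>G\<^esub>"
  by (simp add: monoid_algebra_def basis_elem_def)

lemma e_closed: "p \<in> carrier G \<Longrightarrow> e p \<in> carrier F"
  by (auto simp: carrier_F basis_elem_def fsupp_def)

lemma fsupp_e: "fsupp K (e p) = {p}"
  by (auto simp: basis_elem_def fsupp_def)

lemma add_F_closed:
  assumes "f \<in> carrier F" "g \<in> carrier F"
  shows "f \<oplus>\<^bsub>F\<^esub> g \<in> carrier F"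
proof -
  have "fsupp K (f \<oplus>\<^bsub>F\<^esub> g) \<subseteq> fsupp K f \<union> fsupp K g"
    by (auto simp: fsupp_def F_simps)
  then show ?thesis
    using assms by (auto simp: carrier_F F_simps(1) intro: finite_subset)
qed

lemma smult_F_closed:
  assumes "c \<in> carrier K" "f \<in> carrier F"
  shows "c \<odot>\<^bsub>F\<^esub> f \<in> carrier F"
proof -
  have "fsupp K (c \<odot>\<^bsub>F\<^esub> f) \<subseteq> fsupp K f"
    using assms by (auto simp: fsupp_def F_simps)
  then show ?thesis
    using assms by (auto simp: carrier_F F_simps(2) intro: finite_subset)
qed

lemma zero_F_closed: "\<zero>\<^bsub>F\<^esub> \<in> carrier F"
  by (auto simp: carrier_F F_simps fsupp_def)

lemma F_abelian_group: "abelian_group F"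
proof (rule abelian_groupI)
  fix f assume f: "f \<in> carrier F"
  show "\<exists>g\<in>carrier F. g \<oplus>\<^bsub>F\<^esub> f = \<zero>\<^bsub>F\<^esub>"
  proof
    show "(\<ominus> \<one>) \<odot>\<^bsub>F\<^esub> f \<in> carrier F" by (rule smult_F_closed) (use f in auto)
    show "(\<ominus> \<one>) \<odot>\<^bsub>F\<^esub> f \<oplus>\<^bsub>F\<^esub> f = \<zero>\<^bsub>F\<^esub>"
      using f by (auto simp: F_simps carrier_F K.l_minus K.l_neg)
  qed
next
  fix f g assume "f \<in> carrier F" "g \<in> carrier F"
  then show "f \<oplus>\<^bsub>F\<^esub> g = g \<oplus>\<^bsub>F\<^esub> f"
    by (auto simp: carrier_F F_simps K.a_comm)
next
  fix f g h assume "f \<in> carrier F" "g \<in> carrier F" "h \<in> carrier F"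
  then show "(f \<oplus>\<^bsub>F\<^esub> g) \<oplus>\<^bsub>F\<^esub> h = f \<oplus>\<^bsub>F\<^esub> (g \<oplus>\<^bsub>F\<^esub> h)"
    by (auto simp: carrier_F F_simps K.a_assoc)
next
  fix f assume "f \<in> carrier F"
  then show "\<zero>\<^bsub>F\<^esub> \<oplus>\<^bsub>F\<^esub> f = f"
    by (auto simp: carrier_F F_simps)
qed (auto simp: add_F_closed zero_F_closed)

lemma F_module: "module K F"
  by (rule moduleI[OF K.is_cring F_abelian_group])
     (auto simp: smult_F_closed, auto simp: carrier_F F_simps K.l_distr K.r_distr K.m_assoc)

sublocale F: module K F
  by (rule F_module)

text \<open>The support may be enlarged to any convenient finite set; this is what makes bilinearity
  of the product visible.\<close>

lemma mult_F:
  assumes "finite A" "finite B" "fsupp K f \<subseteq> A" "fsupp K g \<subseteq> B"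
    and "\<And>w. f w \<in> carrier K" "\<And>w. g w \<in> carrier K"
  shows "(f \<otimes>\<^bsub>F\<^esub> g) w = (\<Oplus>p\<in>A \<times> B.
    if fst p \<otimes>\<^bsub>G\<^esub> snd p = w then f (fst p) \<otimes>\<^bsub>K\<^esub> g (snd p) else \<zero>)"
proof -
  have "(f \<otimes>\<^bsub>F\<^esub> g) w = (\<Oplus>p\<in>{p \<in> fsupp K f \<times> fsupp K g. fst p \<otimes>\<^bsub>G\<^esub> snd p = w}.
               f (fst p) \<otimes>\<^bsub>K\<^esub> g (snd p))"
    by (simp add: monoid_algebra_def)
  also have "\<dots> = (\<Oplus>p\<in>A \<times> B.
    if fst p \<otimes>\<^bsub>G\<^esub> snd p = w then f (fst p) \<otimes>\<^bsub>K\<^esub> g (snd p) else \<zero>)"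
    using assms by (intro K.add.finprod_mono_neutral_cong_left) (auto simp: fsupp_def)
  finally show ?thesis .
qed

lemma mult_F_closed:
  assumes "f \<in> carrier F" "g \<in> carrier F"
  shows "f \<otimes>\<^bsub>F\<^esub> g \<in> carrier F"
proof -
  let ?S = "fsupp K f \<times> fsupp K g"
  have *: "fsupp K (f \<otimes>\<^bsub>F\<^esub> g) \<subseteq> (\<lambda>p. fst p \<otimes>\<^bsub>G\<^esub> snd p) ` ?S"
  proof
    fix w assume w: "w \<in> fsupp K (f \<otimes>\<^bsub>F\<^esub> g)"
    show "w \<in> (\<lambda>p. fst p \<otimes>\<^bsub>G\<^esub> snd p) ` ?S"
    proof (rule ccontr)
      assume "w \<notin> (\<lambda>p. fst p \<otimes>\<^bsub>G\<^esub> snd p) ` ?S"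
      then have *: "{p \<in> ?S. fst p \<otimes>\<^bsub>G\<^esub> snd p = w} = {}" by blast
      have "(f \<otimes>\<^bsub>F\<^esub> g) w = \<zero>"
        by (simp only: monoid_algebra_def monoid.simps * K.finsum_empty)
      with w show False by (simp add: fsupp_def)
    qed
  qed
  have "(f \<otimes>\<^bsub>F\<^esub> g) w \<in> carrier K" for w
    using assms by (subst mult_F[of "fsupp K f" "fsupp K g"]) (auto intro!: K.finsum_closed simp: carrier_F)
  moreover have "fsupp K (f \<otimes>\<^bsub>F\<^esub> g) \<subseteq> carrier G"
    using assms by (intro order_trans[OF *]) (auto simp: carrier_F subset_iff)
  moreover have "finite (fsupp K (f \<otimes>\<^bsub>F\<^esub> g))"
    using * assms by (auto simp: carrier_F intro: finite_subset)
  ultimately show ?thesis by (simp add: carrier_F)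
qed

lemma mult_F_add_left:
  assumes "f \<in> carrier F" "f' \<in> carrier F" "g \<in> carrier F"
  shows "(f \<oplus>\<^bsub>F\<^esub> f') \<otimes>\<^bsub>F\<^esub> g = f \<otimes>\<^bsub>F\<^esub> g \<oplus>\<^bsub>F\<^esub> f' \<otimes>\<^bsub>F\<^esub> g"
proof
  fix w
  let ?A = "fsupp K f \<union> fsupp K f' \<union> fsupp K (f \<oplus>\<^bsub>F\<^esub> f')" and ?B = "fsupp K g"
  let ?t = "\<lambda>h p. if fst p \<otimes>\<^bsub>G\<^esub> snd p = w then h (fst p) \<otimes>\<^bsub>K\<^esub> g (snd p) else \<zero>"
  have c: "f v \<in> carrier K" "f' v \<in> carrier K" "g v \<in> carrier K" "(f \<oplus>\<^bsub>F\<^esub> f') v \<in> carrier K" for v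
    using assms add_F_closed by (auto simp: carrier_F)
  have fin: "finite ?A" "finite ?B"
    using assms add_F_closed[OF assms(1,2)] by (auto simp: carrier_F)
  have "((f \<oplus>\<^bsub>F\<^esub> f') \<otimes>\<^bsub>F\<^esub> g) w = (\<Oplus>p\<in>?A \<times> ?B. ?t (f \<oplus>\<^bsub>F\<^esub> f') p)"
    by (rule mult_F) (use c fin in auto)
  also have "\<dots> = (\<Oplus>p\<in>?A \<times> ?B. ?t f p \<oplus> ?t f' p)"
    by (rule K.finsum_cong') (use c in \<open>auto simp: F_simps K.l_distr\<close>)
  also have "\<dots> = (\<Oplus>p\<in>?A \<times> ?B. ?t f p) \<oplus> (\<Oplus>p\<in>?A \<times> ?B. ?t f' p)"
    by (rule K.finsum_addf) (use c in auto)
  also have "\<dots> = (f \<otimes>\<^bsub>F\<^esub> g) w \<oplus> (f' \<otimes>\<^bsub>F\<^esub> g) w"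
    by (subst (1 2) mult_F[OF fin]) (use c in auto)
  finally show "((f \<oplus>\<^bsub>F\<^esub> f') \<otimes>\<^bsub>F\<^esub> g) w = (f \<otimes>\<^bsub>F\<^esub> g \<oplus>\<^bsub>F\<^esub> f' \<otimes>\<^bsub>F\<^esub> g) w"
    by (simp add: F_simps)
qed

lemma mult_F_add_right:
  assumes "f \<in> carrier F" "f' \<in> carrier F" "g \<in> carrier F"
  shows "g \<otimes>\<^bsub>F\<^esub> (f \<oplus>\<^bsub>F\<^esub> f') = g \<otimes>\<^bsub>F\<^esub> f \<oplus>\<^bsub>F\<^esub> g \<otimes>\<^bsub>F\<^esub> f'"
proof
  fix w
  let ?A = "fsupp K f \<union> fsupp K f' \<union> fsupp K (f \<oplus>\<^bsub>F\<^esub> f')" and ?B = "fsupp K g"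
  let ?t = "\<lambda>h p. if fst p \<otimes>\<^bsub>G\<^esub> snd p = w then g (fst p) \<otimes>\<^bsub>K\<^esub> h (snd p) else \<zero>"
  have c: "f v \<in> carrier K" "f' v \<in> carrier K" "g v \<in> carrier K" "(f \<oplus>\<^bsub>F\<^esub> f') v \<in> carrier K" for v
    using assms add_F_closed by (auto simp: carrier_F)
  have fin: "finite ?A" "finite ?B"
    using assms add_F_closed[OF assms(1,2)] by (auto simp: carrier_F)
  have "(g \<otimes>\<^bsub>F\<^esub> (f \<oplus>\<^bsub>F\<^esub> f')) w = (\<Oplus>p\<in>?B \<times> ?A. ?t (f \<oplus>\<^bsub>F\<^esub> f') p)"
    by (rule mult_F) (use c fin in auto)
  also have "\<dots> = (\<Oplus>p\<in>?B \<times> ?A. ?t f p \<oplus> ?t f' p)"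
    by (rule K.finsum_cong') (use c in \<open>auto simp: F_simps K.r_distr\<close>)
  also have "\<dots> = (\<Oplus>p\<in>?B \<times> ?A. ?t f p) \<oplus> (\<Oplus>p\<in>?B \<times> ?A. ?t f' p)"
    by (rule K.finsum_addf) (use c in auto)
  also have "\<dots> = (g \<otimes>\<^bsub>F\<^esub> f) w \<oplus> (g \<otimes>\<^bsub>F\<^esub> f') w"
    by (subst (1 2) mult_F[OF fin(2,1)]) (use c in auto)
  finally show "(g \<otimes>\<^bsub>F\<^esub> (f \<oplus>\<^bsub>F\<^esub> f')) w = (g \<otimes>\<^bsub>F\<^esub> f \<oplus>\<^bsub>F\<^esub> g \<otimes>\<^bsub>F\<^esub> f') w"
    by (simp add: F_simps)
qed

lemma mult_F_smult_left:
  assumes "c \<in> carrier K" "f \<in> carrier F" "g \<in> carrier F"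
  shows "(c \<odot>\<^bsub>F\<^esub> f) \<otimes>\<^bsub>F\<^esub> g = c \<odot>\<^bsub>F\<^esub> (f \<otimes>\<^bsub>F\<^esub> g)"
proof
  fix w
  let ?A = "fsupp K f \<union> fsupp K (c \<odot>\<^bsub>F\<^esub> f)" and ?B = "fsupp K g"
  let ?t = "\<lambda>h p. if fst p \<otimes>\<^bsub>G\<^esub> snd p = w then h (fst p) \<otimes>\<^bsub>K\<^esub> g (snd p) else \<zero>"
  have c: "f v \<in> carrier K" "g v \<in> carrier K" "(c \<odot>\<^bsub>F\<^esub> f) v \<in> carrier K" for v
    using assms smult_F_closed by (auto simp: carrier_F)
  have fin: "finite ?A" "finite ?B"
    using assms smult_F_closed[OF assms(1,2)] by (auto simp: carrier_F)
  have "((c \<odot>\<^bsub>F\<^esub> f) \<otimes>\<^bsub>F\<^esub> g) w = (\<Oplus>p\<in>?A \<times> ?B. ?t (c \<odot>\<^bsub>F\<^esub> f) p)"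
    by (rule mult_F) (use c fin in auto)
  also have "\<dots> = (\<Oplus>p\<in>?A \<times> ?B. c \<otimes>\<^bsub>K\<^esub> ?t f p)"
    by (rule K.finsum_cong') (use c assms(1) in \<open>auto simp: F_simps K.m_assoc\<close>)
  also have "\<dots> = c \<otimes>\<^bsub>K\<^esub> (\<Oplus>p\<in>?A \<times> ?B. ?t f p)"
    by (rule K.finsum_rdistr[symmetric]) (use c fin assms(1) in auto)
  also have "\<dots> = c \<otimes>\<^bsub>K\<^esub> (f \<otimes>\<^bsub>F\<^esub> g) w"
    by (subst mult_F[OF fin]) (use c in auto)
  finally show "((c \<odot>\<^bsub>F\<^esub> f) \<otimes>\<^bsub>F\<^esub> g) w = (c \<odot>\<^bsub>F\<^esub> (f \<otimes>\<^bsub>F\<^esub> g)) w"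
    by (simp add: F_simps)
qed

lemma mult_F_smult_right:
  assumes "c \<in> carrier K" "f \<in> carrier F" "g \<in> carrier F"
  shows "g \<otimes>\<^bsub>F\<^esub> (c \<odot>\<^bsub>F\<^esub> f) = c \<odot>\<^bsub>F\<^esub> (g \<otimes>\<^bsub>F\<^esub> f)"
proof
  fix w
  let ?A = "fsupp K f \<union> fsupp K (c \<odot>\<^bsub>F\<^esub> f)" and ?B = "fsupp K g"
  let ?t = "\<lambda>h p. if fst p \<otimes>\<^bsub>G\<^esub> snd p = w then g (fst p) \<otimes>\<^bsub>K\<^esub> h (snd p) else \<zero>"
  have c: "f v \<in> carrier K" "g v \<in> carrier K" "(c \<odot>\<^bsub>F\<^esub> f) v \<in> carrier K" for v
    using assms smult_F_closed by (auto simp: carrier_F)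
  have fin: "finite ?A" "finite ?B"
    using assms smult_F_closed[OF assms(1,2)] by (auto simp: carrier_F)
  have "(g \<otimes>\<^bsub>F\<^esub> (c \<odot>\<^bsub>F\<^esub> f)) w = (\<Oplus>p\<in>?B \<times> ?A. ?t (c \<odot>\<^bsub>F\<^esub> f) p)"
    by (rule mult_F) (use c fin in auto)
  also have "\<dots> = (\<Oplus>p\<in>?B \<times> ?A. c \<otimes>\<^bsub>K\<^esub> ?t f p)"
    by (rule K.finsum_cong') (use c assms(1) in \<open>auto simp: F_simps K.m_lcomm\<close>)
  also have "\<dots> = c \<otimes>\<^bsub>K\<^esub> (\<Oplus>p\<in>?B \<times> ?A. ?t f p)"
    by (rule K.finsum_rdistr[symmetric]) (use c fin assms(1) in auto)
  also have "\<dots> = c \<otimes>\<^bsub>K\<^esub> (g \<otimes>\<^bsub>F\<^esub> f) w"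
    by (subst mult_F[OF fin(2,1)]) (use c in auto)
  finally show "(g \<otimes>\<^bsub>F\<^esub> (c \<odot>\<^bsub>F\<^esub> f)) w = (c \<odot>\<^bsub>F\<^esub> (g \<otimes>\<^bsub>F\<^esub> f)) w"
    by (simp add: F_simps)
qed

lemma e_mult:
  "p \<in> carrier G \<Longrightarrow> q \<in> carrier G \<Longrightarrow> e p \<otimes>\<^bsub>F\<^esub> e q = e (p \<otimes>\<^bsub>G\<^esub> q)"
  by (rule ext, subst mult_F[of "{p}" "{q}"]) (auto simp: fsupp_e, auto simp: basis_elem_def)

text \<open>The basis elements span, so identities that are linear in each argument need to be checked on
basis elements only. Associativity of the product reduces in this way to associativity in the
monoid.\<close>

lemma F_induct [consumes 1, case_names zero smult add basis]:
  assumes "f \<in> carrier F"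
    and zero: "P \<zero>\<^bsub>F\<^esub>"
    and smult: "\<And>c f. c \<in> carrier K \<Longrightarrow> f \<in> carrier F \<Longrightarrow> P f \<Longrightarrow> P (c \<odot>\<^bsub>F\<^esub> f)"
    and add: "\<And>f g. f \<in> carrier F \<Longrightarrow> g \<in> carrier F \<Longrightarrow> P f \<Longrightarrow> P g \<Longrightarrow> P (f \<oplus>\<^bsub>F\<^esub> g)"
    and basis: "\<And>p. p \<in> carrier G \<Longrightarrow> P (e p)"
  shows "P f"
proof -
  have "P f" if "finite S" "S \<subseteq> carrier G" "f \<in> carrier F" "fsupp K f \<subseteq> S" for S f
    using that
  proof (induction S arbitrary: f rule: finite_induct)
    case empty
    then have "f = \<zero>\<^bsub>F\<^esub>" by (auto simp: fsupp_def F_simps)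
    with zero show ?case by simp
  next
    case (insert p S)
    let ?f = "f(p := \<zero>)"
    have f: "?f \<in> carrier F" "fsupp K ?f \<subseteq> S"
      using insert.prems by (auto simp: carrier_F fsupp_def subset_iff intro: rev_finite_subset)
    have "f = f p \<odot>\<^bsub>F\<^esub> e p \<oplus>\<^bsub>F\<^esub> ?f"
      using insert.prems by (auto simp: F_simps basis_elem_def carrier_F)
    moreover have "P (f p \<odot>\<^bsub>F\<^esub> e p \<oplus>\<^bsub>F\<^esub> ?f)"
      using insert.prems f by (intro add smult basis smult_F_closed e_closed insert.IH) (auto simp: carrier_F simp del: fun_upd_apply)
    ultimately show ?case by simp
  qed
  from this[of "fsupp K f"] assms(1) show ?thesis by (auto simp: carrier_F)
qed

lemma mult_F_assoc:
  assumes "f \<in> carrier F" "g \<in> carrier F" "h \<in> carrier F"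
  shows "(f \<otimes>\<^bsub>F\<^esub> g) \<otimes>\<^bsub>F\<^esub> h = f \<otimes>\<^bsub>F\<^esub> (g \<otimes>\<^bsub>F\<^esub> h)"
proof -
  note bilin = mult_F_add_left mult_F_add_right mult_F_smult_left mult_F_smult_right
    mult_F_closed e_closed smult_F_closed
  have zero: "\<zero>\<^bsub>F\<^esub> \<otimes>\<^bsub>F\<^esub> f = \<zero>\<^bsub>F\<^esub>" "f \<otimes>\<^bsub>F\<^esub> \<zero>\<^bsub>F\<^esub> = \<zero>\<^bsub>F\<^esub>" if "f \<in> carrier F" for f
    using that mult_F_smult_left[of \<zero> f f] mult_F_smult_right[of \<zero> f f]
    by (auto simp: mult_F_closed)
  have 1: "(e p \<otimes>\<^bsub>F\<^esub> e q) \<otimes>\<^bsub>F\<^esub> h = e p \<otimes>\<^bsub>F\<^esub> (e q \<otimes>\<^bsub>F\<^esub> h)" if "p \<in> carrier G" "q \<in> carrier G" for p q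
    using assms(3) that by (induction h rule: F_induct) (simp_all add: bilin zero e_mult G.m_assoc)
  have 2: "(e p \<otimes>\<^bsub>F\<^esub> g) \<otimes>\<^bsub>F\<^esub> h = e p \<otimes>\<^bsub>F\<^esub> (g \<otimes>\<^bsub>F\<^esub> h)" if "p \<in> carrier G" for p
    using assms(2,3) that by (induction g rule: F_induct) (simp_all add: bilin zero 1)
  show ?thesis
    using assms by (induction f rule: F_induct) (simp_all add: bilin zero 2)
qed

lemma mult_F_one:
  assumes "f \<in> carrier F"
  shows "\<one>\<^bsub>F\<^esub> \<otimes>\<^bsub>F\<^esub> f = f" "f \<otimes>\<^bsub>F\<^esub> \<one>\<^bsub>F\<^esub> = f"
proof -
  have zero: "\<one>\<^bsub>F\<^esub> \<otimes>\<^bsub>F\<^esub> \<zero>\<^bsub>F\<^esub> = \<zero>\<^bsub>F\<^esub>" "\<zero>\<^bsub>F\<^esub> \<otimes>\<^bsub>F\<^esub> \<one>\<^bsub>F\<^esub> = \<zero>\<^bsub>F\<^esub>"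
    using mult_F_smult_left[of \<zero> "\<one>\<^bsub>F\<^esub>" "\<one>\<^bsub>F\<^esub>"] mult_F_smult_right[of \<zero> "\<one>\<^bsub>F\<^esub>" "\<one>\<^bsub>F\<^esub>"]
    by (auto simp: one_F e_closed mult_F_closed)
  show "\<one>\<^bsub>F\<^esub> \<otimes>\<^bsub>F\<^esub> f = f" using assms
    by (induction f rule: F_induct) (simp_all add: mult_F_add_right mult_F_smult_right zero,
        simp_all add: one_F e_closed e_mult mult_F_add_right mult_F_smult_right)
  show "f \<otimes>\<^bsub>F\<^esub> \<one>\<^bsub>F\<^esub> = f" using assms
    by (induction f rule: F_induct) (simp_all add: zero,
        simp_all add: one_F e_closed e_mult mult_F_add_left mult_F_smult_left)
qed

lemma F_algebra: "assoc_algebra K F"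
proof (rule assoc_algebraI)
  show "ring F"
    by (rule ringI[OF F_abelian_group])
       (auto simp: mult_F_closed mult_F_assoc mult_F_one mult_F_add_left mult_F_add_right
          one_F e_closed intro!: monoidI, auto simp: one_F[symmetric] mult_F_one)
qed (auto simp: mult_F_smult_left mult_F_smult_right F_module K.field_axioms)

end

subsection \<open>Linear extension\<close>

definition lin_ext :: "('k, 'z) ring_scheme \<Rightarrow> ('k, 'v) module \<Rightarrow> ('m \<Rightarrow> 'v) \<Rightarrow> ('m \<Rightarrow> 'k) \<Rightarrow> 'v" where
  "lin_ext K V \<phi> f = (\<Oplus>\<^bsub>V\<^esub>p\<in>fsupp K f. f p \<odot>\<^bsub>V\<^esub> \<phi> p)"

context monoid_alg
begin

text \<open>Two functions have different supports; before their sums can be compared, both have to be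
written over a common index set.\<close>

lemma lin_ext_superset:
  assumes "module K V" "\<phi> \<in> carrier G \<rightarrow> carrier V" "f \<in> carrier F"
    and "finite A" "fsupp K f \<subseteq> A" "A \<subseteq> carrier G"
  shows "lin_ext K V \<phi> f = (\<Oplus>\<^bsub>V\<^esub>p\<in>A. f p \<odot>\<^bsub>V\<^esub> \<phi> p)"
proof -
  interpret V: module K V by fact
  show ?thesis
    unfolding lin_ext_def using assms
    by (intro V.M.add.finprod_mono_neutral_cong_left)
       (auto simp: fsupp_def carrier_F Pi_iff subset_iff intro!: V.smult_closed)
qed

lemma lin_ext_linear:
  assumes V: "module K V" and \<phi>: "\<phi> \<in> carrier G \<rightarrow> carrier V"
  shows "lin_ext K V \<phi> \<in> linear_maps K F V"
proof -
  interpret V: module K V by fact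
  show ?thesis
  proof (rule linear_mapsI)
    fix f assume "f \<in> carrier F"
    then show "lin_ext K V \<phi> f \<in> carrier V"
      using \<phi> by (auto simp: lin_ext_def carrier_F Pi_iff subset_iff intro!: V.M.finsum_closed)
  next
    fix f g assume f: "f \<in> carrier F" and g: "g \<in> carrier F"
    let ?A = "fsupp K f \<union> fsupp K g \<union> fsupp K (f \<oplus>\<^bsub>F\<^esub> g)"
    note c = f[unfolded carrier_F] g[unfolded carrier_F] add_F_closed[OF f g, unfolded carrier_F]
    have c': "f v \<in> carrier K" "g v \<in> carrier K" for v using c by auto
    have A: "finite ?A" "?A \<subseteq> carrier G" using c by auto
    then have \<phi>A: "\<phi> p \<in> carrier V" if "p \<in> ?A" for p using that \<phi> by auto
    have "lin_ext K V \<phi> (f \<oplus>\<^bsub>F\<^esub> g) = (\<Oplus>\<^bsub>V\<^esub>p\<in>?A. (f \<oplus>\<^bsub>F\<^esub> g) p \<odot>\<^bsub>V\<^esub> \<phi> p)"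
      by (rule lin_ext_superset[OF V \<phi> add_F_closed[OF f g] A(1) _ A(2)]) auto
    also have "\<dots> = (\<Oplus>\<^bsub>V\<^esub>p\<in>?A. f p \<odot>\<^bsub>V\<^esub> \<phi> p \<oplus>\<^bsub>V\<^esub> g p \<odot>\<^bsub>V\<^esub> \<phi> p)"
      by (rule V.M.finsum_cong') (use c' \<phi>A in \<open>simp_all add: F_simps(1) V.smult_l_distr Pi_iff del: Un_iff\<close>)
    also have "\<dots> = (\<Oplus>\<^bsub>V\<^esub>p\<in>?A. f p \<odot>\<^bsub>V\<^esub> \<phi> p) \<oplus>\<^bsub>V\<^esub> (\<Oplus>\<^bsub>V\<^esub>p\<in>?A. g p \<odot>\<^bsub>V\<^esub> \<phi> p)"
      by (rule V.M.finsum_addf) (use c' \<phi>A in \<open>auto simp del: Un_iff\<close>)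
    also have "\<dots> = lin_ext K V \<phi> f \<oplus>\<^bsub>V\<^esub> lin_ext K V \<phi> g"
      by (subst (1 2) lin_ext_superset[OF V \<phi> _ A(1) _ A(2)]) (use f g in auto)
    finally show "lin_ext K V \<phi> (f \<oplus>\<^bsub>F\<^esub> g) = lin_ext K V \<phi> f \<oplus>\<^bsub>V\<^esub> lin_ext K V \<phi> g" .
  next
    fix c f assume c: "c \<in> carrier K" and f: "f \<in> carrier F"
    let ?A = "fsupp K f \<union> fsupp K (c \<odot>\<^bsub>F\<^esub> f)"
    note d = f[unfolded carrier_F] smult_F_closed[OF c f, unfolded carrier_F]
    have c': "f v \<in> carrier K" for v using d by auto
    have A: "finite ?A" "?A \<subseteq> carrier G" using d by auto
    then have \<phi>A: "\<phi> p \<in> carrier V" if "p \<in> ?A" for p using that \<phi> by auto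
    have "lin_ext K V \<phi> (c \<odot>\<^bsub>F\<^esub> f) = (\<Oplus>\<^bsub>V\<^esub>p\<in>?A. (c \<odot>\<^bsub>F\<^esub> f) p \<odot>\<^bsub>V\<^esub> \<phi> p)"
      by (rule lin_ext_superset[OF V \<phi> smult_F_closed[OF c f] A(1) _ A(2)]) auto
    also have "\<dots> = (\<Oplus>\<^bsub>V\<^esub>p\<in>?A. c \<odot>\<^bsub>V\<^esub> (f p \<odot>\<^bsub>V\<^esub> \<phi> p))"
      by (rule V.M.finsum_cong') (use c c' \<phi>A in \<open>auto simp: F_simps(2) V.smult_assoc1 simp del: Un_iff\<close>)
    also have "\<dots> = c \<odot>\<^bsub>V\<^esub> (\<Oplus>\<^bsub>V\<^esub>p\<in>?A. f p \<odot>\<^bsub>V\<^esub> \<phi> p)"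
      by (rule V.finsum_smult_ldistr[symmetric]) (use A c c' \<phi>A in \<open>auto simp del: Un_iff\<close>)
    also have "\<dots> = c \<odot>\<^bsub>V\<^esub> lin_ext K V \<phi> f"
      by (subst lin_ext_superset[OF V \<phi> _ A(1) _ A(2)]) (use f in auto)
    finally show "lin_ext K V \<phi> (c \<odot>\<^bsub>F\<^esub> f) = c \<odot>\<^bsub>V\<^esub> lin_ext K V \<phi> f" .
  qed
qed

lemma lin_ext_e:
  assumes "module K V" "\<phi> \<in> carrier G \<rightarrow> carrier V" "p \<in> carrier G"
  shows "lin_ext K V \<phi> (e p) = \<phi> p"
proof -
  interpret V: module K V by fact
  have "lin_ext K V \<phi> (e p) = e p p \<odot>\<^bsub>V\<^esub> \<phi> p"
    using assms funcset_mem[OF assms(2,3)] unfolding lin_ext_def fsupp_e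
    by (subst V.M.finsum_insert) (auto simp: basis_elem_def)
  then show ?thesis using funcset_mem[OF assms(2,3)] by (simp add: basis_elem_def)
qed

lemma linear_maps_F_eqI:
  assumes "module K V" "f \<in> linear_maps K F V" "g \<in> linear_maps K F V"
    and "\<And>p. p \<in> carrier G \<Longrightarrow> f (e p) = g (e p)" "t \<in> carrier F"
  shows "f t = g t"
  using assms(5)
  by (induction t rule: F_induct)
     (auto simp: linear_maps_zero[OF F_module assms(1)] linear_mapsD[OF assms(2)]
       linear_mapsD[OF assms(3)] assms)

text \<open>Multiplicativity is a condition on basis elements, where it is that of \<open>\<phi>\<close>. This is the
  universal property of the monoid algebra.\<close>

lemma lin_ext_hom:
  assumes A: "assoc_algebra K A" and \<phi>: "\<phi> \<in> hom G A" "\<phi> \<one>\<^bsub>G\<^esub> = \<one>\<^bsub>A\<^esub>"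
  shows "lin_ext K A \<phi> \<in> algebra_homs K F A"
proof -
  interpret A: assoc_algebra K A by fact
  have \<phi>': "\<phi> \<in> carrier G \<rightarrow> carrier A" using \<phi> by (auto simp: hom_def)
  note M = A.module_axioms
  note lin = lin_ext_linear[OF M \<phi>']
  note lins = linear_mapsD[OF lin] linear_maps_zero[OF F_module M lin] lin_ext_e[OF M \<phi>']
  interpret F: assoc_algebra K F by (rule F_algebra)
  have 1: "lin_ext K A \<phi> (e p \<otimes>\<^bsub>F\<^esub> g) = \<phi> p \<otimes>\<^bsub>A\<^esub> lin_ext K A \<phi> g"
    if "p \<in> carrier G" "g \<in> carrier F" for p g
    using that(2) that(1) \<phi>(1) \<phi>'
    by (induction g rule: F_induct)
       (simp_all add: lins e_closed F.r_distr F.smult_mult_right A.r_distr A.smult_mult_right Pi_iff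
         e_mult hom_mult)
  show ?thesis
  proof (rule algebra_homsI[OF lin])
    fix f g assume "f \<in> carrier F" "g \<in> carrier F"
    then show "lin_ext K A \<phi> (f \<otimes>\<^bsub>F\<^esub> g) = lin_ext K A \<phi> f \<otimes>\<^bsub>A\<^esub> lin_ext K A \<phi> g"
      by (induction f rule: F_induct)
         (simp_all add: lins F.l_distr F.smult_mult_left A.l_distr A.smult_mult_left 1)
  qed (simp add: one_F lins \<phi>)
qed

end

section \<open>Quotient algebras\<close>

text \<open>The ring axioms speak of five record fields only. This carries them from the quotient ring to
the quotient algebra, and from a field to the field as an algebra over itself, whose records
are different.\<close>

lemma ring_cong:
  assumes "ring R" and "carrier S = carrier R" "mult S = mult R" "\<one>\<^bsub>S\<^esub> = \<one>\<^bsub>R\<^esub>"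
    "\<zero>\<^bsub>S\<^esub> = \<zero>\<^bsub>R\<^esub>" "add S = add R"
  shows "ring S"
proof -
  interpret R: ring R by fact
  show ?thesis
    by (intro ringI abelian_groupI monoidI)
       (auto simp: assms(2-) R.m_assoc R.a_assoc R.l_distr R.r_distr intro: R.a_comm R.l_neg)
qed

text \<open>The value is meaningful when \<open>f\<close> is constant on \<open>X\<close>. Extensions of bilinear maps to tensor
products are of this shape as well, with \<open>f\<close> a linear extension.\<close>

definition quot_lift :: "('a \<Rightarrow> 'v) \<Rightarrow> 'a set \<Rightarrow> 'v" where
  "quot_lift f X = the_elem (f ` X)"

locale quotient_alg = assoc_algebra K A + ideal J A for K (structure) and A :: "('k, 'a) module" (structure) and J
begin

abbreviation Q where "Q \<equiv> quotient_algebra A J"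

lemma Q_simps:
  "carrier Q = carrier (A Quot J)" "mult Q = mult (A Quot J)" "\<one>\<^bsub>Q\<^esub> = \<one>\<^bsub>A Quot J\<^esub>"
  "\<zero>\<^bsub>Q\<^esub> = \<zero>\<^bsub>A Quot J\<^esub>" "add Q = add (A Quot J)"
  "c \<odot>\<^bsub>Q\<^esub> X = (\<Union>x\<in>X. J +>\<^bsub>A\<^esub> (c \<odot>\<^bsub>A\<^esub> x))"
  by (simp_all add: quotient_algebra_def ring.defs module.defs)

lemma Q_ring: "ring Q"
  by (rule ring_cong[OF quotient_is_ring]) (simp_all add: Q_simps)

lemma Q_cases:
  assumes "X \<in> carrier Q"
  obtains x where "x \<in> carrier A" "X = J +>\<^bsub>A\<^esub> x"
  using assms by (auto simp: Q_simps FactRing_simps)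

lemma coset_closed: "x \<in> carrier A \<Longrightarrow> J +>\<^bsub>A\<^esub> x \<in> carrier Q"
  by (auto simp: Q_simps FactRing_simps)

lemma coset_mult: "x \<in> carrier A \<Longrightarrow> y \<in> carrier A \<Longrightarrow>
    (J +>\<^bsub>A\<^esub> x) \<otimes>\<^bsub>Q\<^esub> (J +>\<^bsub>A\<^esub> y) = J +>\<^bsub>A\<^esub> (x \<otimes>\<^bsub>A\<^esub> y)"
  by (simp add: Q_simps FactRing_def rcoset_mult_add)

lemma coset_add: "x \<in> carrier A \<Longrightarrow> y \<in> carrier A \<Longrightarrow>
    (J +>\<^bsub>A\<^esub> x) \<oplus>\<^bsub>Q\<^esub> (J +>\<^bsub>A\<^esub> y) = J +>\<^bsub>A\<^esub> (x \<oplus>\<^bsub>A\<^esub> y)"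
  by (simp add: Q_simps FactRing_def a_rcos_sum)

lemma coset_one: "\<one>\<^bsub>Q\<^esub> = J +>\<^bsub>A\<^esub> \<one>\<^bsub>A\<^esub>"
  by (simp add: Q_simps FactRing_def)

text \<open>Ideals of an algebra are subspaces, because \<open>c \<odot> j = (c \<odot> 1) j\<close>. Hence scalars act on cosets.\<close>

lemma ideal_smult: "c \<in> carrier K \<Longrightarrow> j \<in> J \<Longrightarrow> c \<odot>\<^bsub>A\<^esub> j \<in> J"
  using I_l_closed[of j "c \<odot>\<^bsub>A\<^esub> \<one>\<^bsub>A\<^esub>"] a_Hcarr[of j] by (simp add: smult_mult_left)

lemma coset_smult:
  assumes "c \<in> carrier K" "x \<in> carrier A"
  shows "c \<odot>\<^bsub>Q\<^esub> (J +>\<^bsub>A\<^esub> x) = J +>\<^bsub>A\<^esub> (c \<odot>\<^bsub>A\<^esub> x)"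
proof -
  have "J +>\<^bsub>A\<^esub> (c \<odot>\<^bsub>A\<^esub> y) = J +>\<^bsub>A\<^esub> (c \<odot>\<^bsub>A\<^esub> x)" if "y \<in> J +>\<^bsub>A\<^esub> x" for y
  proof -
    from that obtain j where j: "j \<in> J" "y = j \<oplus>\<^bsub>A\<^esub> x"
      by (auto simp: a_r_coset_def r_coset_def)
    then have "c \<odot>\<^bsub>A\<^esub> y = c \<odot>\<^bsub>A\<^esub> j \<oplus>\<^bsub>A\<^esub> c \<odot>\<^bsub>A\<^esub> x"
      using assms a_Hcarr by (simp add: smult_r_distr)
    then have "c \<odot>\<^bsub>A\<^esub> y \<in> J +>\<^bsub>A\<^esub> (c \<odot>\<^bsub>A\<^esub> x)"
      using j ideal_smult[OF assms(1)] by (auto simp: a_r_coset_def r_coset_def)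
    then show ?thesis using a_repr_independence assms a_subgroup smult_closed by metis
  qed
  moreover have "x \<in> J +>\<^bsub>A\<^esub> x" using assms a_rcos_self by simp
  ultimately show ?thesis unfolding Q_simps by blast
qed

lemma Q_algebra: "assoc_algebra K Q"
proof (rule assoc_algebraI)
  interpret Q: ring Q by (rule Q_ring)
  show "field K" by (rule K.field_axioms)
  show "ring Q" by (rule Q_ring)
  show "module K Q"
    by (rule moduleI[OF K.is_cring Q.abelian_group_axioms])
       (auto elim!: Q_cases simp: coset_smult coset_add coset_closed smult_l_distr smult_r_distr smult_assoc1)
qed (auto elim!: Q_cases simp: coset_smult coset_mult smult_mult_left smult_mult_right)

lemma coset_hom: "(+>\<^bsub>A\<^esub>) J \<in> algebra_homs K A Q"
  by (auto intro!: algebra_homsI linear_mapsI simp: coset_closed coset_add coset_smult coset_mult coset_one)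

lemma coset_eq_iff:
  assumes "x \<in> carrier A" "y \<in> carrier A"
  shows "J +>\<^bsub>A\<^esub> x = J +>\<^bsub>A\<^esub> y \<longleftrightarrow> x \<ominus>\<^bsub>A\<^esub> y \<in> J"
  using quotient_eq_iff_same_a_r_cos[OF is_ideal assms] by auto

text \<open>A linear map that kills \<open>J\<close> is constant on cosets.\<close>

lemma quot_lift_coset:
  assumes V: "module K V" and f: "f \<in> linear_maps K A V" and J: "\<And>j. j \<in> J \<Longrightarrow> f j = \<zero>\<^bsub>V\<^esub>"
    and x: "x \<in> carrier A"
  shows "quot_lift f (J +>\<^bsub>A\<^esub> x) = f x"
proof -
  interpret V: module K V by fact
  have "f y = f x" if "y \<in> J +>\<^bsub>A\<^esub> x" for y
    using that x J by (auto simp: a_r_coset_def r_coset_def linear_mapsD[OF f] a_Hcarr)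
  moreover have "x \<in> J +>\<^bsub>A\<^esub> x" using x a_rcos_self by simp
  ultimately have "f ` (J +>\<^bsub>A\<^esub> x) = {f x}" by blast
  then show ?thesis by (simp add: quot_lift_def)
qed

lemma quot_lift_linear:
  assumes "module K V" "f \<in> linear_maps K A V" "\<And>j. j \<in> J \<Longrightarrow> f j = \<zero>\<^bsub>V\<^esub>"
  shows "quot_lift f \<in> linear_maps K Q V"
  by (rule linear_mapsI)
     (auto elim!: Q_cases simp: coset_add coset_smult quot_lift_coset[OF assms] linear_mapsD[OF assms(2)])

lemma quot_lift_hom:
  assumes "module K V" "f \<in> algebra_homs K A V" "\<And>j. j \<in> J \<Longrightarrow> f j = \<zero>\<^bsub>V\<^esub>"
  shows "quot_lift f \<in> algebra_homs K Q V"
  by (rule algebra_homsI[OF quot_lift_linear[OF assms(1) algebra_homs_linear[OF assms(2)] assms(3)]])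
     (auto elim!: Q_cases simp: coset_one coset_mult
        quot_lift_coset[OF assms(1) algebra_homs_linear[OF assms(2)] assms(3)] algebra_homsD[OF assms(2)])

end

section \<open>Algebras given by generators and relations\<close>

primrec word_eval :: "('a, 'y) monoid_scheme \<Rightarrow> ('g \<Rightarrow> 'a) \<Rightarrow> 'g list \<Rightarrow> 'a" where
  "word_eval A v [] = \<one>\<^bsub>A\<^esub>"
| "word_eval A v (g # w) = v g \<otimes>\<^bsub>A\<^esub> word_eval A v w"

definition free_eval :: "('k, 'z) ring_scheme \<Rightarrow> ('k, 'a) module \<Rightarrow> ('g \<Rightarrow> 'a) \<Rightarrow> ('g list \<Rightarrow> 'k) \<Rightarrow> 'a" where
  "free_eval K A v = lin_ext K A (word_eval A v)"

lemma free_monoid_monoid: "monoid (free_monoid S)"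
  by (rule monoidI) (auto simp: free_monoid_def)

lemma word_eval_closed:
  assumes "monoid A" "v \<in> S \<rightarrow> carrier A" "w \<in> lists S"
  shows "word_eval A v w \<in> carrier A"
proof -
  interpret A: monoid A by fact
  show ?thesis using assms(2,3) by (induction w) auto
qed

lemma word_eval_append:
  assumes "monoid A" "v \<in> S \<rightarrow> carrier A" "w \<in> lists S" "w' \<in> lists S"
  shows "word_eval A v (w @ w') = word_eval A v w \<otimes>\<^bsub>A\<^esub> word_eval A v w'"
proof -
  interpret A: monoid A by fact
  note closed = word_eval_closed[OF assms(1,2)]
  show ?thesis using assms(2-)
  proof (induction w)
    case (Cons g w)
    then show ?case using closed[of w] closed[of w'] by (auto simp: A.m_assoc Pi_iff)
  qed (simp add: closed)
qed

locale free_alg = K?: field K for K :: "('k, 'z) ring_scheme" (structure) +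
  fixes S :: "'g set"
begin

sublocale monoid_alg K "free_monoid S"
  by (intro monoid_alg.intro K.field_axioms free_monoid_monoid)

lemma F_free: "free_algebra K S = F"
  by (simp add: free_algebra_def)

sublocale F: assoc_algebra K F
  by (rule F_algebra)

lemma free_gen_closed: "g \<in> S \<Longrightarrow> free_gen K g \<in> carrier F"
  unfolding free_gen_def by (rule e_closed) (simp add: free_monoid_def)

lemma free_eval_hom:
  assumes A: "assoc_algebra K A" and v: "v \<in> S \<rightarrow> carrier A"
  shows "free_eval K A v \<in> algebra_homs K F A"
proof -
  interpret A: assoc_algebra K A by fact
  show ?thesis
    unfolding free_eval_def
    by (rule lin_ext_hom[OF A])
       (auto simp: hom_def free_monoid_def word_eval_closed[OF A.monoid_axioms v]
         word_eval_append[OF A.monoid_axioms v])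
qed

lemma free_eval_gen:
  assumes A: "assoc_algebra K A" and v: "v \<in> S \<rightarrow> carrier A" and g: "g \<in> S"
  shows "free_eval K A v (free_gen K g) = v g"
proof -
  interpret A: assoc_algebra K A by fact
  have "free_eval K A v (free_gen K g) = word_eval A v [g]"
    unfolding free_eval_def free_gen_def
    by (rule lin_ext_e[OF A.module_axioms])
       (use g in \<open>auto simp: free_monoid_def word_eval_closed[OF A.monoid_axioms v]\<close>)
  then show ?thesis using v g by (auto simp: Pi_iff)
qed

lemma F_gen_induct [consumes 1, case_names zero smult add one gen]:
  assumes "f \<in> carrier F"
    and "P \<zero>\<^bsub>F\<^esub>"
    and "\<And>c f. c \<in> carrier K \<Longrightarrow> f \<in> carrier F \<Longrightarrow> P f \<Longrightarrow> P (c \<odot>\<^bsub>F\<^esub> f)"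
    and "\<And>f g. f \<in> carrier F \<Longrightarrow> g \<in> carrier F \<Longrightarrow> P f \<Longrightarrow> P g \<Longrightarrow> P (f \<oplus>\<^bsub>F\<^esub> g)"
    and one: "P \<one>\<^bsub>F\<^esub>"
    and gen: "\<And>g f. g \<in> S \<Longrightarrow> f \<in> carrier F \<Longrightarrow> P f \<Longrightarrow> P (free_gen K g \<otimes>\<^bsub>F\<^esub> f)"
  shows "P f"
  using assms(1-4)
proof (induction f rule: F_induct)
  case (basis w)
  then have "w \<in> lists S" by (simp add: free_monoid_def)
  then have "P (e w)"
  proof (induction w)
    case Nil
    then show ?case using one by (simp add: one_F) (simp add: free_monoid_def)
  next
    case (Cons g w)
    then have "P (free_gen K g \<otimes>\<^bsub>F\<^esub> e w)"
      by (intro gen e_closed) (auto simp: free_monoid_def)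
    also have "free_gen K g \<otimes>\<^bsub>F\<^esub> e w = e (g # w)"
      unfolding free_gen_def using Cons
      by (subst e_mult) (auto simp: free_monoid_def)
    finally show ?case .
  qed
  then show ?case .
qed auto

end

locale presentation = free_alg K S for K :: "('k, 'z) ring_scheme" (structure) and S :: "'g set" +
  fixes R :: "(('g list \<Rightarrow> 'k) \<times> ('g list \<Rightarrow> 'k)) set"
  assumes relations_closed: "(l, r) \<in> R \<Longrightarrow> l \<in> carrier F \<and> r \<in> carrier F"
begin

abbreviation J where "J \<equiv> relation_ideal K S R"
abbreviation P where "P \<equiv> presented_algebra K S R"
abbreviation gen where "gen \<equiv> presented_gen K S R"

lemma relators_closed: "(\<lambda>(l, r). l \<ominus>\<^bsub>F\<^esub> r) ` R \<subseteq> carrier F"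
  using relations_closed by auto

sublocale quotient_alg K F J
proof -
  have "ideal J F"
    unfolding relation_ideal_def F_free by (rule F.genideal_ideal[OF relators_closed])
  then show "quotient_alg K F J"
    by (intro quotient_alg.intro F_algebra)
qed

lemma P_quotient: "P = Q"
  by (simp add: presented_algebra_def F_free)

lemma P_algebra: "assoc_algebra K P"
  unfolding P_quotient by (rule Q_algebra)

lemma gen_coset: "gen g = J +>\<^bsub>F\<^esub> free_gen K g"
  by (simp add: presented_gen_def F_free)

lemma gen_closed: "g \<in> S \<Longrightarrow> gen g \<in> carrier P"
  by (simp add: gen_coset P_quotient coset_closed free_gen_closed)

lemma coset_P_hom: "(+>\<^bsub>F\<^esub>) J \<in> algebra_homs K F P"
  unfolding P_quotient by (rule coset_hom)

lemma relation_holds: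
  assumes "(l, r) \<in> R"
  shows "J +>\<^bsub>F\<^esub> l = J +>\<^bsub>F\<^esub> r"
proof -
  have "l \<ominus>\<^bsub>F\<^esub> r \<in> J"
    unfolding relation_ideal_def F_free
    using F.genideal_self[OF relators_closed] assms by force
  then show ?thesis using relations_closed[OF assms] by (simp add: coset_eq_iff)
qed

definition presented_lift :: "('k, 'a) module \<Rightarrow> ('g \<Rightarrow> 'a) \<Rightarrow> ('g list \<Rightarrow> 'k) set \<Rightarrow> 'a" where
  "presented_lift A v = quot_lift (free_eval K A v)"

text \<open>The kernel of the evaluation of words is an ideal that contains the relators, hence the
  ideal generated by them. This is the universal property of the presentation.\<close>

lemma presented_lift:
  assumes A: "assoc_algebra K A" and v: "v \<in> S \<rightarrow> carrier A"
    and rel: "\<And>l r. (l, r) \<in> R \<Longrightarrow> free_eval K A v l = free_eval K A v r"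
  shows presented_lift_hom: "presented_lift A v \<in> algebra_homs K P A"
    and presented_lift_gen: "g \<in> S \<Longrightarrow> presented_lift A v (gen g) = v g"
proof -
  interpret A: assoc_algebra K A by fact
  let ?f = "free_eval K A v"
  note hom = free_eval_hom[OF A v]
  have "ring_hom_ring F A ?f"
    by (rule ring_hom_ringI2) (use hom in \<open>auto simp: algebra_homs_def F.ring_axioms A.ring_axioms\<close>)
  note ker = ring_hom_ring.kernel_is_ideal[OF this]
  have "J \<subseteq> a_kernel F A ?f"
    unfolding relation_ideal_def F_free
  proof (rule F.genideal_minimal[OF ker])
    show "(\<lambda>(l, r). l \<ominus>\<^bsub>F\<^esub> r) ` R \<subseteq> a_kernel F A ?f"
    proof clarify
      fix l r assume lr: "(l, r) \<in> R"
      note c = relations_closed[OF lr]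
      have "?f (l \<ominus>\<^bsub>F\<^esub> r) = ?f l \<ominus>\<^bsub>A\<^esub> ?f r"
        using c by (intro linear_maps_minus[OF F_module A.module_axioms algebra_homs_linear[OF hom]]) auto
      also have "\<dots> = \<zero>\<^bsub>A\<^esub>"
        using c by (simp add: rel[OF lr] A.r_neg a_minus_def algebra_homsD[OF hom])
      finally have "?f (l \<ominus>\<^bsub>F\<^esub> r) = \<zero>\<^bsub>A\<^esub>" .
      moreover have "l \<ominus>\<^bsub>F\<^esub> r \<in> carrier F"
        using c by (intro F.minus_closed) auto
      ultimately show "l \<ominus>\<^bsub>F\<^esub> r \<in> a_kernel F A ?f"
        unfolding a_kernel_def' by blast
    qed
  qed
  then have J: "?f j = \<zero>\<^bsub>A\<^esub>" if "j \<in> J" for j using that unfolding a_kernel_def' by blast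
  show "presented_lift A v \<in> algebra_homs K P A"
    unfolding P_quotient presented_lift_def by (rule quot_lift_hom[OF A.module_axioms hom J])
  show "presented_lift A v (gen g) = v g" if "g \<in> S"
    using that by (simp add: presented_lift_def gen_coset free_gen_closed free_eval_gen[OF A v]
        quot_lift_coset[OF A.module_axioms algebra_homs_linear[OF hom] J])
qed

lemma presented_induct [consumes 1, case_names zero smult add one gen]:
  assumes "h \<in> carrier P"
    and "\<phi> \<zero>\<^bsub>P\<^esub>"
    and "\<And>c f. c \<in> carrier K \<Longrightarrow> f \<in> carrier P \<Longrightarrow> \<phi> f \<Longrightarrow> \<phi> (c \<odot>\<^bsub>P\<^esub> f)"
    and "\<And>f g. f \<in> carrier P \<Longrightarrow> g \<in> carrier P \<Longrightarrow> \<phi> f \<Longrightarrow> \<phi> g \<Longrightarrow> \<phi> (f \<oplus>\<^bsub>P\<^esub> g)"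
    and "\<phi> \<one>\<^bsub>P\<^esub>"
    and "\<And>g f. g \<in> S \<Longrightarrow> f \<in> carrier P \<Longrightarrow> \<phi> f \<Longrightarrow> \<phi> (gen g \<otimes>\<^bsub>P\<^esub> f)"
  shows "\<phi> h"
proof -
  note hom = coset_P_hom
  obtain f where f: "f \<in> carrier F" "h = J +>\<^bsub>F\<^esub> f"
    using assms(1) unfolding P_quotient by (rule Q_cases)
  from f(1) have "\<phi> (J +>\<^bsub>F\<^esub> f)"
  proof (induction f rule: F_gen_induct)
    case zero
    then show ?case using assms(2) by (simp add: algebra_homs_zero[OF F_algebra P_algebra hom])
  next
    case one
    then show ?case using assms(5) by (simp add: algebra_homsD[OF hom])
  next
    case (gen g f)
    then show ?case using assms(6)[OF gen(1), of "J +>\<^bsub>F\<^esub> f"]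
      by (simp add: algebra_homsD[OF hom] gen_coset free_gen_closed)
  qed (simp_all add: algebra_homsD[OF hom] assms(3,4))
  then show ?thesis by (simp add: f)
qed

lemma presented_hom_eqI:
  assumes A: "assoc_algebra K A" and f: "f \<in> algebra_homs K P A" and f': "f' \<in> algebra_homs K P A"
    and eq: "\<And>g. g \<in> S \<Longrightarrow> f (gen g) = f' (gen g)" and h: "h \<in> carrier P"
  shows "f h = f' h"
  using h
  by (induction h rule: presented_induct)
     (simp_all add: algebra_homs_zero[OF P_algebra A f] algebra_homs_zero[OF P_algebra A f']
       algebra_homsD[OF f] algebra_homsD[OF f'] eq gen_closed)

end

section \<open>Tensor products\<close>

definition bilinear_maps :: "('k, 'z) ring_scheme \<Rightarrow> ('k, 'a) module \<Rightarrow> ('k, 'b) module \<Rightarrow>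
    ('k, 'v) module \<Rightarrow> ('a \<Rightarrow> 'b \<Rightarrow> 'v) set" where
  "bilinear_maps K A B V = {\<beta>. (\<forall>a\<in>carrier A. \<beta> a \<in> linear_maps K B V) \<and>
     (\<forall>b\<in>carrier B. (\<lambda>a. \<beta> a b) \<in> linear_maps K A V)}"

lemma bilinear_mapsI:
  assumes "\<And>a b. \<lbrakk>a \<in> carrier A; b \<in> carrier B\<rbrakk> \<Longrightarrow> \<beta> a b \<in> carrier V"
    and "\<And>a a' b. \<lbrakk>a \<in> carrier A; a' \<in> carrier A; b \<in> carrier B\<rbrakk> \<Longrightarrow>
      \<beta> (a \<oplus>\<^bsub>A\<^esub> a') b = \<beta> a b \<oplus>\<^bsub>V\<^esub> \<beta> a' b"
    and "\<And>a b b'. \<lbrakk>a \<in> carrier A; b \<in> carrier B; b' \<in> carrier B\<rbrakk> \<Longrightarrow>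
      \<beta> a (b \<oplus>\<^bsub>B\<^esub> b') = \<beta> a b \<oplus>\<^bsub>V\<^esub> \<beta> a b'"
    and "\<And>c a b. \<lbrakk>c \<in> carrier K; a \<in> carrier A; b \<in> carrier B\<rbrakk> \<Longrightarrow> \<beta> (c \<odot>\<^bsub>A\<^esub> a) b = c \<odot>\<^bsub>V\<^esub> \<beta> a b"
    and "\<And>c a b. \<lbrakk>c \<in> carrier K; a \<in> carrier A; b \<in> carrier B\<rbrakk> \<Longrightarrow> \<beta> a (c \<odot>\<^bsub>B\<^esub> b) = c \<odot>\<^bsub>V\<^esub> \<beta> a b"
  shows "\<beta> \<in> bilinear_maps K A B V"
  using assms by (auto simp: bilinear_maps_def intro!: linear_mapsI)

lemma bilinear_mapsD:
  assumes "\<beta> \<in> bilinear_maps K A B V"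
  shows "\<lbrakk>a \<in> carrier A; b \<in> carrier B\<rbrakk> \<Longrightarrow> \<beta> a b \<in> carrier V"
    and "\<lbrakk>a \<in> carrier A; a' \<in> carrier A; b \<in> carrier B\<rbrakk> \<Longrightarrow>
      \<beta> (a \<oplus>\<^bsub>A\<^esub> a') b = \<beta> a b \<oplus>\<^bsub>V\<^esub> \<beta> a' b"
    and "\<lbrakk>a \<in> carrier A; b \<in> carrier B; b' \<in> carrier B\<rbrakk> \<Longrightarrow>
      \<beta> a (b \<oplus>\<^bsub>B\<^esub> b') = \<beta> a b \<oplus>\<^bsub>V\<^esub> \<beta> a b'"
    and "\<lbrakk>c \<in> carrier K; a \<in> carrier A; b \<in> carrier B\<rbrakk> \<Longrightarrow> \<beta> (c \<odot>\<^bsub>A\<^esub> a) b = c \<odot>\<^bsub>V\<^esub> \<beta> a b"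
    and "\<lbrakk>c \<in> carrier K; a \<in> carrier A; b \<in> carrier B\<rbrakk> \<Longrightarrow> \<beta> a (c \<odot>\<^bsub>B\<^esub> b) = c \<odot>\<^bsub>V\<^esub> \<beta> a b"
  using assms unfolding bilinear_maps_def linear_maps_def by auto

locale tensor = A: assoc_algebra K A + B: assoc_algebra K B
  for K :: "('k, 'z) ring_scheme" and A :: "('k, 'a) module" and B :: "('k, 'b) module"
begin

sublocale M: monoid_alg K "A \<times>\<times> B"
  by (intro monoid_alg.intro A.K.field_axioms DirProd_monoid A.monoid_axioms B.monoid_axioms)

sublocale F: assoc_algebra K M.F
  by (rule M.F_algebra)

abbreviation T where "T \<equiv> tensor_algebra K A B"
abbreviation J where "J \<equiv> tensor_ideal K A B"
abbreviation tens where "tens \<equiv> pure_tensor K A B"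
abbreviation ext where "ext V \<beta> \<equiv> lin_ext K V (\<lambda>p. \<beta> (fst p) (snd p))"

lemma e_closed: "a \<in> carrier A \<Longrightarrow> b \<in> carrier B \<Longrightarrow> M.e (a, b) \<in> carrier M.F"
  by (rule M.e_closed) simp

lemma ext_linear:
  assumes "module K V" "\<beta> \<in> bilinear_maps K A B V"
  shows "ext V \<beta> \<in> linear_maps K M.F V"
  by (rule M.lin_ext_linear[OF assms(1)]) (auto simp: bilinear_mapsD[OF assms(2)])

lemma ext_e:
  assumes "module K V" "\<beta> \<in> bilinear_maps K A B V" "a \<in> carrier A" "b \<in> carrier B"
  shows "ext V \<beta> (M.e (a, b)) = \<beta> a b"
  using assms by (subst M.lin_ext_e[OF assms(1)]) (auto simp: bilinear_mapsD[OF assms(2)])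

lemma shift_bilinear:
  assumes \<beta>: "\<beta> \<in> bilinear_maps K A B V" and ab: "a \<in> carrier A" "b \<in> carrier B"
  shows "(\<lambda>a' b'. \<beta> (a \<otimes>\<^bsub>A\<^esub> a') (b \<otimes>\<^bsub>B\<^esub> b')) \<in> bilinear_maps K A B V"
    and "(\<lambda>a' b'. \<beta> (a' \<otimes>\<^bsub>A\<^esub> a) (b' \<otimes>\<^bsub>B\<^esub> b)) \<in> bilinear_maps K A B V"
  using ab by (auto intro!: bilinear_mapsI simp: bilinear_mapsD[OF \<beta>] A.A.r_distr B.A.r_distr
        A.smult_mult_right B.smult_mult_right A.A.l_distr B.A.l_distr
        A.smult_mult_left B.smult_mult_left)

lemma ext_shift:
  assumes V: "module K V" and \<beta>: "\<beta> \<in> bilinear_maps K A B V"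
    and ab: "a \<in> carrier A" "b \<in> carrier B" and f: "f \<in> carrier M.F"
  shows "ext V \<beta> (M.e (a, b) \<otimes>\<^bsub>M.F\<^esub> f) = ext V (\<lambda>a' b'. \<beta> (a \<otimes>\<^bsub>A\<^esub> a') (b \<otimes>\<^bsub>B\<^esub> b')) f"
    and "ext V \<beta> (f \<otimes>\<^bsub>M.F\<^esub> M.e (a, b)) = ext V (\<lambda>a' b'. \<beta> (a' \<otimes>\<^bsub>A\<^esub> a) (b' \<otimes>\<^bsub>B\<^esub> b)) f"
proof -
  note e = e_closed[OF ab]
  note 1 = shift_bilinear(1)[OF \<beta> ab] and 2 = shift_bilinear(2)[OF \<beta> ab]
  have l: "(\<lambda>f. M.e (a, b) \<otimes>\<^bsub>M.F\<^esub> f) \<in> linear_maps K M.F M.F" "(\<lambda>f. f \<otimes>\<^bsub>M.F\<^esub> M.e (a, b)) \<in> linear_maps K M.F M.F"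
    using e by (auto intro!: linear_mapsI simp: F.A.r_distr F.A.l_distr F.smult_mult_right F.smult_mult_left)
  show "ext V \<beta> (M.e (a, b) \<otimes>\<^bsub>M.F\<^esub> f) = ext V (\<lambda>a' b'. \<beta> (a \<otimes>\<^bsub>A\<^esub> a') (b \<otimes>\<^bsub>B\<^esub> b')) f"
    by (rule M.linear_maps_F_eqI[OF V linear_maps_comp[OF l(1) ext_linear[OF V \<beta>]] ext_linear[OF V 1] _ f])
       (use ab in \<open>auto simp: M.e_mult ext_e[OF V \<beta>] ext_e[OF V 1]\<close>)
  show "ext V \<beta> (f \<otimes>\<^bsub>M.F\<^esub> M.e (a, b)) = ext V (\<lambda>a' b'. \<beta> (a' \<otimes>\<^bsub>A\<^esub> a) (b' \<otimes>\<^bsub>B\<^esub> b)) f"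
    by (rule M.linear_maps_F_eqI[OF V linear_maps_comp[OF l(2) ext_linear[OF V \<beta>]] ext_linear[OF V 2] _ f])
       (use ab in \<open>auto simp: M.e_mult ext_e[OF V \<beta>] ext_e[OF V 2]\<close>)
qed

text \<open>The linear extension of a single bilinear map kills the bilinearity relators, but its kernel is
not an ideal, so it is not clear that it kills the ideal generated by them. The common kernel of
all bilinear maps to \<open>V\<close> is an ideal: multiplying by a basis element turns the extension of one
bilinear map into that of another, by the two lemmas above.\<close>

definition bilinear_null :: "('k, 'v) module \<Rightarrow> ('a \<times> 'b \<Rightarrow> 'k) set" where
  "bilinear_null V = {f \<in> carrier M.F. \<forall>\<beta>\<in>bilinear_maps K A B V. ext V \<beta> f = \<zero>\<^bsub>V\<^esub>}"

lemma bilinear_null_ideal: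
  assumes V: "module K V"
  shows "ideal (bilinear_null V) M.F"
proof -
  interpret V: module K V by fact
  let ?N = "bilinear_null V"
  note lin = linear_mapsD[OF ext_linear[OF V]] linear_maps_zero[OF M.F_module V ext_linear[OF V]]
  have l: "x \<otimes>\<^bsub>M.F\<^esub> f \<in> ?N" and r: "f \<otimes>\<^bsub>M.F\<^esub> x \<in> ?N"
    if f: "f \<in> ?N" and x: "x \<in> carrier M.F" for f x
  proof -
    have f': "f \<in> carrier M.F" using f by (simp add: bilinear_null_def)
    have 1: "ext V \<beta> f = \<zero>\<^bsub>V\<^esub>" if "\<beta> \<in> bilinear_maps K A B V" for \<beta>
      using that f by (simp add: bilinear_null_def)
    have "ext V \<beta> (x \<otimes>\<^bsub>M.F\<^esub> f) = \<zero>\<^bsub>V\<^esub>" if "\<beta> \<in> bilinear_maps K A B V" for \<beta>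
      using x
    proof (induction x rule: M.F_induct)
      case (basis p)
      then show ?case using that f'
        by (cases p) (auto simp: ext_shift[OF V] intro!: 1 shift_bilinear)
    qed (simp_all add: that f' lin F.A.l_distr F.smult_mult_left)
    moreover have "ext V \<beta> (f \<otimes>\<^bsub>M.F\<^esub> x) = \<zero>\<^bsub>V\<^esub>" if "\<beta> \<in> bilinear_maps K A B V" for \<beta>
      using x
    proof (induction x rule: M.F_induct)
      case (basis p)
      then show ?case using that f'
        by (cases p) (auto simp: ext_shift[OF V] intro!: 1 shift_bilinear)
    qed (simp_all add: that f' lin F.A.r_distr F.smult_mult_right)
    ultimately show "x \<otimes>\<^bsub>M.F\<^esub> f \<in> ?N" "f \<otimes>\<^bsub>M.F\<^esub> x \<in> ?N"
      using x f' by (auto simp: bilinear_null_def)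
  qed
  show ?thesis
  proof (rule idealI[OF F.A.ring_axioms _ l r])
    have neg: "\<ominus>\<^bsub>M.F\<^esub> f \<in> ?N" if "f \<in> ?N" for f
      using l[OF that, of "\<ominus>\<^bsub>M.F\<^esub> \<one>\<^bsub>M.F\<^esub>"] that by (simp add: bilinear_null_def F.A.l_minus)
    show "subgroup ?N (add_monoid M.F)"
      by (rule group.subgroupI[OF M.F.a_group])
         (use neg in \<open>auto simp: bilinear_null_def lin a_inv_def[symmetric] intro: exI[of _ "\<zero>\<^bsub>M.F\<^esub>"]\<close>)
  qed auto
qed

lemma relators_null:
  assumes V: "module K V"
  shows "tensor_relators K A B \<subseteq> bilinear_null V"
proof -
  interpret V: module K V by fact
  note lin = linear_maps_minus[OF M.F_module V ext_linear[OF V]] linear_mapsD[OF ext_linear[OF V]]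
  have *: "x \<ominus>\<^bsub>V\<^esub> x = \<zero>\<^bsub>V\<^esub>" if "x \<in> carrier V" for x
    using that by (simp add: a_minus_def V.M.r_neg)
  show ?thesis
    unfolding tensor_relators_def Let_def
    by (auto simp: bilinear_null_def lin ext_e[OF V] e_closed bilinear_mapsD * intro!: M.F.minus_closed)
qed

lemma relators_closed: "tensor_relators K A B \<subseteq> carrier M.F"
  using relators_null[OF M.F_module] by (auto simp: bilinear_null_def)

sublocale quotient_alg K M.F J
  by (intro quotient_alg.intro M.F_algebra)
     (unfold tensor_ideal_def, rule F.A.genideal_ideal[OF relators_closed])

lemma T_quotient: "T = Q"
  by (simp add: tensor_algebra_def)

lemma T_algebra: "assoc_algebra K T"
  unfolding T_quotient by (rule Q_algebra)

sublocale T: assoc_algebra K T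
  by (rule T_algebra)

lemma ext_ideal:
  assumes V: "module K V" and \<beta>: "\<beta> \<in> bilinear_maps K A B V" and j: "j \<in> J"
  shows "ext V \<beta> j = \<zero>\<^bsub>V\<^esub>"
proof -
  have "J \<subseteq> bilinear_null V"
    unfolding tensor_ideal_def by (rule F.A.genideal_minimal[OF bilinear_null_ideal[OF V] relators_null[OF V]])
  then show ?thesis using j \<beta> by (auto simp: bilinear_null_def)
qed

lemma tens_coset: "tens a b = J +>\<^bsub>M.F\<^esub> M.e (a, b)"
  by (simp add: pure_tensor_def)

lemma tens_closed [simp, intro]: "a \<in> carrier A \<Longrightarrow> b \<in> carrier B \<Longrightarrow> tens a b \<in> carrier T"
  by (simp add: tens_coset T_quotient coset_closed e_closed)

lemma tens_mult:
  "\<lbrakk>a \<in> carrier A; a' \<in> carrier A; b \<in> carrier B; b' \<in> carrier B\<rbrakk> \<Longrightarrow>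
    tens a b \<otimes>\<^bsub>T\<^esub> tens a' b' = tens (a \<otimes>\<^bsub>A\<^esub> a') (b \<otimes>\<^bsub>B\<^esub> b')"
  by (simp add: tens_coset T_quotient coset_mult e_closed M.e_mult)

lemma tens_one: "\<one>\<^bsub>T\<^esub> = tens \<one>\<^bsub>A\<^esub> \<one>\<^bsub>B\<^esub>"
  by (simp add: tens_coset T_quotient coset_one M.one_F)

lemma relator_coset:
  assumes "l \<ominus>\<^bsub>M.F\<^esub> r \<in> tensor_relators K A B" "l \<in> carrier M.F" "r \<in> carrier M.F"
  shows "J +>\<^bsub>M.F\<^esub> l = J +>\<^bsub>M.F\<^esub> r"
  using assms F.A.genideal_self[OF relators_closed]
  by (subst coset_eq_iff) (auto simp: tensor_ideal_def)

lemma tens_bilinear: "tens \<in> bilinear_maps K A B T"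
proof (rule bilinear_mapsI)
  fix a a' b assume *: "a \<in> carrier A" "a' \<in> carrier A" "b \<in> carrier B"
  show "tens (a \<oplus>\<^bsub>A\<^esub> a') b = tens a b \<oplus>\<^bsub>T\<^esub> tens a' b"
    unfolding T_quotient tens_coset coset_add[OF e_closed[OF *(1,3)] e_closed[OF *(2,3)]]
    by (rule relator_coset) (use * in \<open>auto simp: tensor_relators_def Let_def e_closed\<close>)
next
  fix a b b' assume *: "a \<in> carrier A" "b \<in> carrier B" "b' \<in> carrier B"
  show "tens a (b \<oplus>\<^bsub>B\<^esub> b') = tens a b \<oplus>\<^bsub>T\<^esub> tens a b'"
    unfolding T_quotient tens_coset coset_add[OF e_closed[OF *(1,2)] e_closed[OF *(1,3)]]
    by (rule relator_coset) (use * in \<open>auto simp: tensor_relators_def Let_def e_closed\<close>)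
next
  fix c a b assume *: "c \<in> carrier K" "a \<in> carrier A" "b \<in> carrier B"
  show "tens (c \<odot>\<^bsub>A\<^esub> a) b = c \<odot>\<^bsub>T\<^esub> tens a b"
    unfolding T_quotient tens_coset coset_smult[OF *(1) e_closed[OF *(2,3)]]
    by (rule relator_coset) (use * in \<open>auto simp: tensor_relators_def Let_def e_closed\<close>)
  show "tens a (c \<odot>\<^bsub>B\<^esub> b) = c \<odot>\<^bsub>T\<^esub> tens a b"
    unfolding T_quotient tens_coset coset_smult[OF *(1) e_closed[OF *(2,3)]]
    by (rule relator_coset) (use * in \<open>auto simp: tensor_relators_def Let_def e_closed\<close>)
qed auto

lemmas tens_bilin = bilinear_mapsD(2-)[OF tens_bilinear]

lemma tensor_induct [consumes 1, case_names zero smult add pure]: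
  assumes "t \<in> carrier T"
    and "P \<zero>\<^bsub>T\<^esub>"
    and "\<And>c s. c \<in> carrier K \<Longrightarrow> s \<in> carrier T \<Longrightarrow> P s \<Longrightarrow> P (c \<odot>\<^bsub>T\<^esub> s)"
    and "\<And>s t. s \<in> carrier T \<Longrightarrow> t \<in> carrier T \<Longrightarrow> P s \<Longrightarrow> P t \<Longrightarrow> P (s \<oplus>\<^bsub>T\<^esub> t)"
    and "\<And>a b. a \<in> carrier A \<Longrightarrow> b \<in> carrier B \<Longrightarrow> P (tens a b)"
  shows "P t"
proof -
  have hom: "(+>\<^bsub>M.F\<^esub>) J \<in> algebra_homs K M.F T"
    unfolding T_quotient by (rule coset_hom)
  obtain f where f: "f \<in> carrier M.F" "t = J +>\<^bsub>M.F\<^esub> f"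
    using assms(1) unfolding T_quotient by (rule Q_cases)
  from f(1) have "P (J +>\<^bsub>M.F\<^esub> f)"
  proof (induction f rule: M.F_induct)
    case zero
    then show ?case using assms(2) by (simp add: algebra_homs_zero[OF M.F_algebra T_algebra hom])
  next
    case (basis p)
    then show ?case using assms(5) by (cases p) (auto simp: tens_coset)
  qed (simp_all add: algebra_homsD[OF hom] assms(3,4))
  then show ?thesis by (simp add: f)
qed

lemma tensor_lift_quot: "tensor_lift K V \<beta> = quot_lift (ext V \<beta>)"
  by (rule ext) (simp add: tensor_lift_def quot_lift_def lin_ext_def)

lemma lift_linear:
  assumes "module K V" "\<beta> \<in> bilinear_maps K A B V"
  shows "tensor_lift K V \<beta> \<in> linear_maps K T V"
  unfolding tensor_lift_quot T_quotient
  by (rule quot_lift_linear[OF assms(1) ext_linear[OF assms] ext_ideal[OF assms]])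

lemma lift_tens:
  assumes "module K V" "\<beta> \<in> bilinear_maps K A B V" "a \<in> carrier A" "b \<in> carrier B"
  shows "tensor_lift K V \<beta> (tens a b) = \<beta> a b"
  unfolding tensor_lift_quot tens_coset using assms
  by (simp add: quot_lift_coset[OF assms(1) ext_linear[OF assms(1,2)] ext_ideal[OF assms(1,2)]]
      e_closed ext_e)

lemma linear_maps_T_eqI:
  assumes "module K V" "f \<in> linear_maps K T V" "g \<in> linear_maps K T V"
    and "\<And>a b. \<lbrakk>a \<in> carrier A; b \<in> carrier B\<rbrakk> \<Longrightarrow> f (tens a b) = g (tens a b)" "t \<in> carrier T"
  shows "f t = g t"
  using assms(5)
  by (induction t rule: tensor_induct)
     (auto simp: linear_maps_zero[OF T.module_axioms assms(1)] linear_mapsD[OF assms(2)]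
       linear_mapsD[OF assms(3)] assms)

text \<open>Products of arbitrary tensors are sums of products of pure ones, so multiplicativity is a
condition on pure tensors.\<close>

lemma linear_mult_homI:
  assumes V: "assoc_algebra K V" and f: "f \<in> linear_maps K T V"
    and mult: "\<And>a a' b b'. \<lbrakk>a \<in> carrier A; a' \<in> carrier A; b \<in> carrier B; b' \<in> carrier B\<rbrakk> \<Longrightarrow>
      f (tens (a \<otimes>\<^bsub>A\<^esub> a') (b \<otimes>\<^bsub>B\<^esub> b')) = f (tens a b) \<otimes>\<^bsub>V\<^esub> f (tens a' b')"
    and one: "f (tens \<one>\<^bsub>A\<^esub> \<one>\<^bsub>B\<^esub>) = \<one>\<^bsub>V\<^esub>"
  shows "f \<in> algebra_homs K T V"
proof (rule algebra_homsI[OF f])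
  interpret V: assoc_algebra K V by fact
  note fs = linear_mapsD[OF f] linear_maps_zero[OF T.module_axioms V.module_axioms f]
  have 1: "f (tens a b \<otimes>\<^bsub>T\<^esub> t) = f (tens a b) \<otimes>\<^bsub>V\<^esub> f t"
    if "t \<in> carrier T" "a \<in> carrier A" "b \<in> carrier B" for a b t
    using that
    by (induction t rule: tensor_induct)
       (simp_all add: fs T.A.r_distr T.smult_mult_right V.A.r_distr V.smult_mult_right tens_mult mult)
  show "f (s \<otimes>\<^bsub>T\<^esub> t) = f s \<otimes>\<^bsub>V\<^esub> f t" if "s \<in> carrier T" "t \<in> carrier T" for s t
    using that
    by (induction s rule: tensor_induct)
       (simp_all add: fs T.A.l_distr T.smult_mult_left V.A.l_distr V.smult_mult_left 1)
  show "f \<one>\<^bsub>T\<^esub> = \<one>\<^bsub>V\<^esub>" by (simp add: tens_one one)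
qed

lemma lift_hom:
  assumes V: "assoc_algebra K V" and \<beta>: "\<beta> \<in> bilinear_maps K A B V"
    and "\<And>a a' b b'. \<lbrakk>a \<in> carrier A; a' \<in> carrier A; b \<in> carrier B; b' \<in> carrier B\<rbrakk> \<Longrightarrow>
      \<beta> (a \<otimes>\<^bsub>A\<^esub> a') (b \<otimes>\<^bsub>B\<^esub> b') = \<beta> a b \<otimes>\<^bsub>V\<^esub> \<beta> a' b'"
    and "\<beta> \<one>\<^bsub>A\<^esub> \<one>\<^bsub>B\<^esub> = \<one>\<^bsub>V\<^esub>"
  shows "tensor_lift K V \<beta> \<in> algebra_homs K T V"
proof -
  have M: "module K V" using V by (rule assoc_algebra.axioms)
  show ?thesis
    by (rule linear_mult_homI[OF V lift_linear[OF M \<beta>]]) (simp_all add: lift_tens[OF M \<beta>] assms)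
qed

end

lemma tensorI: "\<lbrakk>assoc_algebra K A; assoc_algebra K B\<rbrakk> \<Longrightarrow> tensor K A B"
  by (rule tensor.intro)

subsection \<open>Maps between tensor products\<close>

context
  fixes K :: "('k, 'z) ring_scheme" and A :: "('k, 'a) module" and B :: "('k, 'b) module"
    and C :: "('k, 'c) module" and D :: "('k, 'd) module" and f g
  assumes alg: "assoc_algebra K A" "assoc_algebra K B" "assoc_algebra K C" "assoc_algebra K D"
    and f: "f \<in> algebra_homs K A C" and g: "g \<in> algebra_homs K B D"
begin

interpretation AB: tensor K A B by (intro tensorI alg)
interpretation CD: tensor K C D by (intro tensorI alg)

lemma tensor_map_bilinear: "(\<lambda>a b. pure_tensor K C D (f a) (g b)) \<in> bilinear_maps K A B CD.T"
  by (rule bilinear_mapsI) (simp_all add: algebra_homsD[OF f] algebra_homsD[OF g] CD.tens_bilin CD.tens_closed)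

lemma tensor_map_tens:
  "\<lbrakk>a \<in> carrier A; b \<in> carrier B\<rbrakk> \<Longrightarrow>
    tensor_map K C D f g (pure_tensor K A B a b) = pure_tensor K C D (f a) (g b)"
  unfolding tensor_map_def by (rule AB.lift_tens[OF CD.T.module_axioms tensor_map_bilinear])

lemma tensor_map_hom: "tensor_map K C D f g \<in> algebra_homs K AB.T CD.T"
  unfolding tensor_map_def
  by (rule AB.lift_hom[OF CD.T_algebra tensor_map_bilinear])
     (simp_all add: algebra_homsD[OF f] algebra_homsD[OF g] CD.tens_mult CD.tens_one)

end

subsection \<open>The associativity isomorphism\<close>

context
  fixes K :: "('k, 'z) ring_scheme" and A :: "('k, 'a) module" and B :: "('k, 'b) module"
    and C :: "('k, 'c) module"
  assumes alg: "assoc_algebra K A" "assoc_algebra K B" "assoc_algebra K C"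
begin

interpretation A: assoc_algebra K A by (rule alg)
interpretation B: assoc_algebra K B by (rule alg)
interpretation C: assoc_algebra K C by (rule alg)
interpretation AB: tensor K A B by (intro tensorI alg)
interpretation BC: tensor K B C by (intro tensorI alg)
interpretation ABC: tensor K A BC.T by (intro tensorI alg BC.T_algebra)
interpretation ABC': tensor K AB.T C by (intro tensorI alg AB.T_algebra)

lemma tensor_assoc_inner_bilinear:
  "c \<in> carrier C \<Longrightarrow>
    (\<lambda>a b. pure_tensor K A BC.T a (pure_tensor K B C b c)) \<in> bilinear_maps K A B ABC.T"
  by (rule bilinear_mapsI) (simp_all add: ABC.tens_bilin BC.tens_bilin)

text \<open>Linearity in the third factor is visible only on pure tensors of the first two, since the
third factor enters through the bilinear map that is being extended.\<close>

lemma tensor_assoc_bilinear: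
  "(\<lambda>s c. tensor_lift K ABC.T (\<lambda>a b. pure_tensor K A BC.T a (pure_tensor K B C b c)) s)
    \<in> bilinear_maps K AB.T C ABC.T" (is "?\<beta> \<in> _")
proof -
  note inner = tensor_assoc_inner_bilinear
  note lin = AB.lift_linear[OF ABC.T.module_axioms inner]
  note lins = linear_mapsD[OF lin] linear_maps_zero[OF AB.T.module_axioms ABC.T.module_axioms lin]
    AB.lift_tens[OF ABC.T.module_axioms inner]
  show ?thesis
  proof (rule bilinear_mapsI)
    fix s c c' assume s: "s \<in> carrier AB.T" and c: "c \<in> carrier C" "c' \<in> carrier C"
    show "?\<beta> s (c \<oplus>\<^bsub>C\<^esub> c') = ?\<beta> s c \<oplus>\<^bsub>ABC.T\<^esub> ?\<beta> s c'"
      using s c by (induction s rule: AB.tensor_induct)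
        (simp_all add: lins ABC.tens_bilin BC.tens_bilin ABC.T.smult_r_distr ABC.T.M.a_ac)
  next
    fix k s c assume k: "k \<in> carrier K" and s: "s \<in> carrier AB.T" and c: "c \<in> carrier C"
    show "?\<beta> s (k \<odot>\<^bsub>C\<^esub> c) = k \<odot>\<^bsub>ABC.T\<^esub> ?\<beta> s c"
      using s c k by (induction s rule: AB.tensor_induct)
        (simp_all add: lins ABC.tens_bilin BC.tens_bilin ABC.T.smult_r_distr
          ABC.T.smult_assoc1[symmetric] A.K.m_comm)
  qed (simp_all add: lins)
qed

lemma tensor_assoc_lift:
  "tensor_assoc K A B C = tensor_lift K ABC.T
    (\<lambda>s c. tensor_lift K ABC.T (\<lambda>a b. pure_tensor K A BC.T a (pure_tensor K B C b c)) s)"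
  by (simp add: tensor_assoc_def Let_def)

lemma tensor_assoc_tens:
  "\<lbrakk>a \<in> carrier A; b \<in> carrier B; c \<in> carrier C\<rbrakk> \<Longrightarrow>
    tensor_assoc K A B C (pure_tensor K AB.T C (pure_tensor K A B a b) c) =
      pure_tensor K A BC.T a (pure_tensor K B C b c)"
  by (simp add: tensor_assoc_lift ABC'.lift_tens[OF ABC.T.module_axioms tensor_assoc_bilinear]
      AB.lift_tens[OF ABC.T.module_axioms tensor_assoc_inner_bilinear])

lemma tensor_assoc_hom: "tensor_assoc K A B C \<in> algebra_homs K ABC'.T ABC.T"
  unfolding tensor_assoc_lift
proof (rule ABC'.lift_hom[OF ABC.T_algebra tensor_assoc_bilinear])
  note inner = tensor_assoc_inner_bilinear
  note lin = AB.lift_linear[OF ABC.T.module_axioms inner]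
  note lins = linear_mapsD[OF lin] linear_maps_zero[OF AB.T.module_axioms ABC.T.module_axioms lin]
    AB.lift_tens[OF ABC.T.module_axioms inner]
  let ?\<beta> = "\<lambda>s c. tensor_lift K ABC.T (\<lambda>a b. pure_tensor K A BC.T a (pure_tensor K B C b c)) s"
  fix s s' c c' assume s: "s \<in> carrier AB.T" "s' \<in> carrier AB.T" and c: "c \<in> carrier C" "c' \<in> carrier C"
  have 1: "?\<beta> (AB.tens a b \<otimes>\<^bsub>AB.T\<^esub> s') (c \<otimes>\<^bsub>C\<^esub> c') = ?\<beta> (AB.tens a b) c \<otimes>\<^bsub>ABC.T\<^esub> ?\<beta> s' c'"
    if "a \<in> carrier A" "b \<in> carrier B" for a b
    using s(2) c that
    by (induction s' rule: AB.tensor_induct)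
       (simp_all add: lins AB.T.A.r_distr AB.T.smult_mult_right ABC.T.A.r_distr ABC.T.smult_mult_right
         AB.tens_mult ABC.tens_mult BC.tens_mult)
  show "?\<beta> (s \<otimes>\<^bsub>AB.T\<^esub> s') (c \<otimes>\<^bsub>C\<^esub> c') = ?\<beta> s c \<otimes>\<^bsub>ABC.T\<^esub> ?\<beta> s' c'"
    using s(1) s(2) c
    by (induction s rule: AB.tensor_induct)
       (simp_all add: lins AB.T.A.l_distr AB.T.smult_mult_left ABC.T.A.l_distr ABC.T.smult_mult_left 1)
next
  show "tensor_lift K ABC.T (\<lambda>a b. pure_tensor K A BC.T a (pure_tensor K B C b \<one>\<^bsub>C\<^esub>)) \<one>\<^bsub>AB.T\<^esub> = \<one>\<^bsub>ABC.T\<^esub>"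
    by (simp add: AB.tens_one ABC.tens_one BC.tens_one
        AB.lift_tens[OF ABC.T.module_axioms tensor_assoc_inner_bilinear])
qed

end

section \<open>Quantum integers at a root of unity\<close>

locale root_of_unity = K?: field K for K :: "('k, 'z) ring_scheme" (structure) +
  fixes n :: nat and \<omega> :: 'k
  assumes primitive: "primitive_root_of_unity K n \<omega>" and n_gt_1: "n > 1"
begin

abbreviation qi where "qi \<equiv> q_int K \<omega>"
abbreviation qf where "qf \<equiv> q_fact K \<omega>"

lemma omega_closed [simp, intro]: "\<omega> \<in> carrier K"
  and omega_pow_n [simp]: "\<omega> [^] n = \<one>"
  and omega_pow_neq: "0 < k \<Longrightarrow> k < n \<Longrightarrow> \<omega> [^] k \<noteq> \<one>"
  using primitive by (auto simp: primitive_root_of_unity_def)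

lemma qi_closed [simp, intro]: "qi k \<in> carrier K"
  by (auto simp: q_int_def intro!: K.finsum_closed)

lemma qi_0 [simp]: "qi 0 = \<zero>"
  by (simp add: q_int_def)

lemma qi_Suc: "qi (Suc k) = qi k \<oplus> \<omega> [^] k"
  by (simp add: q_int_def lessThan_Suc K.finsum_insert K.a_comm)

lemma qi_add: "qi (i + j) = qi j \<oplus> \<omega> [^] j \<otimes> qi i"
proof (induction i)
  case (Suc i)
  then show ?case
    by (simp add: qi_Suc K.r_distr K.nat_pow_mult K.a_assoc add.commute)
qed simp

text \<open>The geometric sum. It shows that \<open>(n)\<^sub>\<omega> = 0\<close> while \<open>(k)\<^sub>\<omega>\<close> is invertible for \<open>0 < k < n\<close>; all that
follows rests on these two facts.\<close>

lemma qi_geometric: "(\<one> \<ominus> \<omega>) \<otimes> qi k = \<one> \<ominus> \<omega> [^] k"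
proof (induction k)
  case (Suc k)
  have p: "\<omega> [^] k \<in> carrier K" "\<omega> \<in> carrier K" by simp_all
  have "(\<one> \<ominus> \<omega>) \<otimes> qi (Suc k) = (\<one> \<ominus> \<omega> [^] k) \<oplus> (\<one> \<ominus> \<omega>) \<otimes> \<omega> [^] k"
    by (simp add: qi_Suc K.r_distr Suc[symmetric])
  also have "\<dots> = \<one> \<ominus> \<omega> [^] k \<otimes> \<omega>"
    using p by algebra
  finally show ?case by simp
qed (simp add: a_minus_def K.r_neg)

lemma minus_eq_zero_iff: "\<lbrakk>a \<in> carrier K; b \<in> carrier K\<rbrakk> \<Longrightarrow> a \<ominus> b = \<zero> \<longleftrightarrow> a = b"
  using K.minus_equality[of a "\<ominus> b"] by (auto simp: a_minus_def K.r_neg)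

lemma one_minus_omega: "\<one> \<ominus> \<omega> \<noteq> \<zero>"
  using omega_pow_neq[of 1] n_gt_1 by (simp add: minus_eq_zero_iff)

lemma qi_n [simp]: "qi n = \<zero>"
proof -
  have "(\<one> \<ominus> \<omega>) \<otimes> qi n = \<zero>" by (simp only: qi_geometric omega_pow_n) (simp add: minus_eq_zero_iff)
  then show ?thesis using one_minus_omega by (simp add: K.integral_iff)
qed

lemma qi_n_add: "qi (n + r) = qi r"
  using qi_add[of n r] by simp

lemma qi_nonzero: "0 < k \<Longrightarrow> k < n \<Longrightarrow> qi k \<noteq> \<zero>"
  using qi_geometric[of k] omega_pow_neq[of k] minus_eq_zero_iff[of \<one> "\<omega> [^] k"] by fastforce

lemma qf_closed [simp, intro]: "qf k \<in> carrier K"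
  by (auto simp: q_fact_def intro!: K.finprod_closed)

lemma qf_0 [simp]: "qf 0 = \<one>"
  by (simp add: q_fact_def)

lemma qf_Suc: "qf (Suc k) = qf k \<otimes> qi (Suc k)"
proof -
  have "{1..Suc k} = insert (Suc k) {1..k}" by auto
  then show ?thesis by (simp add: q_fact_def K.finprod_insert K.m_comm)
qed

lemma qf_nonzero: "k < n \<Longrightarrow> qf k \<noteq> \<zero>"
  by (induction k) (auto simp: qf_Suc K.integral_iff qi_nonzero)

lemma qf_Unit: "k < n \<Longrightarrow> qf k \<in> Units K"
  using qf_nonzero K.field_Units by simp

lemma qi_Unit: "0 < k \<Longrightarrow> k < n \<Longrightarrow> qi k \<in> Units K"
  using qi_nonzero K.field_Units by simp

lemma inv_qf_Suc:
  assumes "Suc k < n"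
  shows "qi (Suc k) \<otimes> inv (qf (Suc k)) = inv (qf k)"
proof -
  have u: "qf k \<in> Units K" "qi (Suc k) \<in> Units K"
    using assms by (auto intro: qf_Unit qi_Unit)
  have c: "inv (qf k) \<in> carrier K" "inv (qi (Suc k)) \<in> carrier K" using u by auto
  have "qf k \<otimes> qi (Suc k) \<otimes> (inv (qi (Suc k)) \<otimes> inv (qf k)) = qf k \<otimes> (qi (Suc k) \<otimes> inv (qi (Suc k))) \<otimes> inv (qf k)"
    using c by (simp only: K.m_assoc K.m_closed qf_closed qi_closed)
  also have "\<dots> = \<one>" using u by simp
  finally have "inv (qf (Suc k)) = inv (qi (Suc k)) \<otimes> inv (qf k)"
    unfolding qf_Suc using c by (intro K.comm_inv_char) auto
  then show ?thesis
    using u c by (simp add: K.m_assoc[symmetric])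
qed

end

section \<open>Truncated quantum exponentials\<close>

text \<open>The divided power \<open>X\<^sup>i / (i)!\<^sub>\<omega>\<close>. The quantum factorial vanishes from \<open>n\<close> on, and for \<open>X\<^sup>n = 0\<close> the
value \<open>0\<close> there is what makes the recursion \<open>dp_mult\<close> hold without exception. These are the
coefficients of the truncated quantum exponential \<open>e\<^sub>X(t) = \<Sum>\<^sub>i X\<^sup>i t\<^sup>i / (i)!\<^sub>\<omega>\<close>.\<close>

definition divided_power :: "('k, 'z) ring_scheme \<Rightarrow> ('k, 'a) module \<Rightarrow> nat \<Rightarrow> 'k \<Rightarrow> 'a \<Rightarrow> nat \<Rightarrow> 'a" where
  "divided_power K E n \<omega> X i =
     (if i < n then inv\<^bsub>K\<^esub> (q_fact K \<omega> i) \<odot>\<^bsub>E\<^esub> (X [^]\<^bsub>E\<^esub> i) else \<zero>\<^bsub>E\<^esub>)"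

text \<open>The coefficient of \<open>t\<^sup>s\<close> in \<open>e\<^sub>B(t) e\<^sub>A(t)\<close>.\<close>

definition exp_coeff :: "('k, 'z) ring_scheme \<Rightarrow> ('k, 'a) module \<Rightarrow> nat \<Rightarrow> 'k \<Rightarrow> 'a \<Rightarrow> 'a \<Rightarrow> nat \<Rightarrow> 'a" where
  "exp_coeff K E n \<omega> A B s =
     (\<Oplus>\<^bsub>E\<^esub>i\<in>{..s}. divided_power K E n \<omega> B i \<otimes>\<^bsub>E\<^esub> divided_power K E n \<omega> A (s - i))"

text \<open>For \<open>A = u \<otimes> x\<close> and \<open>B = x \<otimes> 1\<close> this is the element by which the coproduct will be twisted.\<close>

definition twist :: "('k, 'z) ring_scheme \<Rightarrow> ('k, 'a) module \<Rightarrow> nat \<Rightarrow> 'k \<Rightarrow> 'k \<Rightarrow> 'a \<Rightarrow> 'a \<Rightarrow> 'a" where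
  "twist K E n \<omega> c A B = \<one>\<^bsub>E\<^esub> \<oplus>\<^bsub>E\<^esub> c \<odot>\<^bsub>E\<^esub> exp_coeff K E n \<omega> A B n"

text \<open>The relations between \<open>u \<otimes> x\<close> and \<open>x \<otimes> 1\<close>, under which the quantum binomial theorem applies to
\<open>A + B\<close>.\<close>

definition q_pair :: "('k, 'z) ring_scheme \<Rightarrow> ('k, 'a) module \<Rightarrow> nat \<Rightarrow> 'k \<Rightarrow> 'a \<Rightarrow> 'a \<Rightarrow> bool" where
  "q_pair K E n \<omega> A B \<longleftrightarrow> A \<in> carrier E \<and> B \<in> carrier E \<and>
     A \<otimes>\<^bsub>E\<^esub> B = \<omega> \<odot>\<^bsub>E\<^esub> (B \<otimes>\<^bsub>E\<^esub> A) \<and> A [^]\<^bsub>E\<^esub> n = \<zero>\<^bsub>E\<^esub> \<and> B [^]\<^bsub>E\<^esub> n = \<zero>\<^bsub>E\<^esub>"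

context assoc_algebra
begin

lemma smult_cancel:
  assumes "c \<in> carrier K" "c \<noteq> \<zero>\<^bsub>K\<^esub>" "x \<in> carrier A" "y \<in> carrier A" "c \<odot>\<^bsub>A\<^esub> x = c \<odot>\<^bsub>A\<^esub> y"
  shows "x = y"
proof -
  have u: "c \<in> Units K" using assms K.field_Units by simp
  then have "inv\<^bsub>K\<^esub> c \<odot>\<^bsub>A\<^esub> (c \<odot>\<^bsub>A\<^esub> x) = x" "inv\<^bsub>K\<^esub> c \<odot>\<^bsub>A\<^esub> (c \<odot>\<^bsub>A\<^esub> y) = y"
    using assms(1-4) by (simp_all add: smult_assoc1[symmetric])
  then show ?thesis using assms(5) by metis
qed

lemma pow_commute_scaled:
  assumes "g \<in> carrier A" "x \<in> carrier A" "\<rho> \<in> carrier K" "g \<otimes>\<^bsub>A\<^esub> x = \<rho> \<odot>\<^bsub>A\<^esub> (x \<otimes>\<^bsub>A\<^esub> g)"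
  shows "g \<otimes>\<^bsub>A\<^esub> x [^]\<^bsub>A\<^esub> (i::nat) = \<rho> [^]\<^bsub>K\<^esub> i \<odot>\<^bsub>A\<^esub> (x [^]\<^bsub>A\<^esub> i \<otimes>\<^bsub>A\<^esub> g)"
proof (induction i)
  case (Suc i)
  have "g \<otimes>\<^bsub>A\<^esub> x [^]\<^bsub>A\<^esub> Suc i = \<rho> [^]\<^bsub>K\<^esub> i \<odot>\<^bsub>A\<^esub> (x [^]\<^bsub>A\<^esub> i \<otimes>\<^bsub>A\<^esub> (g \<otimes>\<^bsub>A\<^esub> x))"
    using assms Suc by (simp add: A.m_assoc[symmetric] smult_mult_left) (simp add: A.m_assoc)
  also have "\<dots> = \<rho> [^]\<^bsub>K\<^esub> Suc i \<odot>\<^bsub>A\<^esub> (x [^]\<^bsub>A\<^esub> Suc i \<otimes>\<^bsub>A\<^esub> g)"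
    using assms by (simp add: smult_mult_right smult_assoc1 A.m_assoc)
  finally show ?case .
qed (use assms in simp)

lemma pow_commute_scaled':
  assumes "g \<in> carrier A" "x \<in> carrier A" "\<rho> \<in> carrier K" "x \<otimes>\<^bsub>A\<^esub> g = \<rho> \<odot>\<^bsub>A\<^esub> (g \<otimes>\<^bsub>A\<^esub> x)"
  shows "x [^]\<^bsub>A\<^esub> (i::nat) \<otimes>\<^bsub>A\<^esub> g = \<rho> [^]\<^bsub>K\<^esub> i \<odot>\<^bsub>A\<^esub> (g \<otimes>\<^bsub>A\<^esub> x [^]\<^bsub>A\<^esub> i)"
proof (induction i)
  case (Suc i)
  have "x [^]\<^bsub>A\<^esub> Suc i \<otimes>\<^bsub>A\<^esub> g = \<rho> \<odot>\<^bsub>A\<^esub> ((x [^]\<^bsub>A\<^esub> i \<otimes>\<^bsub>A\<^esub> g) \<otimes>\<^bsub>A\<^esub> x)"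
    using assms by (simp add: A.m_assoc smult_mult_right)
  also have "\<dots> = \<rho> [^]\<^bsub>K\<^esub> Suc i \<odot>\<^bsub>A\<^esub> (g \<otimes>\<^bsub>A\<^esub> x [^]\<^bsub>A\<^esub> Suc i)"
    using assms Suc by (simp add: smult_mult_left smult_assoc1[symmetric] A.m_assoc K.m_comm)
  finally show ?case .
qed (use assms in simp)

end

locale q_exponential = assoc_algebra K E + root_of_unity K n \<omega>
  for E :: "('k, 'a) module" (structure) and K :: "('k, 'z) ring_scheme" (structure) and n \<omega>
begin

abbreviation dp where "dp \<equiv> divided_power K E n \<omega>"
abbreviation T where "T \<equiv> exp_coeff K E n \<omega>"
abbreviation tw where "tw \<equiv> twist K E n \<omega>"
abbreviation pair where "pair \<equiv> q_pair K E n \<omega>"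

lemma inv_qf_closed [simp, intro]: "k < n \<Longrightarrow> inv\<^bsub>K\<^esub> (qf k) \<in> carrier K"
  by (simp add: qf_Unit)

lemma dp_closed [simp, intro]: "X \<in> carrier E \<Longrightarrow> dp X i \<in> carrier E"
  by (simp add: divided_power_def)

lemma dp_0 [simp]: "X \<in> carrier E \<Longrightarrow> dp X 0 = \<one>"
  using n_gt_1 by (simp add: divided_power_def)

lemma dp_ge [simp]: "n \<le> i \<Longrightarrow> dp X i = \<zero>"
  by (simp add: divided_power_def)

text \<open>At \<open>i = n - 1\<close> both sides vanish, the left one because \<open>X\<^sup>n = 0\<close>; the truncation costs nothing.\<close>

lemma dp_mult:
  assumes X: "X \<in> carrier E" "X [^] n = \<zero>"
  shows "dp X i \<otimes> X = qi (Suc i) \<odot> dp X (Suc i)" and "X \<otimes> dp X i = qi (Suc i) \<odot> dp X (Suc i)"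
proof -
  show 1: "dp X i \<otimes> X = qi (Suc i) \<odot> dp X (Suc i)"
  proof (cases "Suc i < n")
    case True
    then show ?thesis
      using X by (simp add: divided_power_def smult_mult_left smult_assoc1[symmetric] inv_qf_Suc qf_Unit)
  next
    case False
    then consider "Suc i = n" | "n \<le> i" by linarith
    then show ?thesis
    proof cases
      case 1
      then have "X [^] i \<otimes> X = \<zero>" using X by (metis A.nat_pow_Suc)
      then show ?thesis using 1 X by (simp add: divided_power_def smult_mult_left)
    qed (use X in simp)
  qed
  have "X \<otimes> dp X i = dp X i \<otimes> X"
    using X by (simp add: divided_power_def smult_mult_left smult_mult_right A.nat_pow_Suc2[symmetric])
  then show "X \<otimes> dp X i = qi (Suc i) \<odot> dp X (Suc i)" using 1 by simp
qed

lemma dp_mult_zero: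
  assumes X: "X \<in> carrier E" "X [^] n = \<zero>" and "n \<le> i + j"
  shows "dp X i \<otimes> dp X j = \<zero>"
proof -
  have "X [^] (i + j) = X [^] n \<otimes> X [^] (i + j - n)"
    using X(1) assms(3) by (simp add: A.nat_pow_mult)
  then have "X [^] (i + j) = \<zero>" using X by simp
  then show ?thesis
    using X by (simp add: divided_power_def smult_mult_left smult_mult_right A.nat_pow_mult)
qed

lemma dp_commute_scaled:
  assumes "g \<in> carrier E" "X \<in> carrier E" "\<rho> \<in> carrier K"
  shows "g \<otimes> X = \<rho> \<odot> (X \<otimes> g) \<Longrightarrow> g \<otimes> dp X i = \<rho> [^]\<^bsub>K\<^esub> i \<odot> (dp X i \<otimes> g)"
    and "X \<otimes> g = \<rho> \<odot> (g \<otimes> X) \<Longrightarrow> dp X i \<otimes> g = \<rho> [^]\<^bsub>K\<^esub> i \<odot> (g \<otimes> dp X i)"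
  using assms pow_commute_scaled[OF assms, of i] pow_commute_scaled'[OF assms, of i]
  by (simp_all add: divided_power_def smult_mult_left smult_mult_right smult_assoc1[symmetric] K.m_comm)

lemma T_closed [simp, intro]: "\<lbrakk>A \<in> carrier E; B \<in> carrier E\<rbrakk> \<Longrightarrow> T A B s \<in> carrier E"
  by (auto simp: exp_coeff_def intro!: M.finsum_closed)

lemma T_0: "\<lbrakk>A \<in> carrier E; B \<in> carrier E\<rbrakk> \<Longrightarrow> T A B 0 = \<one>"
  by (simp add: exp_coeff_def)

text \<open>If \<open>i + j \<ge> 2 n - 1\<close>, then \<open>i \<ge> n\<close> or \<open>j \<ge> n\<close>.\<close>

lemma T_large:
  assumes "A \<in> carrier E" "B \<in> carrier E" "2 * n \<le> Suc s"
  shows "T A B s = \<zero>"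
  unfolding exp_coeff_def
proof (rule M.add.finprod_one_eqI)
  fix i
  show "dp B i \<otimes> dp A (s - i) = \<zero>"
    using assms by (cases "n \<le> i") auto
qed

lemma T_commute_scaled:
  assumes "g \<in> carrier E" "A \<in> carrier E" "B \<in> carrier E" "\<rho> \<in> carrier K"
    and gA: "g \<otimes> A = \<rho> \<odot> (A \<otimes> g)" and gB: "g \<otimes> B = \<rho> \<odot> (B \<otimes> g)"
  shows "g \<otimes> T A B s = \<rho> [^]\<^bsub>K\<^esub> s \<odot> (T A B s \<otimes> g)"
proof -
  have 1: "g \<otimes> (dp B i \<otimes> dp A (s - i)) = \<rho> [^]\<^bsub>K\<^esub> s \<odot> (dp B i \<otimes> dp A (s - i) \<otimes> g)"
    if "i \<le> s" for i
  proof -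
    have "g \<otimes> (dp B i \<otimes> dp A (s - i)) = \<rho> [^]\<^bsub>K\<^esub> i \<odot> (dp B i \<otimes> (g \<otimes> dp A (s - i)))"
      using assms by (simp add: A.m_assoc[symmetric] dp_commute_scaled(1)[OF _ _ _ gB] smult_mult_left)
    also have "\<dots> = \<rho> [^]\<^bsub>K\<^esub> s \<odot> (dp B i \<otimes> dp A (s - i) \<otimes> g)"
      using assms(1-4) that by (simp add: dp_commute_scaled(1)[OF _ _ _ gA] smult_mult_right
          smult_assoc1[symmetric] A.m_assoc K.nat_pow_mult)
    finally show ?thesis .
  qed
  have "g \<otimes> T A B s = (\<Oplus>i\<in>{..s}. g \<otimes> (dp B i \<otimes> dp A (s - i)))"
    unfolding exp_coeff_def using assms by (intro A.finsum_rdistr) auto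
  also have "\<dots> = (\<Oplus>i\<in>{..s}. \<rho> [^]\<^bsub>K\<^esub> s \<odot> (dp B i \<otimes> dp A (s - i) \<otimes> g))"
    using assms(1-4) by (intro M.finsum_cong') (auto simp: 1)
  also have "\<dots> = \<rho> [^]\<^bsub>K\<^esub> s \<odot> (\<Oplus>i\<in>{..s}. dp B i \<otimes> dp A (s - i) \<otimes> g)"
    using assms by (intro finsum_smult_ldistr[symmetric]) auto
  also have "\<dots> = \<rho> [^]\<^bsub>K\<^esub> s \<odot> (T A B s \<otimes> g)"
    unfolding exp_coeff_def using assms by (subst A.finsum_ldistr) auto
  finally show ?thesis .
qed

lemma pairD:
  assumes "pair A B"
  shows "A \<in> carrier E" "B \<in> carrier E" "A \<otimes> B = \<omega> \<odot> (B \<otimes> A)"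
    "A [^] n = \<zero>" "B [^] n = \<zero>"
  using assms by (auto simp: q_pair_def)

text \<open>In the recursion below, multiplication by \<open>A\<close> and by \<open>B\<close> produces the same terms \<open>t i\<close> with
weights \<open>c i\<close> and \<open>d i\<close>, whose sum does not depend on \<open>i\<close>.\<close>

lemma sum_weighted:
  assumes "\<And>i. i \<le> s \<Longrightarrow> t i \<in> carrier E" "\<And>i. i \<le> s \<Longrightarrow> c i \<in> carrier K" "\<And>i. i \<le> s \<Longrightarrow> d i \<in> carrier K"
    and "\<And>i. i \<le> s \<Longrightarrow> c i \<oplus>\<^bsub>K\<^esub> d i = r" and r: "r \<in> carrier K"
  shows "(\<Oplus>i\<in>{..s::nat}. c i \<odot> t i) \<oplus> (\<Oplus>i\<in>{..s}. d i \<odot> t i) = r \<odot> (\<Oplus>i\<in>{..s}. t i)"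
proof -
  have "(\<Oplus>i\<in>{..s}. c i \<odot> t i) \<oplus> (\<Oplus>i\<in>{..s}. d i \<odot> t i) =
      (\<Oplus>i\<in>{..s}. c i \<odot> t i \<oplus> d i \<odot> t i)"
    using assms by (intro M.finsum_addf[symmetric]) auto
  also have "\<dots> = (\<Oplus>i\<in>{..s}. r \<odot> t i)"
    using assms by (intro M.finsum_cong') (auto simp: smult_l_distr[symmetric])
  also have "\<dots> = r \<odot> (\<Oplus>i\<in>{..s}. t i)"
    using assms by (intro finsum_smult_ldistr[symmetric]) auto
  finally show ?thesis .
qed

text \<open>The quantum binomial theorem in the form of a recursion. Its weights add up to \<open>(s + 1)\<^sub>\<omega>\<close> by
\<open>(i + j)\<^sub>\<omega> = (j)\<^sub>\<omega> + \<omega>\<^sup>j (i)\<^sub>\<omega>\<close>. It holds for every \<open>s\<close>, also across the places where \<open>(s + 1)\<^sub>\<omega>\<close>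
vanishes; this determines the coefficients below degree \<open>n\<close> and relates those above degree \<open>n\<close> to
the one in degree \<open>n\<close>, about which it says nothing.\<close>

lemma T_step:
  assumes pair: "pair A B"
  shows T_step_right: "T A B s \<otimes> (A \<oplus> B) = qi (Suc s) \<odot> T A B (Suc s)"
    and T_step_left: "(A \<oplus> B) \<otimes> T A B s = qi (Suc s) \<odot> T A B (Suc s)"
proof -
  note AB = pairD[OF pair]
  let ?t = "\<lambda>i. dp B i \<otimes> dp A (Suc s - i)"
  have t: "?t i \<in> carrier E" for i using AB by simp
  \<comment> \<open>The weight of the added term is \<open>(0)\<^sub>\<omega> = 0\<close>, at the top here and at the bottom below.\<close>
  have top: "(\<Oplus>i\<in>{..s}. f i \<otimes>\<^bsub>K\<^esub> qi (Suc s - i) \<odot> ?t i) =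
      (\<Oplus>i\<in>{..Suc s}. f i \<otimes>\<^bsub>K\<^esub> qi (Suc s - i) \<odot> ?t i)"
    if "\<And>i. f i \<in> carrier K" for f
    using that t AB by (subst M.finsum_Suc) auto
  have bottom: "(\<Oplus>i\<in>{..s}. f (Suc i) \<otimes>\<^bsub>K\<^esub> qi (Suc i) \<odot> ?t (Suc i)) =
      (\<Oplus>i\<in>{..Suc s}. f i \<otimes>\<^bsub>K\<^esub> qi i \<odot> ?t i)"
    if "\<And>i. f i \<in> carrier K" for f
    using that t AB by (subst M.finsum_Suc2) auto
  have "T A B s \<otimes> A = (\<Oplus>i\<in>{..s}. dp B i \<otimes> dp A (s - i) \<otimes> A)"
    unfolding exp_coeff_def using AB by (intro A.finsum_ldistr) auto
  also have "\<dots> = (\<Oplus>i\<in>{..s}. \<one>\<^bsub>K\<^esub> \<otimes>\<^bsub>K\<^esub> qi (Suc s - i) \<odot> ?t i)"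
    using AB by (intro M.finsum_cong') (auto simp: A.m_assoc dp_mult smult_mult_right Suc_diff_le)
  finally have RA: "T A B s \<otimes> A = (\<Oplus>i\<in>{..Suc s}. \<one>\<^bsub>K\<^esub> \<otimes>\<^bsub>K\<^esub> qi (Suc s - i) \<odot> ?t i)"
    using top[of "\<lambda>_. \<one>\<^bsub>K\<^esub>"] by simp
  have "dp B i \<otimes> dp A (s - i) \<otimes> B = \<omega> [^]\<^bsub>K\<^esub> (s - i) \<otimes>\<^bsub>K\<^esub> qi (Suc i) \<odot> ?t (Suc i)" for i
  proof -
    have "dp B i \<otimes> dp A (s - i) \<otimes> B = \<omega> [^]\<^bsub>K\<^esub> (s - i) \<odot> ((dp B i \<otimes> B) \<otimes> dp A (s - i))"
      using AB by (simp add: A.m_assoc dp_commute_scaled(2)[OF AB(2,1) _ AB(3)] smult_mult_right)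
    then show ?thesis
      using AB by (simp add: dp_mult smult_mult_left smult_assoc1)
  qed
  note 1 = this
  have "T A B s \<otimes> B = (\<Oplus>i\<in>{..s}. dp B i \<otimes> dp A (s - i) \<otimes> B)"
    unfolding exp_coeff_def using AB by (intro A.finsum_ldistr) auto
  also have "\<dots> = (\<Oplus>i\<in>{..s}. \<omega> [^]\<^bsub>K\<^esub> (Suc s - Suc i) \<otimes>\<^bsub>K\<^esub> qi (Suc i) \<odot> ?t (Suc i))"
    using AB t by (intro M.finsum_cong') (auto simp: 1)
  finally have RB: "T A B s \<otimes> B = (\<Oplus>i\<in>{..Suc s}. \<omega> [^]\<^bsub>K\<^esub> (Suc s - i) \<otimes>\<^bsub>K\<^esub> qi i \<odot> ?t i)"
    using bottom[of "\<lambda>i. \<omega> [^]\<^bsub>K\<^esub> (Suc s - i)"] by simp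
  have "T A B s \<otimes> (A \<oplus> B) = T A B s \<otimes> A \<oplus> T A B s \<otimes> B"
    using AB by (simp add: A.r_distr)
  also have "\<dots> = qi (Suc s) \<odot> T A B (Suc s)"
    unfolding RA RB unfolding exp_coeff_def
  proof (rule sum_weighted)
    fix i assume "i \<le> Suc s"
    then show "\<one>\<^bsub>K\<^esub> \<otimes>\<^bsub>K\<^esub> qi (Suc s - i) \<oplus>\<^bsub>K\<^esub> \<omega> [^]\<^bsub>K\<^esub> (Suc s - i) \<otimes>\<^bsub>K\<^esub> qi i = qi (Suc s)"
      using qi_add[of i "Suc s - i"] by simp
  qed (use t in auto)
  finally show "T A B s \<otimes> (A \<oplus> B) = qi (Suc s) \<odot> T A B (Suc s)" .
  have "B \<otimes> T A B s = (\<Oplus>i\<in>{..s}. B \<otimes> (dp B i \<otimes> dp A (s - i)))"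
    unfolding exp_coeff_def using AB by (intro A.finsum_rdistr) auto
  also have "\<dots> = (\<Oplus>i\<in>{..s}. \<one>\<^bsub>K\<^esub> \<otimes>\<^bsub>K\<^esub> qi (Suc i) \<odot> ?t (Suc i))"
    using AB by (intro M.finsum_cong') (auto simp: A.m_assoc[symmetric] dp_mult smult_mult_left)
  finally have LB: "B \<otimes> T A B s = (\<Oplus>i\<in>{..Suc s}. \<one>\<^bsub>K\<^esub> \<otimes>\<^bsub>K\<^esub> qi i \<odot> ?t i)"
    using bottom[of "\<lambda>_. \<one>\<^bsub>K\<^esub>"] by simp
  have "A \<otimes> (dp B i \<otimes> dp A (s - i)) = \<omega> [^]\<^bsub>K\<^esub> i \<otimes>\<^bsub>K\<^esub> qi (Suc s - i) \<odot> ?t i" if "i \<le> s" for i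
  proof -
    have "A \<otimes> (dp B i \<otimes> dp A (s - i)) = \<omega> [^]\<^bsub>K\<^esub> i \<odot> (dp B i \<otimes> (A \<otimes> dp A (s - i)))"
      using AB by (simp add: A.m_assoc[symmetric] dp_commute_scaled(1)[OF AB(1,2) _ AB(3)] smult_mult_left)
    then show ?thesis
      using AB that by (simp add: dp_mult smult_mult_right smult_assoc1 Suc_diff_le)
  qed
  note 2 = this
  have "A \<otimes> T A B s = (\<Oplus>i\<in>{..s}. A \<otimes> (dp B i \<otimes> dp A (s - i)))"
    unfolding exp_coeff_def using AB by (intro A.finsum_rdistr) auto
  also have "\<dots> = (\<Oplus>i\<in>{..s}. \<omega> [^]\<^bsub>K\<^esub> i \<otimes>\<^bsub>K\<^esub> qi (Suc s - i) \<odot> ?t i)"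
    using AB t by (intro M.finsum_cong') (auto simp: 2)
  finally have LA: "A \<otimes> T A B s = (\<Oplus>i\<in>{..Suc s}. \<omega> [^]\<^bsub>K\<^esub> i \<otimes>\<^bsub>K\<^esub> qi (Suc s - i) \<odot> ?t i)"
    using top[of "\<lambda>i. \<omega> [^]\<^bsub>K\<^esub> i"] by simp
  have "(A \<oplus> B) \<otimes> T A B s = B \<otimes> T A B s \<oplus> A \<otimes> T A B s"
    using AB by (simp add: A.l_distr M.a_comm)
  also have "\<dots> = qi (Suc s) \<odot> T A B (Suc s)"
    unfolding LA LB unfolding exp_coeff_def
  proof (rule sum_weighted)
    fix i assume "i \<le> Suc s"
    then show "\<one>\<^bsub>K\<^esub> \<otimes>\<^bsub>K\<^esub> qi i \<oplus>\<^bsub>K\<^esub> \<omega> [^]\<^bsub>K\<^esub> i \<otimes>\<^bsub>K\<^esub> qi (Suc s - i) = qi (Suc s)"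
      using qi_add[of "Suc s - i" i] by simp
  qed (use t in auto)
  finally show "(A \<oplus> B) \<otimes> T A B s = qi (Suc s) \<odot> T A B (Suc s)" .
qed

lemma T_eq_dp:
  assumes "pair A B" "s < n"
  shows "T A B s = dp (A \<oplus> B) s"
  using assms(2)
proof (induction s)
  case 0
  then show ?case using pairD[OF assms(1)] by (simp add: T_0)
next
  case (Suc s)
  note AB = pairD[OF assms(1)]
  have "qi (Suc s) \<odot> T A B (Suc s) = inv\<^bsub>K\<^esub> (qf s) \<odot> (A \<oplus> B) [^] Suc s"
    using Suc AB by (simp add: T_step_right[OF assms(1), symmetric] divided_power_def smult_mult_left)
  also have "\<dots> = qi (Suc s) \<odot> dp (A \<oplus> B) (Suc s)"
    using Suc.prems AB by (simp add: divided_power_def smult_assoc1[symmetric] inv_qf_Suc del: A.nat_pow_Suc)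
  finally show ?case
    using AB Suc.prems qi_nonzero by (auto intro: smult_cancel[of "qi (Suc s)"])
qed

text \<open>In degree \<open>n\<close> the recursion reads \<open>T\<^sub>n\<^sub>-\<^sub>1 (A + B) = (n)\<^sub>\<omega> T\<^sub>n = 0\<close>.\<close>

lemma sum_pow_n:
  assumes "pair A B"
  shows "(A \<oplus> B) [^] n = \<zero>"
proof -
  note AB = pairD[OF assms]
  obtain k where n: "n = Suc k" using n_gt_1 by (cases n) auto
  then have k: "k < n" by simp
  have pow: "(A \<oplus> B) [^] n = (A \<oplus> B) [^] k \<otimes> (A \<oplus> B)"
    unfolding n by simp
  have "T A B k \<otimes> (A \<oplus> B) = \<zero>"
    using AB by (simp add: T_step_right[OF assms] n[symmetric])
  then have "inv\<^bsub>K\<^esub> (qf k) \<odot> (A \<oplus> B) [^] n = \<zero>"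
    using AB k by (simp add: T_eq_dp[OF assms k] divided_power_def smult_mult_left n[symmetric] pow)
  moreover have "inv\<^bsub>K\<^esub> (qf k) \<noteq> \<zero>\<^bsub>K\<^esub>"
    using qf_Unit[of k] n K.Units_inv_Units K.field_Units by auto
  ultimately show ?thesis
    using AB n smult_cancel[of "inv\<^bsub>K\<^esub> (qf k)" "(A \<oplus> B) [^] n" "\<zero>"] by simp
qed

lemma sum_commutes_T:
  assumes "pair A B"
  shows "(A \<oplus> B) \<otimes> T A B s = T A B s \<otimes> (A \<oplus> B)"
  by (simp add: T_step[OF assms])

text \<open>Since \<open>(n + r)\<^sub>\<omega> = (r)\<^sub>\<omega>\<close>, the recursion from degree \<open>n\<close> to degree \<open>n + r\<close> has the same weights as
the one from degree \<open>0\<close> to degree \<open>r\<close>.\<close>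

lemma dp_sum_T:
  assumes "pair A B" "r \<le> n"
  shows "dp (A \<oplus> B) r \<otimes> T A B n = T A B (n + r)"
proof (cases "r = n")
  case True
  then show ?thesis using pairD[OF assms(1)] by (simp add: T_large)
next
  case False
  note AB = pairD[OF assms(1)]
  let ?X = "A \<oplus> B"
  have X: "?X \<in> carrier E" using AB by simp
  from False assms(2) have "r < n" by simp
  then show ?thesis
  proof (induction r)
    case (Suc r)
    have "qi (Suc r) \<odot> (dp ?X (Suc r) \<otimes> T A B n) = dp ?X r \<otimes> (?X \<otimes> T A B n)"
      using AB X by (simp add: smult_mult_left[symmetric] dp_mult(1)[OF X sum_pow_n[OF assms(1)], symmetric]
          A.m_assoc)
    also have "\<dots> = T A B (n + r) \<otimes> ?X"
      using AB X Suc by (simp add: sum_commutes_T[OF assms(1)] A.m_assoc[symmetric])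
    also have "\<dots> = qi (Suc r) \<odot> T A B (n + Suc r)"
      using qi_n_add[of "Suc r"] by (simp add: T_step_right[OF assms(1)])
    finally show ?case
      using AB X Suc.prems qi_nonzero by (auto intro: smult_cancel[of "qi (Suc r)"])
  qed (use AB X in simp)
qed

text \<open>Each product of two terms is a multiple of \<open>B\<^sup>i\<^sup>+\<^sup>j A\<^sup>2\<^sup>n\<^sup>-\<^sup>i\<^sup>-\<^sup>j\<close>, and one of the two exponents is at
least \<open>n\<close>.\<close>

lemma T_n_square:
  assumes "pair A B"
  shows "T A B n \<otimes> T A B n = \<zero>"
proof -
  note AB = pairD[OF assms]
  have 1: "dp B i \<otimes> dp A (n - i) \<otimes> (dp B j \<otimes> dp A (n - j)) = \<zero>" if "i \<le> n" "j \<le> n" for i j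
  proof -
    have "A \<otimes> dp B j = \<omega> [^]\<^bsub>K\<^esub> j \<odot> (dp B j \<otimes> A)"
      by (rule dp_commute_scaled(1)) (use AB in auto)
    then have "dp A (n - i) \<otimes> dp B j = (\<omega> [^]\<^bsub>K\<^esub> j) [^]\<^bsub>K\<^esub> (n - i) \<odot> (dp B j \<otimes> dp A (n - i))"
      by (intro dp_commute_scaled(2)) (use AB in auto)
    then have "dp B i \<otimes> (dp A (n - i) \<otimes> dp B j) \<otimes> dp A (n - j) =
        (\<omega> [^]\<^bsub>K\<^esub> j) [^]\<^bsub>K\<^esub> (n - i) \<odot> ((dp B i \<otimes> dp B j) \<otimes> (dp A (n - i) \<otimes> dp A (n - j)))"
      using AB by (simp add: smult_mult_left smult_mult_right A.m_assoc)
    also have "\<dots> = \<zero>"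
    proof (cases "n \<le> i + j")
      case True
      then show ?thesis using AB by (simp add: dp_mult_zero[of B])
    next
      case False
      then have "n \<le> (n - i) + (n - j)" by simp
      then show ?thesis using AB by (simp add: dp_mult_zero[of A])
    qed
    finally show ?thesis using AB by (simp add: A.m_assoc)
  qed
  have "T A B n \<otimes> T A B n = (\<Oplus>i\<in>{..n}. dp B i \<otimes> dp A (n - i) \<otimes> T A B n)"
    unfolding exp_coeff_def using AB by (intro A.finsum_ldistr) (auto intro!: M.finsum_closed)
  also have "\<dots> = \<zero>"
  proof (rule M.add.finprod_one_eqI)
    fix i assume i: "i \<in> {..n}"
    have "dp B i \<otimes> dp A (n - i) \<otimes> T A B n =
        (\<Oplus>j\<in>{..n}. dp B i \<otimes> dp A (n - i) \<otimes> (dp B j \<otimes> dp A (n - j)))"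
      unfolding exp_coeff_def using AB by (intro A.finsum_rdistr) auto
    also have "\<dots> = \<zero>"
      using i by (intro M.add.finprod_one_eqI) (auto simp: 1)
    finally show "dp B i \<otimes> dp A (n - i) \<otimes> T A B n = \<zero>" .
  qed
  finally show ?thesis .
qed

text \<open>This compares the coefficients of \<open>t\<^sup>s\<close> in \<open>(e\<^sub>C e\<^sub>B) e\<^sub>A = e\<^sub>C (e\<^sub>B e\<^sub>A)\<close>, where the exponentials are
polynomials in \<open>t\<close> over \<open>E\<close>. The two bracketings are the source of the cocycle identity.\<close>

lemma T_assoc:
  assumes "A \<in> carrier E" "B \<in> carrier E" "C \<in> carrier E"
  shows "(\<Oplus>i\<in>{..s}. T B C i \<otimes> dp A (s - i)) = (\<Oplus>i\<in>{..s}. dp C i \<otimes> T A B (s - i))"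
proof -
  interpret P: UP_ring E "UP E" by (unfold UP_ring_def, rule A.ring_axioms)
  have up: "dp X \<in> carrier (UP E)" if "X \<in> carrier E" for X
    using that by (auto simp: UP_def intro!: exI[of _ n])
  have coeff: "coeff (UP E) p i = p i" if "p \<in> carrier (UP E)" for p i
    using that by (simp add: UP_def)
  have T: "coeff (UP E) (dp Y \<otimes>\<^bsub>UP E\<^esub> dp X) i = T X Y i" if "X \<in> carrier E" "Y \<in> carrier E" for X Y i
    unfolding exp_coeff_def using that by (simp add: up) (simp add: coeff up)
  have "coeff (UP E) ((dp C \<otimes>\<^bsub>UP E\<^esub> dp B) \<otimes>\<^bsub>UP E\<^esub> dp A) s = coeff (UP E) (dp C \<otimes>\<^bsub>UP E\<^esub> (dp B \<otimes>\<^bsub>UP E\<^esub> dp A)) s"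
    using assms by (simp only: P.UP_m_assoc up)
  then show ?thesis
    using assms by (simp add: up P.UP_mult_closed T del: P.coeff_mult add: P.coeff_mult[of "_ \<otimes>\<^bsub>UP E\<^esub> _"]
        P.coeff_mult[of _ "_ \<otimes>\<^bsub>UP E\<^esub> _"] coeff[OF up])
qed

lemma T_pair_closed [simp]: "pair A B \<Longrightarrow> T A B s \<in> carrier E"
  using pairD[of A B] by simp

text \<open>Both sides are the coefficient of \<open>t\<^sup>n\<close> in \<open>e\<^sub>C e\<^sub>B e\<^sub>A\<close>: on the left the factors \<open>e\<^sub>C e\<^sub>B\<close>
  are collected, and their coefficients below degree \<open>n\<close> are those of \<open>e\<^sub>B\<^sub>+\<^sub>C\<close>, so that only the
  coefficient in degree \<open>n\<close> itself is missing from the first summand.\<close>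

lemma triple_linear:
  assumes AB: "pair A B" and BC: "pair B C"
  shows "T A (B \<oplus> C) n \<oplus> T B C n = T (A \<oplus> B) C n \<oplus> T A B n"
proof -
  note [simp] = pairD(1,2)[OF AB] pairD(1,2)[OF BC]
  let ?X = "B \<oplus> C" and ?Y = "A \<oplus> B"
  obtain k where n: "n = Suc k" using n_gt_1 by (cases n) auto
  have kn: "i < n" "n - Suc i < n" if "i \<le> k" for i using that n by auto
  have "T A ?X n = dp ?X n \<otimes> dp A 0 \<oplus> (\<Oplus>i\<in>{..k}. dp ?X i \<otimes> dp A (n - i))"
    unfolding exp_coeff_def by (subst (2) n, subst M.finsum_Suc) (auto simp: n[symmetric])
  also have "\<dots> = (\<Oplus>i\<in>{..k}. dp ?X i \<otimes> dp A (n - i))"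
    by simp
  also have "\<dots> = (\<Oplus>i\<in>{..k}. T B C i \<otimes> dp A (n - i))"
    by (rule M.finsum_cong') (auto simp: T_eq_dp[OF BC] kn)
  finally have 1: "T A ?X n \<oplus> T B C n = (\<Oplus>i\<in>{..n}. T B C i \<otimes> dp A (n - i))"
    by (subst (8) n, subst M.finsum_Suc) (auto simp: n[symmetric] M.a_comm)
  have "T ?Y C n = (\<Oplus>i\<in>{..k}. dp C (Suc i) \<otimes> dp ?Y (n - Suc i)) \<oplus> dp C 0 \<otimes> dp ?Y n"
    unfolding exp_coeff_def by (subst (2) n, subst M.finsum_Suc2) auto
  also have "\<dots> = (\<Oplus>i\<in>{..k}. dp C (Suc i) \<otimes> dp ?Y (n - Suc i))"
    by simp
  also have "\<dots> = (\<Oplus>i\<in>{..k}. dp C (Suc i) \<otimes> T A B (n - Suc i))"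
    by (rule M.finsum_cong') (auto simp: T_eq_dp[OF AB] kn)
  finally have 2: "T ?Y C n \<oplus> T A B n = (\<Oplus>i\<in>{..n}. dp C i \<otimes> T A B (n - i))"
    by (subst (8) n, subst M.finsum_Suc2) auto
  show ?thesis unfolding 1 2 by (rule T_assoc) simp_all
qed

text \<open>Both sides are the coefficient of \<open>t\<^sup>2\<^sup>n\<close> in \<open>e\<^sub>C e\<^sub>B e\<^sub>A\<close>. On the left, \<open>A\<close> commutes with
  \<open>T B C n\<close>, which can therefore be moved next to the divided powers of \<open>B + C\<close> and raises them by
  \<open>n\<close> degrees.\<close>

lemma triple_quadratic:
  assumes AB: "pair A B" and BC: "pair B C" and AC: "pair A C"
  shows "T A (B \<oplus> C) n \<otimes> T B C n = T (A \<oplus> B) C n \<otimes> T A B n"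
proof -
  note [simp] = pairD(1,2)[OF AB] pairD(1,2)[OF BC]
  let ?X = "B \<oplus> C" and ?Y = "A \<oplus> B"
  have comm: "dp A i \<otimes> T B C n = T B C n \<otimes> dp A i" for i
  proof -
    have "A \<otimes> T B C n = \<one>\<^bsub>K\<^esub> \<odot> (T B C n \<otimes> A)"
      using T_commute_scaled[of A B C \<omega> n] pairD(3)[OF AB] pairD(3)[OF AC] by simp
    from dp_commute_scaled(2)[OF _ _ _ this, of i] show ?thesis by simp
  qed
  have "T A ?X n \<otimes> T B C n = (\<Oplus>i\<in>{..n}. dp ?X i \<otimes> dp A (n - i) \<otimes> T B C n)"
    by (subst exp_coeff_def) (rule A.finsum_ldistr; simp)
  also have "\<dots> = (\<Oplus>i\<in>{..n}. T B C (i + n) \<otimes> dp A (2 * n - (i + n)))"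
  proof (rule M.finsum_cong')
    fix i assume "i \<in> {..n}"
    then have "dp ?X i \<otimes> dp A (n - i) \<otimes> T B C n = (dp ?X i \<otimes> T B C n) \<otimes> dp A (n - i)"
      by (simp add: A.m_assoc comm)
    also have "\<dots> = T B C (i + n) \<otimes> dp A (2 * n - (i + n))"
      using \<open>i \<in> {..n}\<close> by (simp add: dp_sum_T[OF BC] add.commute)
    finally show "dp ?X i \<otimes> dp A (n - i) \<otimes> T B C n = \<dots>" .
  qed auto
  also have "\<dots> = (\<Oplus>i\<in>(\<lambda>i. i + n) ` {..n}. T B C i \<otimes> dp A (2 * n - i))"
    by (rule M.finsum_reindex[symmetric]) auto
  also have "\<dots> = (\<Oplus>i\<in>{..2 * n}. T B C i \<otimes> dp A (2 * n - i))"
  \<comment> \<open>Below degree \<open>n\<close> the factor \<open>dp A (2 n - i)\<close> vanishes.\<close>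
  proof (rule M.add.finprod_mono_neutral_cong_left)
    fix i assume "i \<in> {..2 * n} - (\<lambda>i. i + n) ` {..n}"
    then have "i < n"
      by (auto simp: image_iff) (metis add.commute atMost_iff le_add_diff_inverse2 leI mult_2 nat_add_left_cancel_le)
    then show "T B C i \<otimes> dp A (2 * n - i) = \<zero>" by simp
  qed auto
  finally have 1: "T A ?X n \<otimes> T B C n = (\<Oplus>i\<in>{..2 * n}. T B C i \<otimes> dp A (2 * n - i))" .
  have "T ?Y C n \<otimes> T A B n = (\<Oplus>i\<in>{..n}. dp C i \<otimes> dp ?Y (n - i) \<otimes> T A B n)"
    by (subst exp_coeff_def) (rule A.finsum_ldistr; simp)
  also have "\<dots> = (\<Oplus>i\<in>{..n}. dp C i \<otimes> T A B (2 * n - i))"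
    by (rule M.finsum_cong') (auto simp: A.m_assoc dp_sum_T[OF AB] mult_2)
  also have "\<dots> = (\<Oplus>i\<in>{..2 * n}. dp C i \<otimes> T A B (2 * n - i))"
    by (rule M.add.finprod_mono_neutral_cong_left) auto
  finally have 2: "T ?Y C n \<otimes> T A B n = (\<Oplus>i\<in>{..2 * n}. dp C i \<otimes> T A B (2 * n - i))" .
  show ?thesis unfolding 1 2 by (rule T_assoc) simp_all
qed

subsection \<open>The twist\<close>

lemma tw_closed [simp, intro]: "\<lbrakk>c \<in> carrier K; A \<in> carrier E; B \<in> carrier E\<rbrakk> \<Longrightarrow> tw c A B \<in> carrier E"
  by (simp add: twist_def)

lemma one_plus_mult:
  assumes "c \<in> carrier K" "d \<in> carrier K" "x \<in> carrier E" "y \<in> carrier E"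
  shows "(\<one> \<oplus> c \<odot> x) \<otimes> (\<one> \<oplus> d \<odot> y) =
    \<one> \<oplus> (c \<odot> x \<oplus> d \<odot> y) \<oplus> (c \<otimes>\<^bsub>K\<^esub> d) \<odot> (x \<otimes> y)"
proof -
  have "c \<odot> (d \<odot> (x \<otimes> y)) = d \<odot> (c \<odot> (x \<otimes> y))"
    using assms by (simp add: smult_assoc1[symmetric] K.m_comm)
  then show ?thesis
    using assms by (simp add: A.l_distr A.r_distr smult_r_distr smult_mult_left smult_mult_right
        smult_assoc1 M.a_ac)
qed

lemma tw_add:
  assumes "pair A B" "c \<in> carrier K" "d \<in> carrier K"
  shows "tw c A B \<otimes> tw d A B = tw (c \<oplus>\<^bsub>K\<^esub> d) A B"
  unfolding twist_def using assms
  by (subst one_plus_mult) (simp_all add: T_n_square smult_l_distr)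

lemma tw_0: "\<lbrakk>A \<in> carrier E; B \<in> carrier E\<rbrakk> \<Longrightarrow> tw \<zero>\<^bsub>K\<^esub> A B = \<one>"
  by (simp add: twist_def)

lemma tw_inverse:
  assumes "pair A B" "c \<in> carrier K"
  shows "tw c A B \<otimes> tw (\<ominus>\<^bsub>K\<^esub> c) A B = \<one>" "tw (\<ominus>\<^bsub>K\<^esub> c) A B \<otimes> tw c A B = \<one>"
  using assms pairD(1,2)[OF assms(1)] by (simp_all add: tw_add tw_0 K.r_neg K.l_neg)

text \<open>Conjugation by an element that scales both \<open>A\<close> and \<open>B\<close> by \<open>\<rho>\<close> scales the coefficient of degree
\<open>n\<close> by \<open>\<rho>\<^sup>n\<close>. For \<open>\<rho> = \<omega>\<close> the twist is unchanged; for a tensor square of \<open>a\<^sub>i\<close> this produces the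
factor \<open>q\<^sub>i\<^sup>n\<close> in the coproduct.\<close>

lemma tw_commute_scaled:
  assumes "g \<in> carrier E" "A \<in> carrier E" "B \<in> carrier E" "\<rho> \<in> carrier K" "c \<in> carrier K"
    and "g \<otimes> A = \<rho> \<odot> (A \<otimes> g)" "g \<otimes> B = \<rho> \<odot> (B \<otimes> g)"
  shows "g \<otimes> tw c A B = tw (c \<otimes>\<^bsub>K\<^esub> \<rho> [^]\<^bsub>K\<^esub> n) A B \<otimes> g"
  unfolding twist_def using assms(1-5) T_commute_scaled[OF assms(1-4,6,7), of n]
  by (simp add: A.l_distr A.r_distr smult_mult_left smult_mult_right smult_assoc1)

lemma tw_commutes_sum:
  assumes "pair A B" "c \<in> carrier K"
  shows "(A \<oplus> B) \<otimes> tw c A B = tw c A B \<otimes> (A \<oplus> B)"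
proof -
  have "X \<otimes> tw c A B = tw c A B \<otimes> X"
    if "X \<in> carrier E" "X \<otimes> T A B n = T A B n \<otimes> X" for X
    unfolding twist_def using that assms(2) pairD(1,2)[OF assms(1)]
    by (simp add: A.l_distr A.r_distr smult_mult_left smult_mult_right)
  then show ?thesis using pairD(1,2)[OF assms(1)] sum_commutes_T[OF assms(1)] by simp
qed

text \<open>The 2-cocycle condition. The coefficients of \<open>c\<close> and of \<open>c\<^sup>2\<close> are the two preceding identities.\<close>

lemma twist_cocycle:
  assumes "pair A B" "pair B C" "pair A C" "c \<in> carrier K"
  shows "tw c A (B \<oplus> C) \<otimes> tw c B C = tw c (A \<oplus> B) C \<otimes> tw c A B"
proof -
  note [simp] = pairD(1,2)[OF assms(1)] pairD(1,2)[OF assms(2)] assms(4)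
  show ?thesis
    unfolding twist_def
    by (simp add: one_plus_mult smult_r_distr[symmetric] triple_linear[OF assms(1,2)]
        triple_quadratic[OF assms(1-3)])
qed

text \<open>Each term of degree \<open>s\<close> contains \<open>s\<close> factors \<open>U\<close>. It will be used with \<open>U = u \<otimes> 1\<close> in degree
\<open>n\<close>, where \<open>U\<^sup>n = 1\<close>.\<close>

lemma T_rescale:
  assumes "U \<in> carrier E" "A \<in> carrier E" "B \<in> carrier E"
    and UA: "U \<otimes> A = A \<otimes> U" and UB: "U \<otimes> B = B \<otimes> U"
  shows "T (U \<otimes> A) (U \<otimes> B) s = U [^] s \<otimes> T A B s"
proof -
  have dp: "dp (U \<otimes> X) i = U [^] i \<otimes> dp X i"
    if "X \<in> carrier E" "U \<otimes> X = X \<otimes> U" for X i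
    using that(1) assms(1)
    by (simp add: divided_power_def A.pow_mult_distrib[OF that(2) assms(1) that(1)] smult_mult_right)
  have cm: "dp B i \<otimes> U [^] j = U [^] j \<otimes> dp B i" for i and j :: nat
    using pow_commute_scaled'[of "dp B i" U "\<one>\<^bsub>K\<^esub>" j] dp_commute_scaled(1)[of U B "\<one>\<^bsub>K\<^esub>" i] assms by simp
  have "dp (U \<otimes> B) i \<otimes> dp (U \<otimes> A) (s - i) = U [^] s \<otimes> (dp B i \<otimes> dp A (s - i))"
    if "i \<le> s" for i
  proof -
    have "dp (U \<otimes> B) i \<otimes> dp (U \<otimes> A) (s - i) =
        U [^] i \<otimes> (dp B i \<otimes> U [^] (s - i)) \<otimes> dp A (s - i)"
      using assms(1-3) by (simp add: dp[OF assms(2) UA] dp[OF assms(3) UB] A.m_assoc)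
    also have "\<dots> = (U [^] i \<otimes> U [^] (s - i)) \<otimes> (dp B i \<otimes> dp A (s - i))"
      using assms(1-3) by (simp add: cm A.m_assoc)
    finally show ?thesis using assms that by (simp add: A.nat_pow_mult)
  qed
  then have "T (U \<otimes> A) (U \<otimes> B) s = (\<Oplus>i\<in>{..s}. U [^] s \<otimes> (dp B i \<otimes> dp A (s - i)))"
    unfolding exp_coeff_def using assms by (intro M.finsum_cong') auto
  also have "\<dots> = U [^] s \<otimes> T A B s"
    unfolding exp_coeff_def using assms by (intro A.finsum_rdistr[symmetric]) auto
  finally show ?thesis .
qed

text \<open>With one argument \<open>0\<close> only the \<open>n\<close>-th divided power of the other one could contribute. This gives
the counit axioms for the twist.\<close>

lemma T_n_zero_left: "B \<in> carrier E \<Longrightarrow> T \<zero> B n = \<zero>"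
  and T_n_zero_right: "B \<in> carrier E \<Longrightarrow> T B \<zero> n = \<zero>"
proof -
  have z: "dp \<zero> i = \<zero>" if "i > 0" for i
    using that by (cases i) (auto simp: divided_power_def)
  assume B: "B \<in> carrier E"
  show "T \<zero> B n = \<zero>"
    unfolding exp_coeff_def
  proof (rule M.add.finprod_one_eqI)
    fix i assume "i \<in> {..n}"
    then show "dp B i \<otimes> dp \<zero> (n - i) = \<zero>"
      using B z by (cases "i = n") auto
  qed
  show "T B \<zero> n = \<zero>"
    unfolding exp_coeff_def
  proof (rule M.add.finprod_one_eqI)
    fix i
    show "dp \<zero> i \<otimes> dp B (n - i) = \<zero>"
      using B z by (cases "i = 0") auto
  qed
qed

end

lemma hom_twist:
  assumes "assoc_algebra K E" "assoc_algebra K E'" "root_of_unity K n \<omega>" "f \<in> algebra_homs K E E'"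
    and "A \<in> carrier E" "B \<in> carrier E"
  shows "f (exp_coeff K E n \<omega> A B s) = exp_coeff K E' n \<omega> (f A) (f B) s"
    and "c \<in> carrier K \<Longrightarrow> f (twist K E n \<omega> c A B) = twist K E' n \<omega> c (f A) (f B)"
proof -
  interpret E: q_exponential E K n \<omega> by (intro q_exponential.intro assms)
  interpret E': q_exponential E' K n \<omega> by (intro q_exponential.intro assms)
  note f = algebra_homsD[OF assms(4)]
  have dp: "f (E.dp X i) = E'.dp (f X) i" if "X \<in> carrier E" for X i
    using that by (simp add: divided_power_def f algebra_homs_zero[OF assms(1,2,4)]
        algebra_homs_pow[OF E.A.monoid_axioms E'.A.monoid_axioms assms(4)])
  have T: "f (E.T A B s) = E'.T (f A) (f B) s" for s
  proof -
    have "f (E.T A B s) = (\<Oplus>\<^bsub>E'\<^esub>i\<in>{..s}. f (E.dp B i \<otimes>\<^bsub>E\<^esub> E.dp A (s - i)))"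
      unfolding exp_coeff_def
      by (rule linear_maps_finsum[OF E.module_axioms E'.module_axioms f(1)]) (use assms in auto)
    also have "\<dots> = E'.T (f A) (f B) s"
      unfolding exp_coeff_def by (rule E'.M.finsum_cong') (use assms in \<open>auto simp: f dp\<close>)
    finally show ?thesis .
  qed
  show "f (E.T A B s) = E'.T (f A) (f B) s" by (rule T)
  show "f (E.tw c A B) = E'.tw c (f A) (f B)" if "c \<in> carrier K"
    using that assms(5,6) by (simp add: twist_def f T)
qed

section \<open>Opposite algebras, conjugation and convolution\<close>

lemma ground_algebra_simps [simp]:
  "carrier (ground_algebra K) = carrier K" "mult (ground_algebra K) = mult K"
  "\<one>\<^bsub>ground_algebra K\<^esub> = \<one>\<^bsub>K\<^esub>" "\<zero>\<^bsub>ground_algebra K\<^esub> = \<zero>\<^bsub>K\<^esub>"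
  "add (ground_algebra K) = add K" "smult (ground_algebra K) = mult K"
  by (simp_all add: ground_algebra_def)

lemma ground_algebra_algebra:
  assumes "field K"
  shows "assoc_algebra K (ground_algebra K)"
proof -
  interpret K: field K by fact
  have ring: "ring (ground_algebra K)"
    by (rule ring_cong[OF K.ring_axioms]) simp_all
  interpret R: ring "ground_algebra K" by (rule ring)
  show ?thesis
  proof (rule assoc_algebraI[OF assms _ ring])
    show "module K (ground_algebra K)"
      by (rule moduleI[OF K.is_cring R.abelian_group_axioms])
         (simp_all add: K.l_distr K.r_distr K.m_assoc)
  qed (simp_all add: K.m_assoc K.m_lcomm)
qed

text \<open>The antipode is an antihomomorphism; as a homomorphism to the opposite algebra it can be
obtained from the universal property of the presentation.\<close>

definition opposite :: "('k, 'a) module \<Rightarrow> ('k, 'a) module" where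
  "opposite A = A\<lparr>mult := \<lambda>x y. y \<otimes>\<^bsub>A\<^esub> x\<rparr>"

lemma opposite_simps [simp]:
  "carrier (opposite A) = carrier A" "x \<otimes>\<^bsub>opposite A\<^esub> y = y \<otimes>\<^bsub>A\<^esub> x"
  "\<one>\<^bsub>opposite A\<^esub> = \<one>\<^bsub>A\<^esub>" "\<zero>\<^bsub>opposite A\<^esub> = \<zero>\<^bsub>A\<^esub>"
  "add (opposite A) = add A" "smult (opposite A) = smult A"
  by (simp_all add: opposite_def)

lemma opposite_algebra:
  assumes "assoc_algebra K A"
  shows "assoc_algebra K (opposite A)"
proof -
  interpret A: assoc_algebra K A by fact
  have ab: "abelian_group (opposite A)"
    by (rule abelian_groupI) (auto simp: A.M.a_assoc intro: A.M.a_comm A.M.l_neg)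
  show ?thesis
  proof (rule assoc_algebraI[OF A.K.field_axioms])
    show "module K (opposite A)"
      by (rule moduleI[OF A.K.is_cring ab])
         (auto simp: A.smult_l_distr A.smult_r_distr A.smult_assoc1)
    show "ring (opposite A)"
      by (rule ringI[OF ab monoidI]) (auto simp: A.A.m_assoc A.A.l_distr A.A.r_distr)
  qed (auto simp: A.smult_mult_left A.smult_mult_right)
qed

lemma opposite_pow:
  assumes "assoc_algebra K A" "x \<in> carrier A"
  shows "x [^]\<^bsub>opposite A\<^esub> (k::nat) = x [^]\<^bsub>A\<^esub> k"
proof -
  interpret A: assoc_algebra K A by fact
  interpret O: assoc_algebra K "opposite A" by (rule opposite_algebra[OF assms(1)])
  show ?thesis
  proof (induction k)
    case (Suc k)
    then show ?case using A.A.nat_pow_Suc2[OF assms(2), of k] by simp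
  qed simp
qed

lemma linear_maps_opposite [simp]: "linear_maps K A (opposite B) = linear_maps K A B"
  by (simp add: linear_maps_def)

lemma conjugation_hom:
  assumes A: "assoc_algebra K A" and hom: "f \<in> algebra_homs K B A" and g: "g \<in> carrier A" "g' \<in> carrier A"
    and gg: "g \<otimes>\<^bsub>A\<^esub> g' = \<one>\<^bsub>A\<^esub>" "g' \<otimes>\<^bsub>A\<^esub> g = \<one>\<^bsub>A\<^esub>"
  shows "(\<lambda>x. g \<otimes>\<^bsub>A\<^esub> f x \<otimes>\<^bsub>A\<^esub> g') \<in> algebra_homs K B A"
proof -
  interpret A: assoc_algebra K A by (rule A)
  show ?thesis
  proof (intro algebra_homsI linear_mapsI)
    note f = algebra_homsD[OF hom]
    fix x y assume x: "x \<in> carrier B" and y: "y \<in> carrier B"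
    have "g \<otimes>\<^bsub>A\<^esub> f x \<otimes>\<^bsub>A\<^esub> g' \<otimes>\<^bsub>A\<^esub> (g \<otimes>\<^bsub>A\<^esub> f y \<otimes>\<^bsub>A\<^esub> g') = g \<otimes>\<^bsub>A\<^esub> f x \<otimes>\<^bsub>A\<^esub> (g' \<otimes>\<^bsub>A\<^esub> g) \<otimes>\<^bsub>A\<^esub> f y \<otimes>\<^bsub>A\<^esub> g'"
      using g x y by (simp add: f A.A.m_assoc del: gg)
    then show "g \<otimes>\<^bsub>A\<^esub> f (x \<otimes>\<^bsub>B\<^esub> y) \<otimes>\<^bsub>A\<^esub> g' = g \<otimes>\<^bsub>A\<^esub> f x \<otimes>\<^bsub>A\<^esub> g' \<otimes>\<^bsub>A\<^esub> (g \<otimes>\<^bsub>A\<^esub> f y \<otimes>\<^bsub>A\<^esub> g')"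
      using g x y gg by (simp add: f A.A.m_assoc)
  qed (use assms in \<open>simp_all add: algebra_homsD[OF hom] A.A.l_distr A.A.r_distr A.smult_mult_left A.smult_mult_right\<close>)
qed

context assoc_algebra
begin

lemma inverse_commute_scaled:
  assumes "a \<in> carrier A" "a' \<in> carrier A" "x \<in> carrier A" "\<rho> \<in> Units K"
    and aa: "a \<otimes>\<^bsub>A\<^esub> a' = \<one>\<^bsub>A\<^esub>" "a' \<otimes>\<^bsub>A\<^esub> a = \<one>\<^bsub>A\<^esub>" and ax: "a \<otimes>\<^bsub>A\<^esub> x = \<rho> \<odot>\<^bsub>A\<^esub> (x \<otimes>\<^bsub>A\<^esub> a)"
  shows "a' \<otimes>\<^bsub>A\<^esub> x = inv\<^bsub>K\<^esub> \<rho> \<odot>\<^bsub>A\<^esub> (x \<otimes>\<^bsub>A\<^esub> a')" "x \<otimes>\<^bsub>A\<^esub> a' = \<rho> \<odot>\<^bsub>A\<^esub> (a' \<otimes>\<^bsub>A\<^esub> x)"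
proof -
  have \<rho>: "\<rho> \<in> carrier K" "inv\<^bsub>K\<^esub> \<rho> \<in> carrier K" using assms(4) by auto
  have "x \<otimes>\<^bsub>A\<^esub> a' = a' \<otimes>\<^bsub>A\<^esub> (a \<otimes>\<^bsub>A\<^esub> x) \<otimes>\<^bsub>A\<^esub> a'"
    using assms(1-3) aa by (simp add: A.m_assoc[symmetric])
  also have "\<dots> = \<rho> \<odot>\<^bsub>A\<^esub> (a' \<otimes>\<^bsub>A\<^esub> x \<otimes>\<^bsub>A\<^esub> (a \<otimes>\<^bsub>A\<^esub> a'))"
    unfolding ax using assms(1-3) \<rho> by (simp add: smult_mult_left smult_mult_right A.m_assoc)
  finally show 1: "x \<otimes>\<^bsub>A\<^esub> a' = \<rho> \<odot>\<^bsub>A\<^esub> (a' \<otimes>\<^bsub>A\<^esub> x)"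
    using assms(1-3) aa by simp
  then show "a' \<otimes>\<^bsub>A\<^esub> x = inv\<^bsub>K\<^esub> \<rho> \<odot>\<^bsub>A\<^esub> (x \<otimes>\<^bsub>A\<^esub> a')"
    using assms(1-4) \<rho> by (simp add: smult_assoc1[symmetric])
qed

text \<open>Up to a power of \<open>\<rho>\<close>, all factors \<open>w\<close> can be moved to the left, which leaves \<open>x\<^sup>i\<^sup>+\<^sup>j = 0\<close>.\<close>

lemma scaled_product_nilpotent:
  assumes w: "w \<in> carrier A" and x: "x \<in> carrier A" and \<rho>: "\<rho> \<in> carrier K"
    and xw: "x \<otimes>\<^bsub>A\<^esub> w = \<rho> \<odot>\<^bsub>A\<^esub> (w \<otimes>\<^bsub>A\<^esub> x)" and nil: "x [^]\<^bsub>A\<^esub> (n::nat) = \<zero>\<^bsub>A\<^esub>"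
  shows "n \<le> i + j \<Longrightarrow> (w \<otimes>\<^bsub>A\<^esub> x) [^]\<^bsub>A\<^esub> i \<otimes>\<^bsub>A\<^esub> x [^]\<^bsub>A\<^esub> j = \<zero>\<^bsub>A\<^esub>"
    and "n \<le> i + j \<Longrightarrow> x [^]\<^bsub>A\<^esub> j \<otimes>\<^bsub>A\<^esub> (w \<otimes>\<^bsub>A\<^esub> x) [^]\<^bsub>A\<^esub> i = \<zero>\<^bsub>A\<^esub>"
proof -
  let ?y = "w \<otimes>\<^bsub>A\<^esub> x"
  have y: "?y \<in> carrier A" using w x by simp
  have nil': "x [^]\<^bsub>A\<^esub> j = \<zero>\<^bsub>A\<^esub>" if "n \<le> j" for j
  proof -
    have "x [^]\<^bsub>A\<^esub> j = x [^]\<^bsub>A\<^esub> n \<otimes>\<^bsub>A\<^esub> x [^]\<^bsub>A\<^esub> (j - n)"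
      using that x by (simp add: A.nat_pow_mult)
    then show ?thesis using nil x by simp
  qed
  have yw: "?y \<otimes>\<^bsub>A\<^esub> w = \<rho> \<odot>\<^bsub>A\<^esub> (w \<otimes>\<^bsub>A\<^esub> ?y)"
    using w x \<rho> xw by (simp add: A.m_assoc smult_mult_right)
  show "?y [^]\<^bsub>A\<^esub> i \<otimes>\<^bsub>A\<^esub> x [^]\<^bsub>A\<^esub> j = \<zero>\<^bsub>A\<^esub>" if "n \<le> i + j"
    using that
  proof (induction i arbitrary: j)
    case (Suc i)
    have "?y [^]\<^bsub>A\<^esub> Suc i \<otimes>\<^bsub>A\<^esub> x [^]\<^bsub>A\<^esub> j = (?y [^]\<^bsub>A\<^esub> i \<otimes>\<^bsub>A\<^esub> w) \<otimes>\<^bsub>A\<^esub> x [^]\<^bsub>A\<^esub> Suc j"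
      using w x y by (simp add: A.m_assoc A.nat_pow_Suc2[symmetric])
    also have "\<dots> = \<rho> [^]\<^bsub>K\<^esub> i \<odot>\<^bsub>A\<^esub> (w \<otimes>\<^bsub>A\<^esub> (?y [^]\<^bsub>A\<^esub> i \<otimes>\<^bsub>A\<^esub> x [^]\<^bsub>A\<^esub> Suc j))"
      using pow_commute_scaled'[OF w y \<rho> yw, of i] w x y \<rho>
      by (simp add: smult_mult_left A.m_assoc del: A.nat_pow_Suc)
    also have "\<dots> = \<zero>\<^bsub>A\<^esub>"
      using Suc.IH[of "Suc j"] Suc.prems w \<rho> by (simp del: A.nat_pow_Suc)
    finally show ?case .
  qed (use nil' x in simp)
  show "x [^]\<^bsub>A\<^esub> j \<otimes>\<^bsub>A\<^esub> ?y [^]\<^bsub>A\<^esub> i = \<zero>\<^bsub>A\<^esub>" if "n \<le> i + j"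
    using that
  proof (induction i arbitrary: j)
    case (Suc i)
    have "x [^]\<^bsub>A\<^esub> j \<otimes>\<^bsub>A\<^esub> ?y [^]\<^bsub>A\<^esub> Suc i = (x [^]\<^bsub>A\<^esub> j \<otimes>\<^bsub>A\<^esub> w) \<otimes>\<^bsub>A\<^esub> x \<otimes>\<^bsub>A\<^esub> ?y [^]\<^bsub>A\<^esub> i"
      using w x y by (subst A.nat_pow_Suc2) (simp_all add: A.m_assoc)
    also have "\<dots> = \<rho> [^]\<^bsub>K\<^esub> j \<odot>\<^bsub>A\<^esub> (w \<otimes>\<^bsub>A\<^esub> (x [^]\<^bsub>A\<^esub> Suc j \<otimes>\<^bsub>A\<^esub> ?y [^]\<^bsub>A\<^esub> i))"
      using pow_commute_scaled'[OF w x \<rho> xw, of j] w x y \<rho>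
      by (simp add: smult_mult_left A.m_assoc)
    also have "\<dots> = \<zero>\<^bsub>A\<^esub>"
      using Suc.IH[of "Suc j"] Suc.prems w \<rho> by (simp del: A.nat_pow_Suc)
    finally show ?case .
  qed (use nil' x in simp)
qed

end

context tensor
begin

lemma tens_pow:
  "\<lbrakk>a \<in> carrier A; b \<in> carrier B\<rbrakk> \<Longrightarrow> tens a b [^]\<^bsub>T\<^esub> (k::nat) = tens (a [^]\<^bsub>A\<^esub> k) (b [^]\<^bsub>B\<^esub> k)"
  by (induction k) (simp_all add: tens_one tens_mult)

lemma tens_zero: "a \<in> carrier A \<Longrightarrow> tens a \<zero>\<^bsub>B\<^esub> = \<zero>\<^bsub>T\<^esub>" "b \<in> carrier B \<Longrightarrow> tens \<zero>\<^bsub>A\<^esub> b = \<zero>\<^bsub>T\<^esub>"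
  using tens_bilin(4)[of "\<zero>\<^bsub>K\<^esub>" a "\<zero>\<^bsub>B\<^esub>"] tens_bilin(3)[of "\<zero>\<^bsub>K\<^esub>" "\<zero>\<^bsub>A\<^esub>" b] by simp_all

lemma tens_left_hom: "(\<lambda>a. tens a \<one>\<^bsub>B\<^esub>) \<in> algebra_homs K A T"
  by (intro algebra_homsI linear_mapsI) (simp_all add: tens_bilin tens_mult tens_one)

lemma tens_right_hom: "(\<lambda>b. tens \<one>\<^bsub>A\<^esub> b) \<in> algebra_homs K B T"
  by (intro algebra_homsI linear_mapsI) (simp_all add: tens_bilin tens_mult tens_one)

lemma tens_commute_scaled:
  assumes "a \<in> carrier A" "a' \<in> carrier A" "b \<in> carrier B" "b' \<in> carrier B" "\<rho> \<in> carrier K" "\<sigma> \<in> carrier K"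
    and "a \<otimes>\<^bsub>A\<^esub> a' = \<rho> \<odot>\<^bsub>A\<^esub> (a' \<otimes>\<^bsub>A\<^esub> a)" "b \<otimes>\<^bsub>B\<^esub> b' = \<sigma> \<odot>\<^bsub>B\<^esub> (b' \<otimes>\<^bsub>B\<^esub> b)"
  shows "tens a b \<otimes>\<^bsub>T\<^esub> tens a' b' = (\<rho> \<otimes>\<^bsub>K\<^esub> \<sigma>) \<odot>\<^bsub>T\<^esub> (tens a' b' \<otimes>\<^bsub>T\<^esub> tens a b)"
  using assms by (simp add: tens_mult tens_bilin T.smult_assoc1[symmetric] A.K.m_comm)

end

subsection \<open>Uniqueness of the antipode\<close>

text \<open>Both are inverse to the identity under convolution: in Sweedler notation,
\<open>S(h) = S(h\<^sub>1) \<epsilon>(h\<^sub>2) = S(h\<^sub>1) h\<^sub>2 S'(h\<^sub>3) = \<epsilon>(h\<^sub>1) S'(h\<^sub>2) = S'(h)\<close>. The middle term is the value of a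
linear map \<open>\<Phi>\<close> on \<open>H \<otimes> (H \<otimes> H)\<close>, and the two bracketings of the coproduct evaluate it
to the two ends.\<close>

lemma antipode_unique:
  assumes H: "hopf_algebra K H \<Delta> \<epsilon> S" and H': "hopf_algebra K H \<Delta>' \<epsilon>' S'"
    and eq: "\<And>h. h \<in> carrier H \<Longrightarrow> \<Delta>' h = \<Delta> h" "\<And>h. h \<in> carrier H \<Longrightarrow> \<epsilon>' h = \<epsilon> h"
    and h: "h \<in> carrier H"
  shows "S h = S' h"
proof -
  interpret H: hopf_algebra K H \<Delta> \<epsilon> S by fact
  interpret H': hopf_algebra K H \<Delta>' \<epsilon>' S' by fact
  note HA = H.assoc_algebra_axioms
  interpret HH: tensor K H H by (intro tensorI HA)
  interpret H3: tensor K H HH.T by (intro tensorI HA HH.T_algebra)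
  interpret H3': tensor K HH.T H by (intro tensorI HA HH.T_algebra)
  note M = H.module_axioms
  note \<Delta> = algebra_homsD[OF H.comult_hom] and \<epsilon> = algebra_homsD[OF H.counit_hom, unfolded ground_algebra_simps]
  have id: "(\<lambda>a. a) \<in> algebra_homs K H H" by (auto intro!: algebra_homsI linear_mapsI)
  note S = linear_mapsD[OF H.antipode_linear] and S' = linear_mapsD[OF H'.antipode_linear]
  have b1: "(\<lambda>b c. b \<otimes>\<^bsub>H\<^esub> S' c) \<in> bilinear_maps K H H H"
    by (rule bilinear_mapsI) (simp_all add: S' H.A.l_distr H.A.r_distr H.smult_mult_left H.smult_mult_right)
  have b1': "(\<lambda>a b. S a \<otimes>\<^bsub>H\<^esub> b) \<in> bilinear_maps K H H H"
    by (rule bilinear_mapsI) (simp_all add: S H.A.l_distr H.A.r_distr H.smult_mult_left H.smult_mult_right)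
  define N where "N = tensor_lift K H (\<lambda>b c. b \<otimes>\<^bsub>H\<^esub> S' c)"
  define N' where "N' = tensor_lift K H (\<lambda>a b. S a \<otimes>\<^bsub>H\<^esub> b)"
  note N = linear_mapsD[OF HH.lift_linear[OF M b1], folded N_def]
  note N' = linear_mapsD[OF HH.lift_linear[OF M b1'], folded N'_def]
  have b2: "(\<lambda>a s. S a \<otimes>\<^bsub>H\<^esub> N s) \<in> bilinear_maps K H HH.T H"
    by (rule bilinear_mapsI)
       (simp_all add: N S H.A.l_distr H.A.r_distr H.smult_mult_left H.smult_mult_right)
  define \<Phi> where "\<Phi> = tensor_lift K H (\<lambda>a s. S a \<otimes>\<^bsub>H\<^esub> N s)"
  note \<Phi>_lin = H3.lift_linear[OF M b2, folded \<Phi>_def]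
  note \<Phi>_tens = H3.lift_tens[OF M b2, folded \<Phi>_def]
  have be: "(\<lambda>a b. \<epsilon> b \<odot>\<^bsub>H\<^esub> a) \<in> bilinear_maps K H H H"
    by (rule bilinear_mapsI)
       (simp_all add: \<epsilon> H.smult_r_distr H.smult_l_distr H.smult_assoc1[symmetric] H.K.m_comm)
  have be': "(\<lambda>a b. \<epsilon> a \<odot>\<^bsub>H\<^esub> b) \<in> bilinear_maps K H H H"
    by (rule bilinear_mapsI)
       (simp_all add: \<epsilon> H.smult_r_distr H.smult_l_distr H.smult_assoc1[symmetric] H.K.m_comm)
  note mapR = tensor_map_hom[OF HA HA HA HH.T_algebra id H.comult_hom]
  note mapL = tensor_map_hom[OF HA HA HH.T_algebra HA H.comult_hom id]
  have "\<Phi> (tensor_map K H HH.T (\<lambda>a. a) \<Delta> t) = S (tensor_lift K H (\<lambda>a b. \<epsilon> b \<odot>\<^bsub>H\<^esub> a) t)"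
    if "t \<in> carrier HH.T" for t
  proof (rule HH.linear_maps_T_eqI[OF M _ _ _ that])
    show "(\<lambda>t. \<Phi> (tensor_map K H HH.T (\<lambda>a. a) \<Delta> t)) \<in> linear_maps K HH.T H"
      by (rule linear_maps_comp[OF algebra_homs_linear[OF mapR] \<Phi>_lin])
    show "(\<lambda>t. S (tensor_lift K H (\<lambda>a b. \<epsilon> b \<odot>\<^bsub>H\<^esub> a) t)) \<in> linear_maps K HH.T H"
      by (rule linear_maps_comp[OF HH.lift_linear[OF M be] H.antipode_linear])
    fix a b assume ab: "a \<in> carrier H" "b \<in> carrier H"
    have "N (\<Delta> b) = \<epsilon> b \<odot>\<^bsub>H\<^esub> \<one>\<^bsub>H\<^esub>"
      using H'.antipode_right[OF ab(2)] ab by (simp add: eq N_def)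
    then show "\<Phi> (tensor_map K H HH.T (\<lambda>a. a) \<Delta> (HH.tens a b)) = S (tensor_lift K H (\<lambda>a b. \<epsilon> b \<odot>\<^bsub>H\<^esub> a) (HH.tens a b))"
      using ab by (simp add: tensor_map_tens[OF HA HA HA HH.T_algebra id H.comult_hom] \<Phi>_tens \<Delta>
          HH.lift_tens[OF M be] S \<epsilon> H.smult_mult_right)
  qed
  from this[OF \<Delta>(2)[OF h]] have 1: "\<Phi> (tensor_map K H HH.T (\<lambda>a. a) \<Delta> (\<Delta> h)) = S h"
    using H.counit_right[OF h] by simp
  note assoc = tensor_assoc_hom[OF HA HA HA]
  have inner: "\<Phi> (tensor_assoc K H H H (H3'.tens s c)) = N' s \<otimes>\<^bsub>H\<^esub> S' c"
    if "s \<in> carrier HH.T" and c: "c \<in> carrier H" for s c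
  proof (rule HH.linear_maps_T_eqI[OF M _ _ _ that(1)])
    have "(\<lambda>s. H3'.tens s c) \<in> linear_maps K HH.T H3'.T"
      using c by (intro linear_mapsI) (simp_all add: H3'.tens_bilin)
    from linear_maps_comp[OF linear_maps_comp[OF this algebra_homs_linear[OF assoc]] \<Phi>_lin]
    show "(\<lambda>s. \<Phi> (tensor_assoc K H H H (H3'.tens s c))) \<in> linear_maps K HH.T H" .
    show "(\<lambda>s. N' s \<otimes>\<^bsub>H\<^esub> S' c) \<in> linear_maps K HH.T H"
      using c by (intro linear_mapsI) (simp_all add: N' S' H.A.l_distr H.smult_mult_left)
    fix a b assume ab: "a \<in> carrier H" "b \<in> carrier H"
    then show "\<Phi> (tensor_assoc K H H H (H3'.tens (HH.tens a b) c)) = N' (HH.tens a b) \<otimes>\<^bsub>H\<^esub> S' c"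
      using c by (simp add: tensor_assoc_tens[OF HA HA HA] \<Phi>_tens N_def N'_def HH.lift_tens[OF M b1]
          HH.lift_tens[OF M b1'] H.A.m_assoc S S')
  qed
  have "\<Phi> (tensor_assoc K H H H (tensor_map K HH.T H \<Delta> (\<lambda>a. a) t)) = S' (tensor_lift K H (\<lambda>a b. \<epsilon> a \<odot>\<^bsub>H\<^esub> b) t)"
    if "t \<in> carrier HH.T" for t
  proof (rule HH.linear_maps_T_eqI[OF M _ _ _ that])
    show "(\<lambda>t. \<Phi> (tensor_assoc K H H H (tensor_map K HH.T H \<Delta> (\<lambda>a. a) t))) \<in> linear_maps K HH.T H"
      by (rule linear_maps_comp[OF linear_maps_comp[OF algebra_homs_linear[OF mapL] algebra_homs_linear[OF assoc]] \<Phi>_lin])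
    show "(\<lambda>t. S' (tensor_lift K H (\<lambda>a b. \<epsilon> a \<odot>\<^bsub>H\<^esub> b) t)) \<in> linear_maps K HH.T H"
      by (rule linear_maps_comp[OF HH.lift_linear[OF M be'] H'.antipode_linear])
    fix a b assume ab: "a \<in> carrier H" "b \<in> carrier H"
    have "N' (\<Delta> a) = \<epsilon> a \<odot>\<^bsub>H\<^esub> \<one>\<^bsub>H\<^esub>"
      using H.antipode_left[OF ab(1)] by (simp add: N'_def)
    then show "\<Phi> (tensor_assoc K H H H (tensor_map K HH.T H \<Delta> (\<lambda>a. a) (HH.tens a b))) =
        S' (tensor_lift K H (\<lambda>a b. \<epsilon> a \<odot>\<^bsub>H\<^esub> b) (HH.tens a b))"
      using ab by (simp add: tensor_map_tens[OF HA HA HH.T_algebra HA H.comult_hom id] inner \<Delta>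
          HH.lift_tens[OF M be'] S' \<epsilon> H.smult_mult_left)
  qed
  from this[OF \<Delta>(2)[OF h]]
  have 2: "\<Phi> (tensor_assoc K H H H (tensor_map K HH.T H \<Delta> (\<lambda>a. a) (\<Delta> h))) = S' h"
    using H.counit_left[OF h] by simp
  show ?thesis using 1 2 H.coassoc[OF h] by simp
qed

section \<open>The algebra D\<close>

text \<open>The elements satisfy the defining relations, so that they define a homomorphism from \<open>D\<close>. It will
be used for the coproduct, the counit and the antipode, and for the generators of \<open>D\<close>
themselves.\<close>

definition D_model :: "('k, 'z) ring_scheme \<Rightarrow> nat \<Rightarrow> nat \<Rightarrow> 'k \<Rightarrow> 'i set \<Rightarrow> ('i \<Rightarrow> 'k) \<Rightarrow>
    ('k, 'a) module \<Rightarrow> 'a \<Rightarrow> 'a \<Rightarrow> ('i \<Rightarrow> 'a) \<Rightarrow> ('i \<Rightarrow> 'a) \<Rightarrow> bool" where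
  "D_model K m n \<omega> I q A u x a a' \<longleftrightarrow>
     u \<in> carrier A \<and> x \<in> carrier A \<and> (\<forall>i\<in>I. a i \<in> carrier A \<and> a' i \<in> carrier A) \<and>
     u [^]\<^bsub>A\<^esub> m = \<one>\<^bsub>A\<^esub> \<and> x [^]\<^bsub>A\<^esub> n = \<zero>\<^bsub>A\<^esub> \<and> u \<otimes>\<^bsub>A\<^esub> x = \<omega> \<odot>\<^bsub>A\<^esub> (x \<otimes>\<^bsub>A\<^esub> u) \<and>
     (\<forall>i\<in>I. a i \<otimes>\<^bsub>A\<^esub> a' i = \<one>\<^bsub>A\<^esub> \<and> a' i \<otimes>\<^bsub>A\<^esub> a i = \<one>\<^bsub>A\<^esub> \<and> u \<otimes>\<^bsub>A\<^esub> a i = a i \<otimes>\<^bsub>A\<^esub> u \<and>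
        a i \<otimes>\<^bsub>A\<^esub> x = q i \<odot>\<^bsub>A\<^esub> (x \<otimes>\<^bsub>A\<^esub> a i)) \<and>
     (\<forall>i\<in>I. \<forall>j\<in>I. a i \<otimes>\<^bsub>A\<^esub> a j = a j \<otimes>\<^bsub>A\<^esub> a i)"

locale D_alg = root_of_unity K n \<omega> for K :: "('k, 'z) ring_scheme" (structure) and n \<omega> +
  fixes m :: nat and I :: "'i set" and q :: "'i \<Rightarrow> 'k"
  assumes m_gt_1: "m > 1" and q_Units: "i \<in> I \<Longrightarrow> q i \<in> Units K"
begin

abbreviation S where "S \<equiv> D_gens I"
abbreviation R where "R \<equiv> D_relations K m n \<omega> I q"

lemma gens_in_S [simp, intro]: "Gen_u \<in> S" "Gen_x \<in> S" "i \<in> I \<Longrightarrow> Gen_a i \<in> S" "i \<in> I \<Longrightarrow> Gen_a_inv i \<in> S"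
  by (auto simp: D_gens_def)

lemma q_closed [simp, intro]: "i \<in> I \<Longrightarrow> q i \<in> carrier K"
  using q_Units by auto

sublocale free_alg K S
  by (intro free_alg.intro K.field_axioms)

lemma R_intros:
  "(free_gen K Gen_u [^]\<^bsub>F\<^esub> m, \<one>\<^bsub>F\<^esub>) \<in> R"
  "(free_gen K Gen_x [^]\<^bsub>F\<^esub> n, \<zero>\<^bsub>F\<^esub>) \<in> R"
  "(free_gen K Gen_u \<otimes>\<^bsub>F\<^esub> free_gen K Gen_x, \<omega> \<odot>\<^bsub>F\<^esub> (free_gen K Gen_x \<otimes>\<^bsub>F\<^esub> free_gen K Gen_u)) \<in> R"
  "i \<in> I \<Longrightarrow> (free_gen K (Gen_a i) \<otimes>\<^bsub>F\<^esub> free_gen K (Gen_a_inv i), \<one>\<^bsub>F\<^esub>) \<in> R"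
  "i \<in> I \<Longrightarrow> (free_gen K (Gen_a_inv i) \<otimes>\<^bsub>F\<^esub> free_gen K (Gen_a i), \<one>\<^bsub>F\<^esub>) \<in> R"
  "i \<in> I \<Longrightarrow> (free_gen K Gen_u \<otimes>\<^bsub>F\<^esub> free_gen K (Gen_a i), free_gen K (Gen_a i) \<otimes>\<^bsub>F\<^esub> free_gen K Gen_u) \<in> R"
  "i \<in> I \<Longrightarrow> (free_gen K (Gen_a i) \<otimes>\<^bsub>F\<^esub> free_gen K Gen_x,
      q i \<odot>\<^bsub>F\<^esub> (free_gen K Gen_x \<otimes>\<^bsub>F\<^esub> free_gen K (Gen_a i))) \<in> R"
  "i \<in> I \<Longrightarrow> j \<in> I \<Longrightarrow> (free_gen K (Gen_a i) \<otimes>\<^bsub>F\<^esub> free_gen K (Gen_a j),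
      free_gen K (Gen_a j) \<otimes>\<^bsub>F\<^esub> free_gen K (Gen_a i)) \<in> R"
  unfolding D_relations_def Let_def F_free by blast+

lemma R_cases:
  assumes "(l, r) \<in> R"
  obtains
    "l = free_gen K Gen_u [^]\<^bsub>F\<^esub> m" "r = \<one>\<^bsub>F\<^esub>"
  | "l = free_gen K Gen_x [^]\<^bsub>F\<^esub> n" "r = \<zero>\<^bsub>F\<^esub>"
  | "l = free_gen K Gen_u \<otimes>\<^bsub>F\<^esub> free_gen K Gen_x" "r = \<omega> \<odot>\<^bsub>F\<^esub> (free_gen K Gen_x \<otimes>\<^bsub>F\<^esub> free_gen K Gen_u)"
  | i where "i \<in> I" "l = free_gen K (Gen_a i) \<otimes>\<^bsub>F\<^esub> free_gen K (Gen_a_inv i)" "r = \<one>\<^bsub>F\<^esub>"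
  | i where "i \<in> I" "l = free_gen K (Gen_a_inv i) \<otimes>\<^bsub>F\<^esub> free_gen K (Gen_a i)" "r = \<one>\<^bsub>F\<^esub>"
  | i where "i \<in> I" "l = free_gen K Gen_u \<otimes>\<^bsub>F\<^esub> free_gen K (Gen_a i)" "r = free_gen K (Gen_a i) \<otimes>\<^bsub>F\<^esub> free_gen K Gen_u"
  | i where "i \<in> I" "l = free_gen K (Gen_a i) \<otimes>\<^bsub>F\<^esub> free_gen K Gen_x" "r = q i \<odot>\<^bsub>F\<^esub> (free_gen K Gen_x \<otimes>\<^bsub>F\<^esub> free_gen K (Gen_a i))"
  | i j where "i \<in> I" "j \<in> I" "l = free_gen K (Gen_a i) \<otimes>\<^bsub>F\<^esub> free_gen K (Gen_a j)" "r = free_gen K (Gen_a j) \<otimes>\<^bsub>F\<^esub> free_gen K (Gen_a i)"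
  using assms unfolding D_relations_def Let_def F_free by (elim UnE insertE CollectE exE conjE) auto

sublocale presentation K S R
proof (unfold_locales)
  fix l r assume "(l, r) \<in> R"
  then show "l \<in> carrier F \<and> r \<in> carrier F"
    by (cases rule: R_cases) (simp_all add: free_gen_closed)
qed

abbreviation D where "D \<equiv> D_algebra K m n \<omega> I q"
abbreviation Dg where "Dg \<equiv> D_gen K m n \<omega> I q"
abbreviation u where "u \<equiv> Dg Gen_u"
abbreviation x where "x \<equiv> Dg Gen_x"
abbreviation a where "a i \<equiv> Dg (Gen_a i)"
abbreviation a' where "a' i \<equiv> Dg (Gen_a_inv i)"

lemma D_P: "D = P" and Dg_gen: "Dg = gen"
  by (simp_all add: D_algebra_def D_gen_def fun_eq_iff)

lemma D_algebra: "assoc_algebra K D"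
  unfolding D_P by (rule P_algebra)

definition D_lift :: "('k, 'a) module \<Rightarrow> 'a \<Rightarrow> 'a \<Rightarrow> ('i \<Rightarrow> 'a) \<Rightarrow> ('i \<Rightarrow> 'a) \<Rightarrow> ('i gen list \<Rightarrow> 'k) set \<Rightarrow> 'a" where
  "D_lift A U X b b' = presented_lift A (case_gen U X b b')"

lemma D_lift:
  assumes A: "assoc_algebra K A" and model: "D_model K m n \<omega> I q A U X b b'"
  shows "D_lift A U X b b' \<in> algebra_homs K D A"
    and "D_lift A U X b b' u = U" "D_lift A U X b b' x = X"
    and "i \<in> I \<Longrightarrow> D_lift A U X b b' (a i) = b i" "i \<in> I \<Longrightarrow> D_lift A U X b b' (a' i) = b' i"
proof -
  interpret A: assoc_algebra K A by (rule A)
  let ?v = "case_gen U X b b'"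
  have v: "?v \<in> S \<rightarrow> carrier A"
    using model by (auto simp: D_model_def D_gens_def)
  note hom = free_eval_hom[OF A v]
  note homs = algebra_homsD[OF hom] algebra_homs_zero[OF F_algebra A hom]
    algebra_homs_pow[OF F.A.monoid_axioms A.A.monoid_axioms hom] free_eval_gen[OF A v] free_gen_closed
  have rel: "free_eval K A ?v l = free_eval K A ?v r" if "(l, r) \<in> R" for l r
    using that by (cases rule: R_cases) (use model in \<open>simp_all add: homs D_model_def\<close>)
  show "D_lift A U X b b' \<in> algebra_homs K D A"
    unfolding D_lift_def D_P by (rule presented_lift_hom[OF A v rel])
  show "D_lift A U X b b' u = U" "D_lift A U X b b' x = X"
    "i \<in> I \<Longrightarrow> D_lift A U X b b' (a i) = b i" "i \<in> I \<Longrightarrow> D_lift A U X b b' (a' i) = b' i"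
    by (simp_all add: D_lift_def Dg_gen presented_lift_gen[OF A v rel])
qed

lemma D_induct [consumes 1, case_names zero smult add one gen]:
  assumes "h \<in> carrier D"
    and "\<phi> \<zero>\<^bsub>D\<^esub>"
    and "\<And>c f. c \<in> carrier K \<Longrightarrow> f \<in> carrier D \<Longrightarrow> \<phi> f \<Longrightarrow> \<phi> (c \<odot>\<^bsub>D\<^esub> f)"
    and "\<And>f g. f \<in> carrier D \<Longrightarrow> g \<in> carrier D \<Longrightarrow> \<phi> f \<Longrightarrow> \<phi> g \<Longrightarrow> \<phi> (f \<oplus>\<^bsub>D\<^esub> g)"
    and "\<phi> \<one>\<^bsub>D\<^esub>"
    and "\<And>g f. g \<in> S \<Longrightarrow> f \<in> carrier D \<Longrightarrow> \<phi> f \<Longrightarrow> \<phi> (Dg g \<otimes>\<^bsub>D\<^esub> f)"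
  shows "\<phi> h"
  using assms unfolding D_P Dg_gen by (rule presented_induct)

lemma gen_cases:
  assumes "g \<in> S"
  obtains "g = Gen_u" | "g = Gen_x" | i where "i \<in> I" "g = Gen_a i" | i where "i \<in> I" "g = Gen_a_inv i"
  using assms by (auto simp: D_gens_def)

lemma D_hom_eqI:
  assumes "assoc_algebra K A" "f \<in> algebra_homs K D A" "f' \<in> algebra_homs K D A"
    and "f u = f' u" "f x = f' x" "\<And>i. i \<in> I \<Longrightarrow> f (a i) = f' (a i)" "\<And>i. i \<in> I \<Longrightarrow> f (a' i) = f' (a' i)"
    and "h \<in> carrier D"
  shows "f h = f' h"
proof (rule presented_hom_eqI[OF assms(1)])
  show "f (gen g) = f' (gen g)" if "g \<in> S" for g
    using that by (cases rule: gen_cases) (auto simp: assms Dg_gen[symmetric])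
qed (use assms in \<open>simp_all add: D_P\<close>)

lemma D_closed [simp, intro]: "u \<in> carrier D" "x \<in> carrier D" "i \<in> I \<Longrightarrow> a i \<in> carrier D" "i \<in> I \<Longrightarrow> a' i \<in> carrier D"
  by (auto simp: D_P Dg_gen intro!: gen_closed)

lemma D_is_model: "D_model K m n \<omega> I q D u x a a'"
proof -
  note hom = coset_P_hom[folded D_P]
  interpret D: assoc_algebra K D by (rule D_algebra)
  let ?\<pi> = "\<lambda>f. J +>\<^bsub>F\<^esub> f"
  note homs = algebra_homsD[OF hom] algebra_homs_zero[OF F_algebra D_algebra hom]
    algebra_homs_pow[OF F.A.monoid_axioms D.A.monoid_axioms hom] free_gen_closed
  have \<pi>: "Dg g = ?\<pi> (free_gen K g)" for g by (simp add: Dg_gen gen_coset)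
  have rel: "(l, r) \<in> R \<Longrightarrow> ?\<pi> l = ?\<pi> r" for l r by (rule relation_holds)
  show ?thesis
    unfolding D_model_def
  proof (intro conjI ballI)
    show "u [^]\<^bsub>D\<^esub> m = \<one>\<^bsub>D\<^esub>" using rel[OF R_intros(1)] by (simp add: \<pi> homs)
    show "x [^]\<^bsub>D\<^esub> n = \<zero>\<^bsub>D\<^esub>" using rel[OF R_intros(2)] by (simp add: \<pi> homs)
    show "u \<otimes>\<^bsub>D\<^esub> x = \<omega> \<odot>\<^bsub>D\<^esub> (x \<otimes>\<^bsub>D\<^esub> u)" using rel[OF R_intros(3)] by (simp add: \<pi> homs)
    fix i assume i: "i \<in> I"
    show "a i \<otimes>\<^bsub>D\<^esub> a' i = \<one>\<^bsub>D\<^esub>" using rel[OF R_intros(4)[OF i]] i by (simp add: \<pi> homs)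
    show "a' i \<otimes>\<^bsub>D\<^esub> a i = \<one>\<^bsub>D\<^esub>" using rel[OF R_intros(5)[OF i]] i by (simp add: \<pi> homs)
    show "u \<otimes>\<^bsub>D\<^esub> a i = a i \<otimes>\<^bsub>D\<^esub> u" using rel[OF R_intros(6)[OF i]] i by (simp add: \<pi> homs)
    show "a i \<otimes>\<^bsub>D\<^esub> x = q i \<odot>\<^bsub>D\<^esub> (x \<otimes>\<^bsub>D\<^esub> a i)" using rel[OF R_intros(7)[OF i]] i by (simp add: \<pi> homs)
    fix j assume j: "j \<in> I"
    show "a i \<otimes>\<^bsub>D\<^esub> a j = a j \<otimes>\<^bsub>D\<^esub> a i" using rel[OF R_intros(8)[OF i j]] i j by (simp add: \<pi> homs)
  qed auto
qed

end

section \<open>The Hopf algebra structure\<close>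

locale D_hopf = D_alg +
  fixes \<alpha>
  assumes alpha_closed [simp, intro]: "\<alpha> \<in> carrier K" and alpha_m: "\<alpha> \<noteq> \<zero> \<Longrightarrow> m = n"
begin

interpretation D: assoc_algebra K D by (rule D_algebra)
interpretation DD: tensor K D D by (intro tensorI D_algebra)
interpretation QD: q_exponential D K n \<omega> by (intro q_exponential.intro D_algebra root_of_unity_axioms)
interpretation QQ: q_exponential DD.T K n \<omega> by (intro q_exponential.intro DD.T_algebra root_of_unity_axioms)

abbreviation D_mult (infixl "\<cdot>" 70) where "b \<cdot> c \<equiv> b \<otimes>\<^bsub>D\<^esub> c"
abbreviation DD_mult (infixl "\<star>" 70) where "s \<star> t \<equiv> s \<otimes>\<^bsub>DD.T\<^esub> t"
abbreviation A0 where "A0 \<equiv> pure_tensor K D D u x"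
abbreviation B0 where "B0 \<equiv> pure_tensor K D D x \<one>\<^bsub>D\<^esub>"
abbreviation tw0 where "tw0 c \<equiv> twist K DD.T n \<omega> c A0 B0"

lemma D_rels:
  "u [^]\<^bsub>D\<^esub> m = \<one>\<^bsub>D\<^esub>" "x [^]\<^bsub>D\<^esub> n = \<zero>\<^bsub>D\<^esub>" "u \<cdot> x = \<omega> \<odot>\<^bsub>D\<^esub> (x \<cdot> u)"
  "i \<in> I \<Longrightarrow> a i \<cdot> a' i = \<one>\<^bsub>D\<^esub>" "i \<in> I \<Longrightarrow> a' i \<cdot> a i = \<one>\<^bsub>D\<^esub>"
  "i \<in> I \<Longrightarrow> u \<cdot> a i = a i \<cdot> u"
  "i \<in> I \<Longrightarrow> a i \<cdot> x = q i \<odot>\<^bsub>D\<^esub> (x \<cdot> a i)"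
  "i \<in> I \<Longrightarrow> j \<in> I \<Longrightarrow> a i \<cdot> a j = a j \<cdot> a i"
  using D_is_model unfolding D_model_def by blast+

lemma A0_B0_pair: "QQ.pair A0 B0"
  unfolding q_pair_def
proof (intro conjI)
  show "A0 \<star> B0 = \<omega> \<odot>\<^bsub>DD.T\<^esub> (B0 \<star> A0)"
    using DD.tens_commute_scaled[of u x x "\<one>\<^bsub>D\<^esub>" \<omega> \<one>] by (simp add: D_rels)
qed (simp_all add: DD.tens_pow D_rels DD.tens_zero)

lemmas A0_B0_closed = QQ.pairD(1,2)[OF A0_B0_pair]

text \<open>The tensor square of such an element \<open>b\<close> scales \<open>u \<otimes> x\<close> and \<open>x \<otimes> 1\<close> by \<open>\<rho>\<close>. The generators
\<open>u\<close>, \<open>a\<^sub>i\<close> and \<open>a\<^sub>i\<inverse>\<close> are of this kind, which allows them to be treated together.\<close>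

definition q_grouplike where
  "q_grouplike b \<rho> \<longleftrightarrow> b \<in> carrier D \<and> \<rho> \<in> Units K \<and> b \<cdot> u = u \<cdot> b \<and>
     b \<cdot> x = \<rho> \<odot>\<^bsub>D\<^esub> (x \<cdot> b)"

lemma q_grouplike_u: "q_grouplike u \<omega>"
proof -
  have "\<omega> \<noteq> \<zero>"
    using omega_pow_n n_gt_1 by (cases n) auto
  then show ?thesis by (simp add: q_grouplike_def D_rels K.field_Units)
qed

lemma q_grouplike_a: "i \<in> I \<Longrightarrow> q_grouplike (a i) (q i)"
  by (simp add: q_grouplike_def D_rels q_Units)

lemma q_grouplike_a': "i \<in> I \<Longrightarrow> q_grouplike (a' i) (inv (q i))"
  using D.inverse_commute_scaled(1)[of "a i" "a' i" x "q i"] D.inverse_commute_scaled(1)[of "a i" "a' i" u \<one>]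
  by (simp add: q_grouplike_def D_rels q_Units)

lemma q_grouplikeD:
  assumes "q_grouplike b \<rho>"
  shows "b \<in> carrier D" "\<rho> \<in> Units K" "\<rho> \<in> carrier K" "b \<cdot> u = u \<cdot> b"
    "b \<cdot> x = \<rho> \<odot>\<^bsub>D\<^esub> (x \<cdot> b)" "DD.tens b b \<in> carrier DD.T"
  using assms by (auto simp: q_grouplike_def)

lemma q_grouplike_commutes:
  assumes "q_grouplike b \<rho>"
  shows "DD.tens b b \<star> A0 = \<rho> \<odot>\<^bsub>DD.T\<^esub> (A0 \<star> DD.tens b b)"
    and "DD.tens b b \<star> B0 = \<rho> \<odot>\<^bsub>DD.T\<^esub> (B0 \<star> DD.tens b b)"
    and "DD.tens b b \<star> (A0 \<oplus>\<^bsub>DD.T\<^esub> B0) = \<rho> \<odot>\<^bsub>DD.T\<^esub> ((A0 \<oplus>\<^bsub>DD.T\<^esub> B0) \<star> DD.tens b b)"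
proof -
  note b = q_grouplikeD[OF assms]
  show 1: "DD.tens b b \<star> A0 = \<rho> \<odot>\<^bsub>DD.T\<^esub> (A0 \<star> DD.tens b b)"
    using DD.tens_commute_scaled[of b u b x \<one> \<rho>] b by simp
  show 2: "DD.tens b b \<star> B0 = \<rho> \<odot>\<^bsub>DD.T\<^esub> (B0 \<star> DD.tens b b)"
    using DD.tens_commute_scaled[of b x b "\<one>\<^bsub>D\<^esub>" \<rho> \<one>] b by simp
  show "DD.tens b b \<star> (A0 \<oplus>\<^bsub>DD.T\<^esub> B0) = \<rho> \<odot>\<^bsub>DD.T\<^esub> ((A0 \<oplus>\<^bsub>DD.T\<^esub> B0) \<star> DD.tens b b)"
    using b A0_B0_closed by (simp add: DD.T.A.l_distr DD.T.A.r_distr DD.T.smult_r_distr 1 2)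
qed

lemma q_grouplike_tw:
  assumes "q_grouplike b \<rho>" "c \<in> carrier K"
  shows "DD.tens b b \<star> tw0 c = tw0 (c \<otimes> \<rho> [^] n) \<star> DD.tens b b"
  using q_grouplikeD[OF assms(1)] q_grouplike_commutes[OF assms(1)] A0_B0_closed assms(2)
  by (intro QQ.tw_commute_scaled) auto

lemma tw0_closed [simp, intro]: "c \<in> carrier K \<Longrightarrow> tw0 c \<in> carrier DD.T"
  using A0_B0_closed by simp

subsection \<open>The comultiplication\<close>

text \<open>The coproduct for which all \<open>a\<^sub>i\<close> are grouplike, before twisting.\<close>

definition comult0 where
  "comult0 = D_lift DD.T (DD.tens u u) (A0 \<oplus>\<^bsub>DD.T\<^esub> B0) (\<lambda>i. DD.tens (a i) (a i)) (\<lambda>i. DD.tens (a' i) (a' i))"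

lemma comult0_model:
  "D_model K m n \<omega> I q DD.T (DD.tens u u) (A0 \<oplus>\<^bsub>DD.T\<^esub> B0) (\<lambda>i. DD.tens (a i) (a i)) (\<lambda>i. DD.tens (a' i) (a' i))"
  unfolding D_model_def
  using A0_B0_closed
  by (simp add: DD.tens_pow D_rels DD.tens_one QQ.sum_pow_n[OF A0_B0_pair] DD.tens_mult
      q_grouplike_commutes[OF q_grouplike_u] q_grouplike_commutes[OF q_grouplike_a])

lemmas comult0 = D_lift[OF DD.T_algebra comult0_model, folded comult0_def]

text \<open>Conjugation by the twist keeps the homomorphism property, so that no relation has to be checked
for the prescribed values on \<open>a\<^sub>i\<close>. The inverse of the twist for \<open>\<alpha>\<close> is the twist for \<open>-\<alpha>\<close>.\<close>

definition comult where
  "comult h = tw0 \<alpha> \<star> comult0 h \<star> tw0 (\<ominus> \<alpha>)"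

lemma comult_hom: "comult \<in> algebra_homs K D DD.T"
  unfolding comult_def using A0_B0_closed
  by (intro conjugation_hom[OF DD.T_algebra comult0(1)]) (simp_all add: QQ.tw_inverse[OF A0_B0_pair])

lemma comult_x: "comult x = A0 \<oplus>\<^bsub>DD.T\<^esub> B0"
proof -
  have "comult x = (A0 \<oplus>\<^bsub>DD.T\<^esub> B0) \<star> (tw0 \<alpha> \<star> tw0 (\<ominus> \<alpha>))"
    unfolding comult_def comult0
    using A0_B0_closed by (simp add: QQ.tw_commutes_sum[OF A0_B0_pair, symmetric] DD.T.A.m_assoc
        del: DD.T.A.l_distr)
  then show ?thesis using A0_B0_closed by (simp add: QQ.tw_inverse[OF A0_B0_pair])
qed

text \<open>Moving \<open>b \<otimes> b\<close> to the right past the inverse twist replaces \<open>-\<alpha>\<close> by \<open>-\<alpha> \<rho>\<^sup>n\<close>, and parameters of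
twists add up.\<close>

lemma conj_grouplike:
  assumes "q_grouplike b \<rho>"
  shows "tw0 \<alpha> \<star> DD.tens b b \<star> tw0 (\<ominus> \<alpha>) = tw0 (\<alpha> \<otimes> (\<one> \<ominus> \<rho> [^] n)) \<star> DD.tens b b"
proof -
  note b = q_grouplikeD[OF assms]
  have p: "\<rho> [^] n \<in> carrier K" using b by simp
  have "tw0 \<alpha> \<star> DD.tens b b \<star> tw0 (\<ominus> \<alpha>) =
      (tw0 \<alpha> \<star> tw0 (\<ominus> \<alpha> \<otimes> \<rho> [^] n)) \<star> DD.tens b b"
    using b by (simp add: DD.T.A.m_assoc q_grouplike_tw[OF assms])
  also have "\<dots> = tw0 (\<alpha> \<oplus> \<ominus> \<alpha> \<otimes> \<rho> [^] n) \<star> DD.tens b b"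
    using p by (simp add: QQ.tw_add[OF A0_B0_pair])
  also have "\<alpha> \<oplus> \<ominus> \<alpha> \<otimes> \<rho> [^] n = \<alpha> \<otimes> (\<one> \<ominus> \<rho> [^] n)"
    using p alpha_closed by algebra
  finally show ?thesis .
qed

lemma comult_u: "comult u = DD.tens u u"
proof -
  have "\<one> \<ominus> \<one> = \<zero>" by (simp add: minus_eq_zero_iff)
  then show ?thesis
    unfolding comult_def comult0 conj_grouplike[OF q_grouplike_u]
    using A0_B0_closed by (simp add: QQ.tw_0)
qed

lemma inv_mult_Units:
  assumes "c \<in> Units K" "d \<in> Units K"
  shows "inv (c \<otimes> d) = inv c \<otimes> inv d"
proof -
  have c: "c \<in> carrier K" "d \<in> carrier K" "inv c \<in> carrier K" "inv d \<in> carrier K" using assms by auto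
  have "(c \<otimes> d) \<otimes> (inv c \<otimes> inv d) = (c \<otimes> inv c) \<otimes> (d \<otimes> inv d)"
    using c by (simp add: K.m_ac)
  also have "\<dots> = \<one>" using assms by simp
  finally show ?thesis using c by (intro K.comm_inv_char) auto
qed

text \<open>The sum in the prescribed coproduct is the coefficient of degree \<open>n\<close> times \<open>b \<otimes> b\<close>, because
\<open>B\<^sup>n\<^sup>-\<^sup>k A\<^sup>k = x\<^sup>n\<^sup>-\<^sup>k u\<^sup>k \<otimes> x\<^sup>k\<close> for \<open>A = u \<otimes> x\<close>, \<open>B = x \<otimes> 1\<close>. The terms for \<open>k = 0\<close> and \<open>k = n\<close> are
absent since divided powers vanish in degree \<open>n\<close>.\<close>

lemma comult_formula_tw:
  assumes b: "b \<in> carrier D" and r: "r \<in> carrier K"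
  shows "comult_formula K D n \<omega> \<alpha> u x b r = tw0 (\<alpha> \<otimes> (\<one> \<ominus> r)) \<star> DD.tens b b"
proof -
  let ?bb = "DD.tens b b" and ?c = "\<alpha> \<otimes> (\<one> \<ominus> r)"
  let ?f = "\<lambda>i. QQ.dp B0 i \<star> QQ.dp A0 (n - i) \<star> ?bb"
  let ?g = "\<lambda>k. inv (qf k \<otimes> qf (n - k)) \<odot>\<^bsub>DD.T\<^esub>
      DD.tens (x [^]\<^bsub>D\<^esub> (n - k) \<cdot> u [^]\<^bsub>D\<^esub> k \<cdot> b) (x [^]\<^bsub>D\<^esub> k \<cdot> b)"
  have bb: "?bb \<in> carrier DD.T" using b by simp
  have c: "?c \<in> carrier K" using r by simp
  have f: "?f i \<in> carrier DD.T" for i using bb A0_B0_closed by simp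
  have fg: "?f (n - k) = ?g k" if "k \<in> {1..n - 1}" for k
  proof -
    have k: "k < n" "n - k < n" "n - (n - k) = k" using that by auto
    then have units: "qf k \<in> Units K" "qf (n - k) \<in> Units K" by (auto intro: qf_Unit)
    have "?f (n - k) = (inv (qf k) \<otimes> inv (qf (n - k))) \<odot>\<^bsub>DD.T\<^esub>
        (B0 [^]\<^bsub>DD.T\<^esub> (n - k) \<star> A0 [^]\<^bsub>DD.T\<^esub> k \<star> ?bb)"
      using k units bb A0_B0_closed
      by (simp add: divided_power_def DD.T.smult_mult_left DD.T.smult_mult_right DD.T.smult_assoc1)
    also have "B0 [^]\<^bsub>DD.T\<^esub> (n - k) \<star> A0 [^]\<^bsub>DD.T\<^esub> k \<star> ?bb =
        DD.tens (x [^]\<^bsub>D\<^esub> (n - k) \<cdot> u [^]\<^bsub>D\<^esub> k \<cdot> b) (x [^]\<^bsub>D\<^esub> k \<cdot> b)"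
      using b by (simp add: DD.tens_pow DD.tens_mult)
    also have "inv (qf k) \<otimes> inv (qf (n - k)) = inv (qf k \<otimes> qf (n - k))"
      using units by (simp add: inv_mult_Units)
    finally show ?thesis .
  qed
  have g: "?g k \<in> carrier DD.T" if "k \<in> {1..n - 1}" for k
    using f[of "n - k"] fg[OF that] by simp
  have img: "{1..n - 1} = (\<lambda>k. n - k) ` {1..n - 1}"
  proof (rule Set.set_eqI)
    fix k
    show "k \<in> {1..n - 1} \<longleftrightarrow> k \<in> (\<lambda>k. n - k) ` {1..n - 1}"
      using n_gt_1 by (auto simp: image_iff intro!: bexI[of _ "n - k"])
  qed
  have "QQ.T A0 B0 n \<star> ?bb = (\<Oplus>\<^bsub>DD.T\<^esub>i\<in>{..n}. ?f i)"
    unfolding exp_coeff_def using A0_B0_closed bb by (intro DD.T.A.finsum_ldistr) auto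
  also have "\<dots> = (\<Oplus>\<^bsub>DD.T\<^esub>i\<in>{1..n - 1}. ?f i)"
  proof (rule DD.T.M.add.finprod_mono_neutral_cong_right)
    show "?f i = \<zero>\<^bsub>DD.T\<^esub>" if "i \<in> {..n} - {1..n - 1}" for i
    proof -
      from that have "i = 0 \<or> i = n" by auto
      then show ?thesis using A0_B0_closed bb by auto
    qed
  qed (use f in auto)
  also have "\<dots> = (\<Oplus>\<^bsub>DD.T\<^esub>i\<in>(\<lambda>k. n - k) ` {1..n - 1}. ?f i)"
    by (simp only: img[symmetric])
  also have "\<dots> = (\<Oplus>\<^bsub>DD.T\<^esub>k\<in>{1..n - 1}. ?f (n - k))"
    by (rule DD.T.M.finsum_reindex) (use f in \<open>auto simp: inj_on_def\<close>)
  also have "\<dots> = (\<Oplus>\<^bsub>DD.T\<^esub>k\<in>{1..n - 1}. ?g k)"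
    by (rule DD.T.M.finsum_cong') (use g fg in auto)
  finally have sum: "QQ.T A0 B0 n \<star> ?bb = (\<Oplus>\<^bsub>DD.T\<^esub>k\<in>{1..n - 1}. ?g k)" .
  show ?thesis
    unfolding comult_formula_def Let_def sum[symmetric] twist_def
    using c bb A0_B0_closed by (simp add: DD.T.A.l_distr DD.T.smult_mult_left)
qed

lemma int_pow_q:
  assumes "i \<in> I"
  shows "q i [^] int n = q i [^] n" "q i [^] (- int n) = inv (q i) [^] n"
proof -
  have c: "q i \<in> carrier K" "inv (q i) \<in> carrier K" using q_Units[OF assms] by auto
  show "q i [^] int n = q i [^] n" by (simp add: int_pow_int)
  have "q i [^] n \<otimes> inv (q i) [^] n = (q i \<otimes> inv (q i)) [^] n"
    using c by (simp add: K.nat_pow_distrib)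
  also have "\<dots> = \<one>" using q_Units[OF assms] by simp
  finally have "inv (q i [^] n) = inv (q i) [^] n"
    using c by (intro K.comm_inv_char) auto
  then show "q i [^] (- int n) = inv (q i) [^] n"
    using n_gt_1 by (simp add: int_pow_def2)
qed

lemma comult_a:
  assumes "i \<in> I"
  shows "comult (a i) = comult_formula K D n \<omega> \<alpha> u x (a i) (q i [^] int n)"
    and "comult (a' i) = comult_formula K D n \<omega> \<alpha> u x (a' i) (q i [^] (- int n))"
proof -
  have c: "q i \<in> carrier K" "inv (q i) \<in> carrier K" using q_Units[OF assms] by auto
  show "comult (a i) = comult_formula K D n \<omega> \<alpha> u x (a i) (q i [^] int n)"
    using c assms unfolding comult_def int_pow_q[OF assms] comult0(4)[OF assms]
    by (simp add: conj_grouplike[OF q_grouplike_a] comult_formula_tw)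
  show "comult (a' i) = comult_formula K D n \<omega> \<alpha> u x (a' i) (q i [^] (- int n))"
    using c assms unfolding comult_def int_pow_q[OF assms] comult0(5)[OF assms]
    by (simp add: conj_grouplike[OF q_grouplike_a'] comult_formula_tw)
qed

subsection \<open>Counit\<close>

definition counit where
  "counit = D_lift (ground_algebra K) \<one> \<zero> (\<lambda>i. \<one>) (\<lambda>i. \<one>)"

lemma counit_model: "D_model K m n \<omega> I q (ground_algebra K) \<one> \<zero> (\<lambda>i. \<one>) (\<lambda>i. \<one>)"
proof -
  interpret G: assoc_algebra K "ground_algebra K" by (rule ground_algebra_algebra[OF K.field_axioms])
  have "\<zero> [^]\<^bsub>ground_algebra K\<^esub> n = \<zero>"
    using n_gt_1 G.A.nat_pow_zero[of n] by simp
  moreover have "\<one> [^]\<^bsub>ground_algebra K\<^esub> m = \<one>"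
    using G.A.nat_pow_one[of m] by simp
  ultimately show ?thesis by (simp add: D_model_def)
qed

lemmas counit = D_lift[OF ground_algebra_algebra[OF K.field_axioms] counit_model, folded counit_def]

lemma counit_q_grouplike:
  "counit u = \<one>" "counit x = \<zero>" "i \<in> I \<Longrightarrow> counit (a i) = \<one>" "i \<in> I \<Longrightarrow> counit (a' i) = \<one>"
  by (simp_all add: counit)

lemma counit_maps:
  defines "lft \<equiv> tensor_lift K D (\<lambda>b c. counit b \<odot>\<^bsub>D\<^esub> c)" and "rgt \<equiv> tensor_lift K D (\<lambda>b c. counit c \<odot>\<^bsub>D\<^esub> b)"
  shows "lft \<in> algebra_homs K DD.T D" "rgt \<in> algebra_homs K DD.T D"
    and "\<lbrakk>b \<in> carrier D; c \<in> carrier D\<rbrakk> \<Longrightarrow> lft (DD.tens b c) = counit b \<odot>\<^bsub>D\<^esub> c"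
    and "\<lbrakk>b \<in> carrier D; c \<in> carrier D\<rbrakk> \<Longrightarrow> rgt (DD.tens b c) = counit c \<odot>\<^bsub>D\<^esub> b"
proof -
  note \<epsilon> = algebra_homsD[OF counit(1), unfolded ground_algebra_simps]
  have bl: "(\<lambda>b c. counit b \<odot>\<^bsub>D\<^esub> c) \<in> bilinear_maps K D D D"
    by (rule bilinear_mapsI)
       (simp_all add: \<epsilon> D.smult_r_distr D.smult_l_distr D.smult_assoc1[symmetric] K.m_comm)
  have br: "(\<lambda>b c. counit c \<odot>\<^bsub>D\<^esub> b) \<in> bilinear_maps K D D D"
    by (rule bilinear_mapsI)
       (simp_all add: \<epsilon> D.smult_r_distr D.smult_l_distr D.smult_assoc1[symmetric] K.m_comm)
  show "lft \<in> algebra_homs K DD.T D"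
    unfolding lft_def
    by (rule DD.lift_hom[OF D_algebra bl])
       (simp_all add: \<epsilon> D.smult_mult_left D.smult_mult_right D.smult_assoc1[symmetric] K.m_comm)
  show "rgt \<in> algebra_homs K DD.T D"
    unfolding rgt_def
    by (rule DD.lift_hom[OF D_algebra br])
       (simp_all add: \<epsilon> D.smult_mult_left D.smult_mult_right D.smult_assoc1[symmetric] K.m_comm)
  show "\<lbrakk>b \<in> carrier D; c \<in> carrier D\<rbrakk> \<Longrightarrow> lft (DD.tens b c) = counit b \<odot>\<^bsub>D\<^esub> c"
    unfolding lft_def by (rule DD.lift_tens[OF D.module_axioms bl])
  show "\<lbrakk>b \<in> carrier D; c \<in> carrier D\<rbrakk> \<Longrightarrow> rgt (DD.tens b c) = counit c \<odot>\<^bsub>D\<^esub> b"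
    unfolding rgt_def by (rule DD.lift_tens[OF D.module_axioms br])
qed

text \<open>The part common to both counit axioms: a homomorphism that sends the twist to \<open>1\<close> does not see the
twisting.\<close>

lemma hom_comult_eq_id:
  assumes f: "f \<in> algebra_homs K DD.T D" and tw: "\<And>c. c \<in> carrier K \<Longrightarrow> f (tw0 c) = \<one>\<^bsub>D\<^esub>"
    and x: "f (A0 \<oplus>\<^bsub>DD.T\<^esub> B0) = x"
    and gl: "f (DD.tens u u) = u" "\<And>i. i \<in> I \<Longrightarrow> f (DD.tens (a i) (a i)) = a i"
      "\<And>i. i \<in> I \<Longrightarrow> f (DD.tens (a' i) (a' i)) = a' i"
    and h: "h \<in> carrier D"
  shows "f (comult h) = h"
proof (rule D_hom_eqI[OF D_algebra algebra_homs_comp[OF comult_hom f] _ _ _ _ _ h])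
  show "(\<lambda>h. h) \<in> algebra_homs K D D" by (auto intro!: algebra_homsI linear_mapsI)
  note f' = algebra_homsD[OF f]
  have 1: "f (tw0 \<alpha> \<star> DD.tens b b \<star> tw0 (\<ominus> \<alpha>)) = f (DD.tens b b)" if "b \<in> carrier D" for b
    using that f'(2)[of "DD.tens b b"] by (simp add: f' tw)
  show "f (comult (a i)) = a i" if "i \<in> I" for i
    unfolding comult_def comult0(4)[OF that] using that by (simp add: 1 gl)
  show "f (comult (a' i)) = a' i" if "i \<in> I" for i
    unfolding comult_def comult0(5)[OF that] using that by (simp add: 1 gl)
qed (simp_all add: comult_x x comult_u gl)

lemma counit_left:
  assumes "h \<in> carrier D"
  shows "tensor_lift K D (\<lambda>b c. counit b \<odot>\<^bsub>D\<^esub> c) (comult h) = h"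
proof (rule hom_comult_eq_id[OF counit_maps(1) _ _ _ _ _ assms])
  show "tensor_lift K D (\<lambda>b c. counit b \<odot>\<^bsub>D\<^esub> c) (tw0 c) = \<one>\<^bsub>D\<^esub>" if "c \<in> carrier K" for c
    using that A0_B0_closed
    by (simp add: hom_twist(2)[OF DD.T_algebra D_algebra root_of_unity_axioms counit_maps(1)]
        counit_maps(3) counit_q_grouplike, simp add: twist_def QD.T_n_zero_right)
qed (use A0_B0_closed in \<open>simp_all add: algebra_homsD[OF counit_maps(1)] counit_maps(3) counit_q_grouplike\<close>)

lemma counit_right:
  assumes "h \<in> carrier D"
  shows "tensor_lift K D (\<lambda>b c. counit c \<odot>\<^bsub>D\<^esub> b) (comult h) = h"
proof (rule hom_comult_eq_id[OF counit_maps(2) _ _ _ _ _ assms])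
  note hom = algebra_homsD[OF counit_maps(2)]
  have \<epsilon>1: "counit \<one>\<^bsub>D\<^esub> = \<one>"
    using algebra_homs_one[OF counit(1)] by simp
  show "tensor_lift K D (\<lambda>b c. counit c \<odot>\<^bsub>D\<^esub> b) (tw0 c) = \<one>\<^bsub>D\<^esub>" if "c \<in> carrier K" for c
    using that A0_B0_closed
    by (simp add: hom_twist(2)[OF DD.T_algebra D_algebra root_of_unity_axioms counit_maps(2)]
        counit_maps(4) counit_q_grouplike \<epsilon>1, simp add: twist_def QD.T_n_zero_left)
  show "tensor_lift K D (\<lambda>b c. counit c \<odot>\<^bsub>D\<^esub> b) (A0 \<oplus>\<^bsub>DD.T\<^esub> B0) = x"
    using A0_B0_closed by (simp add: hom counit_maps(4) counit_q_grouplike \<epsilon>1)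
qed (simp_all add: counit_maps(4) counit_q_grouplike)

subsection \<open>Coassociativity\<close>

interpretation D3: tensor K D DD.T by (intro tensorI D_algebra DD.T_algebra)
interpretation D3': tensor K DD.T D by (intro tensorI D_algebra DD.T_algebra)
interpretation Q3: q_exponential D3.T K n \<omega> by (intro q_exponential.intro D3.T_algebra root_of_unity_axioms)

abbreviation D3_mult (infixl "\<bullet>" 70) where "s \<bullet> t \<equiv> s \<otimes>\<^bsub>D3.T\<^esub> t"
abbreviation A3 where "A3 \<equiv> pure_tensor K D DD.T u A0"
abbreviation B3 where "B3 \<equiv> pure_tensor K D DD.T u B0"
abbreviation C3 where "C3 \<equiv> pure_tensor K D DD.T x \<one>\<^bsub>DD.T\<^esub>"

lemma pairs3: "Q3.pair A3 B3" "Q3.pair B3 C3" "Q3.pair A3 C3"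
proof -
  note c = A0_B0_closed and p = QQ.pairD(3-)[OF A0_B0_pair]
  have nil: "A3 [^]\<^bsub>D3.T\<^esub> n = \<zero>\<^bsub>D3.T\<^esub>" "B3 [^]\<^bsub>D3.T\<^esub> n = \<zero>\<^bsub>D3.T\<^esub>" "C3 [^]\<^bsub>D3.T\<^esub> n = \<zero>\<^bsub>D3.T\<^esub>"
    using c p by (simp_all add: D3.tens_pow D3.tens_zero D_rels)
  show "Q3.pair A3 B3"
    unfolding q_pair_def using nil c p D3.tens_commute_scaled[of u u A0 B0 \<one> \<omega>] by simp
  show "Q3.pair B3 C3"
    unfolding q_pair_def using nil c p D3.tens_commute_scaled[of u x B0 "\<one>\<^bsub>DD.T\<^esub>" \<omega> \<one>] by (simp add: D_rels)
  show "Q3.pair A3 C3"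
    unfolding q_pair_def using nil c p D3.tens_commute_scaled[of u x A0 "\<one>\<^bsub>DD.T\<^esub>" \<omega> \<one>] by (simp add: D_rels)
qed

lemma id_hom: "(\<lambda>h. h) \<in> algebra_homs K D D"
  by (auto intro!: algebra_homsI linear_mapsI)

abbreviation comult_left where
  "comult_left t \<equiv> tensor_assoc K D D D (tensor_map K DD.T D comult (\<lambda>h. h) t)"
abbreviation comult_right where
  "comult_right t \<equiv> tensor_map K D DD.T (\<lambda>h. h) comult t"
abbreviation assoc_left where
  "assoc_left s \<equiv> tensor_assoc K D D D (pure_tensor K DD.T D s \<one>\<^bsub>D\<^esub>)"

lemma comult_left_hom: "comult_left \<in> algebra_homs K DD.T D3.T"
  by (rule algebra_homs_comp[OF tensor_map_hom[OF D_algebra D_algebra DD.T_algebra D_algebra comult_hom id_hom]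
        tensor_assoc_hom[OF D_algebra D_algebra D_algebra]])

lemma comult_right_hom: "comult_right \<in> algebra_homs K DD.T D3.T"
  by (rule tensor_map_hom[OF D_algebra D_algebra D_algebra DD.T_algebra id_hom comult_hom])

lemma assoc_left_hom: "assoc_left \<in> algebra_homs K DD.T D3.T"
  by (rule algebra_homs_comp[OF D3'.tens_left_hom tensor_assoc_hom[OF D_algebra D_algebra D_algebra]])

lemma comult_left_tens:
  "\<lbrakk>b \<in> carrier D; c \<in> carrier D\<rbrakk> \<Longrightarrow>
    comult_left (DD.tens b c) = tensor_assoc K D D D (D3'.tens (comult b) c)"
  by (simp add: tensor_map_tens[OF D_algebra D_algebra DD.T_algebra D_algebra comult_hom id_hom])

lemma comult_right_tens:
  "\<lbrakk>b \<in> carrier D; c \<in> carrier D\<rbrakk> \<Longrightarrow> comult_right (DD.tens b c) = D3.tens b (comult c)"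
  by (simp add: tensor_map_tens[OF D_algebra D_algebra D_algebra DD.T_algebra id_hom comult_hom])

lemma assoc_left_tens:
  "\<lbrakk>b \<in> carrier D; c \<in> carrier D\<rbrakk> \<Longrightarrow> assoc_left (DD.tens b c) = D3.tens b (DD.tens c \<one>\<^bsub>D\<^esub>)"
  by (simp add: tensor_assoc_tens[OF D_algebra D_algebra D_algebra])

lemma assoc_left_values: "assoc_left A0 = B3" "assoc_left B0 = C3"
  by (simp_all add: assoc_left_tens DD.tens_one)

lemma comult_left_values: "comult_left A0 = A3" "comult_left B0 = B3 \<oplus>\<^bsub>D3.T\<^esub> C3"
proof -
  show "comult_left A0 = A3"
    by (simp add: comult_left_tens comult_u tensor_assoc_tens[OF D_algebra D_algebra D_algebra])
  have "comult_left B0 = assoc_left (A0 \<oplus>\<^bsub>DD.T\<^esub> B0)"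
    by (simp add: comult_left_tens comult_x)
  then show "comult_left B0 = B3 \<oplus>\<^bsub>D3.T\<^esub> C3"
    using A0_B0_closed by (simp add: algebra_homsD[OF assoc_left_hom] assoc_left_values)
qed

lemma comult_one: "comult \<one>\<^bsub>D\<^esub> = \<one>\<^bsub>DD.T\<^esub>"
  by (rule algebra_homs_one[OF comult_hom])

lemma comult_right_values: "comult_right A0 = A3 \<oplus>\<^bsub>D3.T\<^esub> B3" "comult_right B0 = C3"
  using A0_B0_closed by (simp_all add: comult_right_tens comult_x D3.tens_bilin comult_one)

text \<open>Here \<open>m = n\<close> enters. The cocycle identity speaks of \<open>u \<otimes> u \<otimes> x\<close> and
\<open>u \<otimes> x \<otimes> 1\<close>, whereas the twist in the last two tensor factors involves \<open>1 \<otimes> u \<otimes> x\<close> and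
\<open>1 \<otimes> x \<otimes> 1\<close>. The factors \<open>u\<close> in front contribute \<open>u\<^sup>n\<close>, which is \<open>1\<close> if \<open>m = n\<close>.\<close>

lemma right_factor_twist:
  assumes c: "c \<in> carrier K" and cm: "c \<noteq> \<zero> \<Longrightarrow> m = n"
  shows "D3.tens \<one>\<^bsub>D\<^esub> (tw0 c) = Q3.tw c A3 B3"
proof (cases "c = \<zero>")
  case True
  then show ?thesis
    using A0_B0_closed by (simp add: QQ.tw_0 Q3.tw_0 D3.tens_one)
next
  case False
  let ?U = "D3.tens u \<one>\<^bsub>DD.T\<^esub>" and ?A = "D3.tens \<one>\<^bsub>D\<^esub> A0" and ?B = "D3.tens \<one>\<^bsub>D\<^esub> B0"
  have cl: "?U \<in> carrier D3.T" "?A \<in> carrier D3.T" "?B \<in> carrier D3.T"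
    using A0_B0_closed by simp_all
  have "u [^]\<^bsub>D\<^esub> k = \<one>\<^bsub>D\<^esub>" if "m = k" for k
    using D_rels(1) that by blast
  from this[OF cm[OF False]] have U: "?U [^]\<^bsub>D3.T\<^esub> n = \<one>\<^bsub>D3.T\<^esub>"
    by (simp add: D3.tens_pow D3.tens_one)
  have UAB: "?U \<bullet> ?A = A3" "?A \<bullet> ?U = A3" "?U \<bullet> ?B = B3" "?B \<bullet> ?U = B3"
    using A0_B0_closed by (simp_all add: D3.tens_mult)
  have "Q3.T A3 B3 n = Q3.T ?A ?B n"
    using Q3.T_rescale[OF cl, of n] cl by (simp add: UAB U)
  then have "Q3.tw c A3 B3 = Q3.tw c ?A ?B" by (simp add: twist_def)
  also have "\<dots> = D3.tens \<one>\<^bsub>D\<^esub> (tw0 c)"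
    using hom_twist(2)[OF DD.T_algebra D3.T_algebra root_of_unity_axioms D3.tens_right_hom A0_B0_closed c] by simp
  finally show ?thesis by simp
qed

text \<open>With \<open>F\<close> the twist, one side is the conjugate of \<open>b \<otimes> b \<otimes> b\<close> by \<open>(\<Delta> \<otimes> 1)(F) (F \<otimes> 1)\<close> and the
other one the conjugate by \<open>(1 \<otimes> \<Delta>)(F) (1 \<otimes> F)\<close>. These two elements are equal by the cocycle
identity: the coproduct takes \<open>u \<otimes> x\<close> and \<open>x \<otimes> 1\<close> to sums of \<open>u \<otimes> u \<otimes> x\<close>, \<open>u \<otimes> x \<otimes> 1\<close> and
\<open>x \<otimes> 1 \<otimes> 1\<close>.\<close>

lemma coassoc_grouplike:
  assumes b: "b \<in> carrier D" and cb: "comult b = tw0 \<alpha> \<star> DD.tens b b \<star> tw0 (\<ominus> \<alpha>)"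
  shows "comult_left (comult b) = comult_right (comult b)"
proof -
  note L = algebra_homsD[OF comult_left_hom] and R = algebra_homsD[OF comult_right_hom]
    and J = algebra_homsD[OF assoc_left_hom]
  note htw = hom_twist(2)[OF DD.T_algebra D3.T_algebra root_of_unity_axioms _ A0_B0_closed]
  have bb: "DD.tens b b \<in> carrier DD.T" and \<alpha>': "\<ominus> \<alpha> \<in> carrier K" using b by auto
  note tc = tw0_closed[OF alpha_closed] tw0_closed[OF \<alpha>']
  note [simp] = Q3.pairD(1,2)[OF pairs3(1)] Q3.pairD(1,2)[OF pairs3(2)]
  let ?bbb = "D3.tens b (DD.tens b b)"
  let ?G1 = "Q3.tw \<alpha> A3 (B3 \<oplus>\<^bsub>D3.T\<^esub> C3) \<bullet> Q3.tw \<alpha> B3 C3"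
  let ?G1' = "Q3.tw (\<ominus> \<alpha>) B3 C3 \<bullet> Q3.tw (\<ominus> \<alpha>) A3 (B3 \<oplus>\<^bsub>D3.T\<^esub> C3)"
  let ?G2 = "Q3.tw \<alpha> (A3 \<oplus>\<^bsub>D3.T\<^esub> B3) C3 \<bullet> Q3.tw \<alpha> A3 B3"
  let ?G2' = "Q3.tw (\<ominus> \<alpha>) A3 B3 \<bullet> Q3.tw (\<ominus> \<alpha>) (A3 \<oplus>\<^bsub>D3.T\<^esub> B3) C3"
  have bbb: "?bbb \<in> carrier D3.T" using b by simp
  have "comult_left (DD.tens b b) = tensor_assoc K D D D (D3'.tens (tw0 \<alpha>) \<one>\<^bsub>D\<^esub> \<otimes>\<^bsub>D3'.T\<^esub> D3'.tens (DD.tens b b) b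
      \<otimes>\<^bsub>D3'.T\<^esub> D3'.tens (tw0 (\<ominus> \<alpha>)) \<one>\<^bsub>D\<^esub>)"
    unfolding comult_left_tens[OF b b] cb using b tc by (simp add: D3'.tens_mult)
  also have "\<dots> = assoc_left (tw0 \<alpha>) \<bullet> ?bbb \<bullet> assoc_left (tw0 (\<ominus> \<alpha>))"
    using b tc by (simp add: algebra_homsD[OF tensor_assoc_hom[OF D_algebra D_algebra D_algebra]]
        tensor_assoc_tens[OF D_algebra D_algebra D_algebra])
  also have "\<dots> = Q3.tw \<alpha> B3 C3 \<bullet> ?bbb \<bullet> Q3.tw (\<ominus> \<alpha>) B3 C3"
    by (simp only: htw[OF assoc_left_hom alpha_closed] htw[OF assoc_left_hom \<alpha>'] assoc_left_values)
  finally have L1: "comult_left (DD.tens b b) = \<dots>" .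
  have "comult_left (comult b) = comult_left (tw0 \<alpha>) \<bullet> comult_left (DD.tens b b) \<bullet> comult_left (tw0 (\<ominus> \<alpha>))"
    unfolding cb by (simp only: L(5) bb tc DD.T.A.m_closed)
  also have "\<dots> = ?G1 \<bullet> ?bbb \<bullet> ?G1'"
    unfolding L1 htw[OF comult_left_hom alpha_closed] htw[OF comult_left_hom \<alpha>'] comult_left_values
    using bbb by (simp add: D3.T.A.m_assoc)
  finally have left: "comult_left (comult b) = ?G1 \<bullet> ?bbb \<bullet> ?G1'" .
  have "comult_right (DD.tens b b) = D3.tens \<one>\<^bsub>D\<^esub> (tw0 \<alpha>) \<bullet> ?bbb \<bullet> D3.tens \<one>\<^bsub>D\<^esub> (tw0 (\<ominus> \<alpha>))"
    unfolding comult_right_tens[OF b b] cb using b tc by (simp add: D3.tens_mult)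
  also have "\<dots> = Q3.tw \<alpha> A3 B3 \<bullet> ?bbb \<bullet> Q3.tw (\<ominus> \<alpha>) A3 B3"
    using right_factor_twist[OF alpha_closed alpha_m] right_factor_twist[OF \<alpha>'] alpha_m by auto
  finally have R1: "comult_right (DD.tens b b) = \<dots>" .
  have "comult_right (comult b) = comult_right (tw0 \<alpha>) \<bullet> comult_right (DD.tens b b) \<bullet> comult_right (tw0 (\<ominus> \<alpha>))"
    unfolding cb by (simp only: R(5) bb tc DD.T.A.m_closed)
  also have "\<dots> = ?G2 \<bullet> ?bbb \<bullet> ?G2'"
    unfolding R1 htw[OF comult_right_hom alpha_closed] htw[OF comult_right_hom \<alpha>'] comult_right_values
    using bbb by (simp add: D3.T.A.m_assoc)
  finally have right: "comult_right (comult b) = ?G2 \<bullet> ?bbb \<bullet> ?G2'" .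
  have G: "?G1 = ?G2"
    by (rule Q3.twist_cocycle[OF pairs3 alpha_closed])
  \<comment> \<open>The conjugating elements are equal; so are their inverses.\<close>
  have pX: "Q3.pair A3 (B3 \<oplus>\<^bsub>D3.T\<^esub> C3)"
    using Q3.pairD[OF pairs3(1)] Q3.pairD[OF pairs3(3)] Q3.sum_pow_n[OF pairs3(2)]
    by (simp add: q_pair_def D3.T.A.l_distr D3.T.A.r_distr D3.T.smult_r_distr)
  have pY: "Q3.pair (A3 \<oplus>\<^bsub>D3.T\<^esub> B3) C3"
    using Q3.pairD[OF pairs3(2)] Q3.pairD[OF pairs3(3)] Q3.sum_pow_n[OF pairs3(1)]
    by (simp add: q_pair_def D3.T.A.l_distr D3.T.A.r_distr D3.T.smult_r_distr)
  have inv1: "?G1' \<bullet> ?G1 = \<one>\<^bsub>D3.T\<^esub>"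
  proof -
    have "?G1' \<bullet> ?G1 = Q3.tw (\<ominus> \<alpha>) B3 C3 \<bullet>
        (Q3.tw (\<ominus> \<alpha>) A3 (B3 \<oplus>\<^bsub>D3.T\<^esub> C3) \<bullet> Q3.tw \<alpha> A3 (B3 \<oplus>\<^bsub>D3.T\<^esub> C3)) \<bullet> Q3.tw \<alpha> B3 C3"
      by (simp add: D3.T.A.m_assoc)
    then show ?thesis by (simp add: Q3.tw_inverse[OF pX] Q3.tw_inverse[OF pairs3(2)])
  qed
  have inv2: "?G2 \<bullet> ?G2' = \<one>\<^bsub>D3.T\<^esub>"
  proof -
    have "?G2 \<bullet> ?G2' = Q3.tw \<alpha> (A3 \<oplus>\<^bsub>D3.T\<^esub> B3) C3 \<bullet>
        (Q3.tw \<alpha> A3 B3 \<bullet> Q3.tw (\<ominus> \<alpha>) A3 B3) \<bullet> Q3.tw (\<ominus> \<alpha>) (A3 \<oplus>\<^bsub>D3.T\<^esub> B3) C3"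
      by (simp add: D3.T.A.m_assoc)
    then show ?thesis by (simp add: Q3.tw_inverse[OF pY] Q3.tw_inverse[OF pairs3(1)])
  qed
  have "?G1' = ?G2'"
    by (rule D3.T.A.inv_unique[OF inv1]) (simp_all add: G inv2)
  then show ?thesis unfolding left right G by simp
qed

lemma coassoc:
  assumes "h \<in> carrier D"
  shows "comult_left (comult h) = comult_right (comult h)"
proof (rule D_hom_eqI[OF D3.T_algebra algebra_homs_comp[OF comult_hom comult_left_hom]
      algebra_homs_comp[OF comult_hom comult_right_hom] _ _ _ _ assms])
  show "comult_left (comult u) = comult_right (comult u)"
    by (rule coassoc_grouplike) (simp_all add: comult_def comult0)
  show "comult_left (comult (a i)) = comult_right (comult (a i))" if "i \<in> I" for i
    using that by (intro coassoc_grouplike) (simp_all add: comult_def comult0)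
  show "comult_left (comult (a' i)) = comult_right (comult (a' i))" if "i \<in> I" for i
    using that by (intro coassoc_grouplike) (simp_all add: comult_def comult0)
  show "comult_left (comult x) = comult_right (comult x)"
    unfolding comult_x using A0_B0_closed Q3.pairD(1,2)[OF pairs3(1)] Q3.pairD(1,2)[OF pairs3(2)]
    by (simp only: algebra_homsD[OF comult_left_hom] algebra_homsD[OF comult_right_hom]
        comult_left_values comult_right_values D3.T.M.a_assoc)
qed

subsection \<open>The antipode\<close>

text \<open>The inverse of \<open>u\<close>, kept opaque so that its exponent \<open>m - 1\<close> is not rewritten.\<close>

definition v where "v = u [^]\<^bsub>D\<^esub> (m - 1)"
abbreviation Sx where "Sx \<equiv> \<ominus>\<^bsub>D\<^esub> (v \<cdot> x)"

lemma v_closed [simp, intro]: "v \<in> carrier D"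
  by (simp add: v_def)

lemma u_v: "u \<cdot> v = \<one>\<^bsub>D\<^esub>" "v \<cdot> u = \<one>\<^bsub>D\<^esub>"
proof -
  have pm: "u [^]\<^bsub>D\<^esub> k = \<one>\<^bsub>D\<^esub>" if "k = m" for k using D_rels(1) that by blast
  have "v \<cdot> u = u [^]\<^bsub>D\<^esub> (m - 1 + 1)"
    unfolding v_def by (subst D.A.nat_pow_mult[symmetric]) simp_all
  then show 1: "v \<cdot> u = \<one>\<^bsub>D\<^esub>"
    using pm[of "m - 1 + 1"] m_gt_1 by simp
  have "u \<cdot> v = u [^]\<^bsub>D\<^esub> (1 + (m - 1))"
    unfolding v_def by (subst D.A.nat_pow_mult[symmetric]) simp_all
  then show "u \<cdot> v = \<one>\<^bsub>D\<^esub>"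
    using pm[of "1 + (m - 1)"] m_gt_1 by simp
qed

lemma omega_Unit: "\<omega> \<in> Units K"
  using q_grouplike_u by (simp add: q_grouplike_def)

lemma x_v: "x \<cdot> v = \<omega> \<odot>\<^bsub>D\<^esub> (v \<cdot> x)"
  by (rule D.inverse_commute_scaled(2)[OF _ _ _ omega_Unit u_v D_rels(3)]) simp_all

abbreviation w where "w \<equiv> \<ominus>\<^bsub>D\<^esub> v"

lemma Sx_w: "Sx = w \<cdot> x"
  by (simp add: D.A.l_minus)

lemma x_w: "x \<cdot> w = \<omega> \<odot>\<^bsub>D\<^esub> (w \<cdot> x)"
  by (simp add: D.A.l_minus D.A.r_minus x_v D.smult_r_minus)

lemma Sx_nilpotent:
  "n \<le> i + j \<Longrightarrow> Sx [^]\<^bsub>D\<^esub> i \<cdot> x [^]\<^bsub>D\<^esub> j = \<zero>\<^bsub>D\<^esub>"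
  "n \<le> i + j \<Longrightarrow> x [^]\<^bsub>D\<^esub> j \<cdot> Sx [^]\<^bsub>D\<^esub> i = \<zero>\<^bsub>D\<^esub>"
  unfolding Sx_w by (rule D.scaled_product_nilpotent[OF _ _ _ x_w D_rels(2)]; simp)+

definition antipode where
  "antipode = D_lift (opposite D) v Sx a' a"

lemma antipode_model: "D_model K m n \<omega> I q (opposite D) v Sx a' a"
  unfolding D_model_def opposite_simps
proof (intro conjI ballI)
  show "v [^]\<^bsub>opposite D\<^esub> m = \<one>\<^bsub>D\<^esub>"
  proof -
    have "v [^]\<^bsub>D\<^esub> m = (u [^]\<^bsub>D\<^esub> m) [^]\<^bsub>D\<^esub> (m - 1)"
      by (simp add: v_def D.A.nat_pow_pow mult.commute)
    then show ?thesis by (simp add: opposite_pow[OF D_algebra] D_rels)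
  qed
  show "Sx [^]\<^bsub>opposite D\<^esub> n = \<zero>\<^bsub>D\<^esub>"
    using Sx_nilpotent(1)[of n 0] by (simp add: opposite_pow[OF D_algebra])
  show "Sx \<cdot> v = \<omega> \<odot>\<^bsub>D\<^esub> (v \<cdot> Sx)"
    by (simp add: D.A.l_minus D.A.r_minus D.smult_r_minus D.A.m_assoc x_v D.smult_mult_right)
  fix i assume i: "i \<in> I"
  show "a i \<cdot> a' i = \<one>\<^bsub>D\<^esub>" "a' i \<cdot> a i = \<one>\<^bsub>D\<^esub>" using i by (simp_all add: D_rels)
  have a'v: "a' i \<cdot> v = v \<cdot> a' i"
    using D.pow_commute_scaled[of "a' i" u \<one> "m - 1"] q_grouplikeD[OF q_grouplike_a'[OF i]]
    by (simp add: v_def)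
  then show "a' i \<cdot> v = v \<cdot> a' i" .
  have xa': "x \<cdot> a' i = q i \<odot>\<^bsub>D\<^esub> (a' i \<cdot> x)"
    using i D.inverse_commute_scaled(2)[of "a i" "a' i" x "q i"] by (simp add: D_rels q_Units)
  have "Sx \<cdot> a' i = \<ominus>\<^bsub>D\<^esub> (q i \<odot>\<^bsub>D\<^esub> (v \<cdot> a' i \<cdot> x))"
    using i by (simp add: D.A.l_minus D.A.m_assoc xa' D.smult_mult_right)
  also have "\<dots> = q i \<odot>\<^bsub>D\<^esub> (a' i \<cdot> Sx)"
    using i by (simp add: a'v[symmetric] D.A.r_minus D.smult_r_minus D.A.m_assoc)
  finally show "Sx \<cdot> a' i = q i \<odot>\<^bsub>D\<^esub> (a' i \<cdot> Sx)" .
  fix j assume j: "j \<in> I"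
  have "a' i \<cdot> a j = a j \<cdot> a' i"
    using i j D.inverse_commute_scaled(1)[of "a i" "a' i" "a j" \<one>] by (simp add: D_rels)
  then show "a' j \<cdot> a' i = a' i \<cdot> a' j"
    using i j D.inverse_commute_scaled(1)[of "a j" "a' j" "a' i" \<one>] by (simp add: D_rels)
qed simp_all

lemmas antipode = D_lift[OF opposite_algebra[OF D_algebra] antipode_model, folded antipode_def]
lemmas antipode_hom = algebra_homsD[OF antipode(1), unfolded opposite_simps linear_maps_opposite]

lemma antipode_pow: "b \<in> carrier D \<Longrightarrow> antipode (b [^]\<^bsub>D\<^esub> (k::nat)) = antipode b [^]\<^bsub>D\<^esub> k"
proof -
  interpret O: assoc_algebra K "opposite D" by (rule opposite_algebra[OF D_algebra])
  assume "b \<in> carrier D"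
  then show ?thesis
    using algebra_homs_pow[OF D.A.monoid_axioms O.A.monoid_axioms antipode(1), of b k]
    by (simp add: opposite_pow[OF D_algebra] antipode_hom)
qed

definition conv_left where "conv_left = tensor_lift K D (\<lambda>b c. antipode b \<cdot> c)"
definition conv_right where "conv_right = tensor_lift K D (\<lambda>b c. b \<cdot> antipode c)"

lemma conv_linear: "conv_left \<in> linear_maps K DD.T D" "conv_right \<in> linear_maps K DD.T D"
  and conv_left_tens: "\<lbrakk>b \<in> carrier D; c \<in> carrier D\<rbrakk> \<Longrightarrow> conv_left (DD.tens b c) = antipode b \<cdot> c"
  and conv_right_tens: "\<lbrakk>b \<in> carrier D; c \<in> carrier D\<rbrakk> \<Longrightarrow> conv_right (DD.tens b c) = b \<cdot> antipode c"
proof -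
  have bl: "(\<lambda>b c. antipode b \<cdot> c) \<in> bilinear_maps K D D D"
    and br: "(\<lambda>b c. b \<cdot> antipode c) \<in> bilinear_maps K D D D"
    by (rule bilinear_mapsI, simp_all add: antipode_hom D.A.l_distr D.A.r_distr D.smult_mult_left D.smult_mult_right)+
  show "conv_left \<in> linear_maps K DD.T D" "conv_right \<in> linear_maps K DD.T D"
    unfolding conv_left_def conv_right_def
    by (rule DD.lift_linear[OF D.module_axioms bl], rule DD.lift_linear[OF D.module_axioms br])
  show "\<lbrakk>b \<in> carrier D; c \<in> carrier D\<rbrakk> \<Longrightarrow> conv_left (DD.tens b c) = antipode b \<cdot> c"
    unfolding conv_left_def by (rule DD.lift_tens[OF D.module_axioms bl])
  show "\<lbrakk>b \<in> carrier D; c \<in> carrier D\<rbrakk> \<Longrightarrow> conv_right (DD.tens b c) = b \<cdot> antipode c"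
    unfolding conv_right_def by (rule DD.lift_tens[OF D.module_axioms br])
qed

lemmas conv_left_linear = linear_mapsD[OF conv_linear(1)]
  linear_maps_zero[OF DD.T.module_axioms D.module_axioms conv_linear(1)]
lemmas conv_right_linear = linear_mapsD[OF conv_linear(2)]
  linear_maps_zero[OF DD.T.module_axioms D.module_axioms conv_linear(2)]

text \<open>\<open>S(s\<^sub>1 t\<^sub>1) s\<^sub>2 t\<^sub>2 = S(t\<^sub>1) (S(s\<^sub>1) s\<^sub>2) t\<^sub>2\<close>, and the inner factor is a scalar by assumption. In this
way the antipode axiom is inherited by products.\<close>

lemma conv_left_mult:
  assumes s: "s \<in> carrier DD.T" and t: "t \<in> carrier DD.T" and c: "c \<in> carrier K"
    and eq: "conv_left s = c \<odot>\<^bsub>D\<^esub> \<one>\<^bsub>D\<^esub>"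
  shows "conv_left (s \<star> t) = c \<odot>\<^bsub>D\<^esub> conv_left t"
proof -
  have 1: "conv_left (s \<star> DD.tens b d) = antipode b \<cdot> conv_left s \<cdot> d"
    if "b \<in> carrier D" "d \<in> carrier D" for b d
    using s that
    by (induction s rule: DD.tensor_induct)
       (simp_all add: conv_left_linear conv_left_tens DD.T.A.l_distr DD.T.smult_mult_left D.A.l_distr D.A.r_distr
         D.smult_mult_left D.smult_mult_right DD.tens_mult antipode_hom D.A.m_assoc)
  show ?thesis
    using t
  proof (induction t rule: DD.tensor_induct)
    case (smult k t)
    then show ?case
      using s c by (simp add: conv_left_linear DD.T.smult_mult_right D.smult_assoc1[symmetric] K.m_comm)
  next
    case (pure b d)
    then show ?case
      using c by (simp add: 1 eq conv_left_tens antipode_hom D.smult_mult_left D.smult_mult_right)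
  qed (use s c in \<open>simp_all add: conv_left_linear DD.T.A.r_distr D.smult_r_distr\<close>)
qed

lemma conv_right_mult:
  assumes s: "s \<in> carrier DD.T" and t: "t \<in> carrier DD.T" and c: "c \<in> carrier K"
    and eq: "conv_right t = c \<odot>\<^bsub>D\<^esub> \<one>\<^bsub>D\<^esub>"
  shows "conv_right (s \<star> t) = c \<odot>\<^bsub>D\<^esub> conv_right s"
proof -
  have 1: "conv_right (DD.tens b d \<star> t) = b \<cdot> conv_right t \<cdot> antipode d"
    if "b \<in> carrier D" "d \<in> carrier D" for b d
    using t that
    by (induction t rule: DD.tensor_induct)
       (simp_all add: conv_right_linear conv_right_tens DD.T.A.r_distr DD.T.smult_mult_right D.A.l_distr D.A.r_distr
         D.smult_mult_left D.smult_mult_right DD.tens_mult antipode_hom D.A.m_assoc)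
  show ?thesis
    using s
  proof (induction s rule: DD.tensor_induct)
    case (smult k s)
    then show ?case
      using t c by (simp add: conv_right_linear DD.T.smult_mult_left D.smult_assoc1[symmetric] K.m_comm)
  next
    case (pure b d)
    then show ?case
      using c by (simp add: 1 eq conv_right_tens antipode_hom D.smult_mult_left D.smult_mult_right)
  qed (use t c in \<open>simp_all add: conv_right_linear DD.T.A.l_distr D.smult_r_distr\<close>)
qed

text \<open>The monomial is \<open>x\<^sup>i u\<^sup>j \<otimes> x\<^sup>j\<close>. As \<open>S(x)\<close> is a multiple of \<open>u\<inverse> x\<close>, both convolutions contain \<open>i + j =
n\<close> factors \<open>x\<close>.\<close>

lemma conv_monomial:
  assumes "i + j = n"
  shows "conv_left (B0 [^]\<^bsub>DD.T\<^esub> i \<star> A0 [^]\<^bsub>DD.T\<^esub> j) = \<zero>\<^bsub>D\<^esub>"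
    and "conv_right (B0 [^]\<^bsub>DD.T\<^esub> i \<star> A0 [^]\<^bsub>DD.T\<^esub> j) = \<zero>\<^bsub>D\<^esub>"
proof -
  have mono: "B0 [^]\<^bsub>DD.T\<^esub> i \<star> A0 [^]\<^bsub>DD.T\<^esub> j = DD.tens (x [^]\<^bsub>D\<^esub> i \<cdot> u [^]\<^bsub>D\<^esub> j) (x [^]\<^bsub>D\<^esub> j)"
    by (simp add: DD.tens_pow DD.tens_mult)
  have S: "antipode (x [^]\<^bsub>D\<^esub> k) = Sx [^]\<^bsub>D\<^esub> k" "antipode (u [^]\<^bsub>D\<^esub> k) = v [^]\<^bsub>D\<^esub> k" for k :: nat
    by (simp_all add: antipode_pow antipode)
  have "conv_left (B0 [^]\<^bsub>DD.T\<^esub> i \<star> A0 [^]\<^bsub>DD.T\<^esub> j) = v [^]\<^bsub>D\<^esub> j \<cdot> (Sx [^]\<^bsub>D\<^esub> i \<cdot> x [^]\<^bsub>D\<^esub> j)"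
    unfolding mono by (simp add: conv_left_tens antipode_hom S D.A.m_assoc)
  then show "conv_left (B0 [^]\<^bsub>DD.T\<^esub> i \<star> A0 [^]\<^bsub>DD.T\<^esub> j) = \<zero>\<^bsub>D\<^esub>"
    using assms by (simp add: Sx_nilpotent(1))
  have "u \<cdot> x [^]\<^bsub>D\<^esub> i = \<omega> [^] i \<odot>\<^bsub>D\<^esub> (x [^]\<^bsub>D\<^esub> i \<cdot> u)"
    by (rule D.pow_commute_scaled) (simp_all add: D_rels)
  then have "u [^]\<^bsub>D\<^esub> j \<cdot> x [^]\<^bsub>D\<^esub> i = (\<omega> [^] i) [^] j \<odot>\<^bsub>D\<^esub> (x [^]\<^bsub>D\<^esub> i \<cdot> u [^]\<^bsub>D\<^esub> j)"
    by (intro D.pow_commute_scaled') simp_all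
  then have "(\<omega> [^] i) [^] j \<odot>\<^bsub>D\<^esub> (x [^]\<^bsub>D\<^esub> i \<cdot> u [^]\<^bsub>D\<^esub> j \<cdot> Sx [^]\<^bsub>D\<^esub> j) =
      u [^]\<^bsub>D\<^esub> j \<cdot> (x [^]\<^bsub>D\<^esub> i \<cdot> Sx [^]\<^bsub>D\<^esub> j)"
    by (simp add: D.smult_mult_left[symmetric] D.A.m_assoc[symmetric])
  also have "\<dots> = \<zero>\<^bsub>D\<^esub>"
    using assms by (simp add: Sx_nilpotent(2) add.commute)
  finally have "(\<omega> [^] i) [^] j \<odot>\<^bsub>D\<^esub> (x [^]\<^bsub>D\<^esub> i \<cdot> u [^]\<^bsub>D\<^esub> j \<cdot> Sx [^]\<^bsub>D\<^esub> j) = (\<omega> [^] i) [^] j \<odot>\<^bsub>D\<^esub> \<zero>\<^bsub>D\<^esub>"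
    by simp
  moreover have "(\<omega> [^] i) [^] j \<noteq> \<zero>"
  proof -
    have nonzero: "c [^] k \<noteq> \<zero>" if "c \<in> carrier K" "c \<noteq> \<zero>" for c and k :: nat
      using that by (induction k) (simp_all add: K.integral_iff)
    have "\<omega> \<noteq> \<zero>" using omega_Unit K.field_Units by simp
    then have "\<omega> [^] i \<noteq> \<zero>" by (rule nonzero[OF omega_closed])
    then show ?thesis by (rule nonzero[rotated]) simp
  qed
  ultimately have "x [^]\<^bsub>D\<^esub> i \<cdot> u [^]\<^bsub>D\<^esub> j \<cdot> Sx [^]\<^bsub>D\<^esub> j = \<zero>\<^bsub>D\<^esub>"
    by (intro D.smult_cancel[of "(\<omega> [^] i) [^] j" _ "\<zero>\<^bsub>D\<^esub>"]) simp_all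
  then show "conv_right (B0 [^]\<^bsub>DD.T\<^esub> i \<star> A0 [^]\<^bsub>DD.T\<^esub> j) = \<zero>\<^bsub>D\<^esub>"
    unfolding mono by (simp add: conv_right_tens S)
qed

lemma conv_tw:
  assumes f: "f \<in> linear_maps K DD.T D" and one: "f (DD.tens \<one>\<^bsub>D\<^esub> \<one>\<^bsub>D\<^esub>) = \<one>\<^bsub>D\<^esub>"
    and mono: "\<And>i j. i + j = n \<Longrightarrow> f (B0 [^]\<^bsub>DD.T\<^esub> i \<star> A0 [^]\<^bsub>DD.T\<^esub> j) = \<zero>\<^bsub>D\<^esub>"
    and c: "c \<in> carrier K"
  shows "f (tw0 c) = \<one> \<odot>\<^bsub>D\<^esub> \<one>\<^bsub>D\<^esub>"
proof -
  note fl = linear_mapsD[OF f] linear_maps_zero[OF DD.T.module_axioms D.module_axioms f]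
  have vanish: "f (QQ.dp B0 i \<star> QQ.dp A0 (n - i)) = \<zero>\<^bsub>D\<^esub>" if "i \<in> {..n}" for i
  proof (cases "i = 0 \<or> i = n")
    case True
    then show ?thesis using A0_B0_closed by (auto simp: fl)
  next
    case False
    with that have "i < n" "n - i < n" "i + (n - i) = n" by auto
    then show ?thesis
      using A0_B0_closed mono[of i "n - i"]
      by (simp add: divided_power_def DD.T.smult_mult_left DD.T.smult_mult_right fl)
  qed
  have "f (QQ.T A0 B0 n) = (\<Oplus>\<^bsub>D\<^esub>i\<in>{..n}. f (QQ.dp B0 i \<star> QQ.dp A0 (n - i)))"
    unfolding exp_coeff_def
    by (rule linear_maps_finsum[OF DD.T.module_axioms D.module_axioms f]) (use A0_B0_closed in auto)
  also have "\<dots> = \<zero>\<^bsub>D\<^esub>"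
    by (rule D.M.add.finprod_one_eqI) (rule vanish)
  finally show ?thesis
    using c A0_B0_closed one by (simp add: twist_def fl DD.tens_one)
qed

lemma antipode_one: "antipode \<one>\<^bsub>D\<^esub> = \<one>\<^bsub>D\<^esub>"
  using algebra_homs_one[OF antipode(1)] by simp

lemma conv_tw0:
  assumes "c \<in> carrier K"
  shows "conv_left (tw0 c) = \<one> \<odot>\<^bsub>D\<^esub> \<one>\<^bsub>D\<^esub>" "conv_right (tw0 c) = \<one> \<odot>\<^bsub>D\<^esub> \<one>\<^bsub>D\<^esub>"
  using conv_tw[OF conv_linear(1) _ conv_monomial(1) assms] conv_tw[OF conv_linear(2) _ conv_monomial(2) assms]
  by (simp_all add: conv_left_tens conv_right_tens antipode_one)

text \<open>Convolution sends twists to \<open>1\<close>, but it is not multiplicative: from the left it allows a twist to be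
removed on the left, from the right one on the right. For the first the conjugate is written as a
twist times \<open>b \<otimes> b\<close>, for the second the left twist is moved past \<open>b \<otimes> b\<close>, which changes its
parameter by \<open>\<rho>\<^sup>-\<^sup>n\<close>.\<close>

lemma conv_grouplike:
  assumes b: "q_grouplike b \<rho>" and S: "antipode b \<cdot> b = \<one>\<^bsub>D\<^esub>" "b \<cdot> antipode b = \<one>\<^bsub>D\<^esub>"
  defines "t \<equiv> tw0 \<alpha> \<star> DD.tens b b \<star> tw0 (\<ominus> \<alpha>)"
  shows "conv_left t = \<one>\<^bsub>D\<^esub>" and "conv_right t = \<one>\<^bsub>D\<^esub>"
proof -
  note bD = q_grouplikeD[OF b]
  let ?bb = "DD.tens b b" and ?\<sigma> = "inv \<rho> [^] n"
  have inv: "inv \<rho> \<in> carrier K" and \<alpha>': "\<ominus> \<alpha> \<in> carrier K" using bD by auto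
  have c: "\<alpha> \<otimes> (\<one> \<ominus> \<rho> [^] n) \<in> carrier K" using bD by simp
  have bb: "conv_left ?bb = \<one>\<^bsub>D\<^esub>" "conv_right ?bb = \<one>\<^bsub>D\<^esub>"
    using bD by (simp_all add: conv_left_tens conv_right_tens S)
  have "t = tw0 (\<alpha> \<otimes> (\<one> \<ominus> \<rho> [^] n)) \<star> ?bb"
    unfolding t_def by (rule conj_grouplike[OF b])
  then show "conv_left t = \<one>\<^bsub>D\<^esub>"
    using conv_left_mult[OF tw0_closed[OF c] bD(6) K.one_closed conv_tw0(1)[OF c]] by (simp add: bb)
  have "(\<rho> \<otimes> inv \<rho>) [^] n = \<rho> [^] n \<otimes> ?\<sigma>"
    using bD inv by (intro K.nat_pow_distrib)
  then have "?\<sigma> \<otimes> \<rho> [^] n = \<one>" using bD inv by (simp add: K.m_comm)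
  then have "\<alpha> \<otimes> ?\<sigma> \<otimes> \<rho> [^] n = \<alpha>" using bD inv by (simp add: K.m_assoc)
  then have "tw0 \<alpha> \<star> ?bb = ?bb \<star> tw0 (\<alpha> \<otimes> ?\<sigma>)"
    using q_grouplike_tw[OF b, of "\<alpha> \<otimes> ?\<sigma>"] inv by simp
  then have "conv_right (tw0 \<alpha> \<star> ?bb) = \<one>\<^bsub>D\<^esub>"
    using conv_right_mult[OF bD(6) tw0_closed K.one_closed conv_tw0(2), of "\<alpha> \<otimes> ?\<sigma>"] inv by (simp add: bb)
  then show "conv_right t = \<one>\<^bsub>D\<^esub>"
    unfolding t_def
    using conv_right_mult[OF DD.T.A.m_closed[OF tw0_closed[OF alpha_closed] bD(6)] tw0_closed[OF \<alpha>'] K.one_closed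
        conv_tw0(2)[OF \<alpha>']] by simp
qed

lemma conv_generator:
  assumes "g \<in> S"
  shows "conv_left (comult (Dg g)) = counit (Dg g) \<odot>\<^bsub>D\<^esub> \<one>\<^bsub>D\<^esub>"
    and "conv_right (comult (Dg g)) = counit (Dg g) \<odot>\<^bsub>D\<^esub> \<one>\<^bsub>D\<^esub>"
proof -
  have "conv_left (comult (Dg g)) = counit (Dg g) \<odot>\<^bsub>D\<^esub> \<one>\<^bsub>D\<^esub> \<and>
    conv_right (comult (Dg g)) = counit (Dg g) \<odot>\<^bsub>D\<^esub> \<one>\<^bsub>D\<^esub>"
    using assms
  proof (cases rule: gen_cases)
    case 1
    then show ?thesis
      using conv_grouplike[OF q_grouplike_u] by (simp add: comult_def comult0 antipode u_v counit_q_grouplike)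
  next
    case 2
    have "u \<cdot> Sx = \<ominus>\<^bsub>D\<^esub> (u \<cdot> v \<cdot> x)" by (simp add: D.A.r_minus D.A.m_assoc)
    then have "u \<cdot> Sx = \<ominus>\<^bsub>D\<^esub> x" by (simp add: u_v)
    then show ?thesis
      unfolding 2 comult_x using A0_B0_closed
      by (simp add: conv_left_linear conv_right_linear conv_left_tens conv_right_tens antipode antipode_one
          counit_q_grouplike D.M.r_neg D.M.l_neg)
  next
    case (3 i)
    then show ?thesis
      using conv_grouplike[OF q_grouplike_a] by (simp add: comult_def comult0 antipode D_rels counit_q_grouplike)
  next
    case (4 i)
    then show ?thesis
      using conv_grouplike[OF q_grouplike_a'] by (simp add: comult_def comult0 antipode D_rels counit_q_grouplike)
  qed
  then show "conv_left (comult (Dg g)) = counit (Dg g) \<odot>\<^bsub>D\<^esub> \<one>\<^bsub>D\<^esub>"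
    and "conv_right (comult (Dg g)) = counit (Dg g) \<odot>\<^bsub>D\<^esub> \<one>\<^bsub>D\<^esub>" by auto
qed

lemma Dg_closed: "g \<in> S \<Longrightarrow> Dg g \<in> carrier D"
  by (cases rule: gen_cases) auto

lemma antipode_axiom:
  assumes "h \<in> carrier D"
  shows "conv_left (comult h) = counit h \<odot>\<^bsub>D\<^esub> \<one>\<^bsub>D\<^esub>" and "conv_right (comult h) = counit h \<odot>\<^bsub>D\<^esub> \<one>\<^bsub>D\<^esub>"
proof -
  note \<Delta> = algebra_homsD[OF comult_hom] algebra_homs_zero[OF D_algebra DD.T_algebra comult_hom]
  note \<epsilon> = algebra_homsD[OF counit(1), unfolded ground_algebra_simps]
    algebra_homs_zero[OF D_algebra ground_algebra_algebra[OF K.field_axioms] counit(1), unfolded ground_algebra_simps]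
  have "conv_left (comult h) = counit h \<odot>\<^bsub>D\<^esub> \<one>\<^bsub>D\<^esub> \<and> conv_right (comult h) = counit h \<odot>\<^bsub>D\<^esub> \<one>\<^bsub>D\<^esub>"
    using assms
  proof (induction h rule: D_induct)
    case (gen g h)
    note c = \<Delta>(2)[OF Dg_closed[OF gen(1)]] \<Delta>(2)[OF gen(2)] \<epsilon>(2)[OF Dg_closed[OF gen(1)]] \<epsilon>(2)[OF gen(2)]
    have "conv_left (comult (Dg g \<cdot> h)) = counit (Dg g) \<odot>\<^bsub>D\<^esub> (counit h \<odot>\<^bsub>D\<^esub> \<one>\<^bsub>D\<^esub>)"
      using conv_left_mult[OF c(1,2,3) conv_generator(1)[OF gen(1)]] gen by (simp add: \<Delta> Dg_closed)
    moreover have "conv_right (comult (Dg g \<cdot> h)) = counit h \<odot>\<^bsub>D\<^esub> (counit (Dg g) \<odot>\<^bsub>D\<^esub> \<one>\<^bsub>D\<^esub>)"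
      using conv_right_mult[OF c(1,2,4)] conv_generator(2)[OF gen(1)] gen by (simp add: \<Delta> Dg_closed)
    ultimately show ?case
      using c gen by (simp add: \<epsilon> Dg_closed D.smult_assoc1[symmetric] K.m_comm)
  qed (simp_all add: \<Delta> \<epsilon> conv_left_linear conv_right_linear D.smult_l_distr D.smult_assoc1
      DD.tens_one conv_left_tens conv_right_tens antipode_one)
  then show "conv_left (comult h) = counit h \<odot>\<^bsub>D\<^esub> \<one>\<^bsub>D\<^esub>" and "conv_right (comult h) = counit h \<odot>\<^bsub>D\<^esub> \<one>\<^bsub>D\<^esub>" by auto
qed

lemma D_hopf_algebra: "hopf_algebra K D comult counit antipode"
proof (intro hopf_algebra.intro bialgebra.intro bialgebra_axioms.intro hopf_algebra_axioms.intro D_algebra)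
  show "comult \<in> algebra_homs K D (tensor_algebra K D D)" by (rule comult_hom)
  show "counit \<in> algebra_homs K D (ground_algebra K)" by (rule counit(1))
  show "antipode \<in> linear_maps K D D" by (rule antipode_hom(1))
qed (simp_all add: coassoc counit_left counit_right antipode_axiom[unfolded conv_left_def conv_right_def])

lemma D_formulas: "D_structure_formulas K m n \<omega> I q \<alpha> comult counit antipode"
  unfolding D_structure_formulas_def Let_def
  by (simp add: comult_u comult_x comult_a counit antipode v_def)

lemma structure_unique:
  assumes H: "hopf_algebra K D \<Delta> \<epsilon> S'" "D_structure_formulas K m n \<omega> I q \<alpha> \<Delta> \<epsilon> S'"
    and H': "hopf_algebra K D \<Delta>' \<epsilon>' S''" "D_structure_formulas K m n \<omega> I q \<alpha> \<Delta>' \<epsilon>' S''"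
    and h: "h \<in> carrier D"
  shows "\<Delta> h = \<Delta>' h \<and> \<epsilon> h = \<epsilon>' h \<and> S' h = S'' h"
proof -
  interpret H: hopf_algebra K D \<Delta> \<epsilon> S' by (rule H)
  interpret H': hopf_algebra K D \<Delta>' \<epsilon>' S'' by (rule H')
  have \<Delta>: "\<Delta> h = \<Delta>' h" if "h \<in> carrier D" for h
    by (rule D_hom_eqI[OF DD.T_algebra H.comult_hom H'.comult_hom _ _ _ _ that])
       (use H(2) H'(2) in \<open>simp_all add: D_structure_formulas_def Let_def\<close>)
  have \<epsilon>: "\<epsilon> h = \<epsilon>' h" if "h \<in> carrier D" for h
    by (rule D_hom_eqI[OF ground_algebra_algebra[OF K.field_axioms] H.counit_hom H'.counit_hom _ _ _ _ that])
       (use H(2) H'(2) in \<open>simp_all add: D_structure_formulas_def Let_def\<close>)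
  show ?thesis
    using antipode_unique[OF H(1) H'(1) \<Delta>[symmetric] \<epsilon>[symmetric] h] \<Delta>[OF h] \<epsilon>[OF h] by simp
qed

end

theorem theorem3p4:
  fixes K :: "('k, 'z) ring_scheme" and m n :: nat and \<omega> \<alpha> :: 'k and I :: "'i set" and q :: "'i \<Rightarrow> 'k"
  assumes "field K"
    and "m > 1" and "n > 1" and "n dvd m"
    and "primitive_root_of_unity K n \<omega>"
    and "I \<noteq> {}"
    and "\<And>i. i \<in> I \<Longrightarrow> q i \<in> Units K"
    and "\<alpha> \<in> carrier K"
    and "\<alpha> \<noteq> \<zero>\<^bsub>K\<^esub> \<Longrightarrow> m = n"
  shows "(\<exists>\<Delta> \<epsilon> S. hopf_algebra K (D_algebra K m n \<omega> I q) \<Delta> \<epsilon> S \<and>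
            D_structure_formulas K m n \<omega> I q \<alpha> \<Delta> \<epsilon> S) \<and>
         (\<forall>\<Delta> \<epsilon> S \<Delta>' \<epsilon>' S'.
            hopf_algebra K (D_algebra K m n \<omega> I q) \<Delta> \<epsilon> S \<and>
            D_structure_formulas K m n \<omega> I q \<alpha> \<Delta> \<epsilon> S \<and>
            hopf_algebra K (D_algebra K m n \<omega> I q) \<Delta>' \<epsilon>' S' \<and>
            D_structure_formulas K m n \<omega> I q \<alpha> \<Delta>' \<epsilon>' S' \<longrightarrow>
            (\<forall>h\<in>carrier (D_algebra K m n \<omega> I q). \<Delta> h = \<Delta>' h \<and> \<epsilon> h = \<epsilon>' h \<and> S h = S' h))"
proof -
  interpret K: field K by fact
  interpret D_hopf K n \<omega> m I q \<alpha>
    using assms by unfold_locales auto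
  show ?thesis
    using D_hopf_algebra D_formulas structure_unique by blast
qed

end
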